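(* Let $E,F$ be complex Banach spaces, $U\subseteq E$ open, $v$ a weight on $U$, $p\in[1,\infty)$, and $f\in\mathcal H_v^\infty(U,F)$. The following are equivalent: (i) $f\in\mathcal H^\infty_{v\mathcal K_p}(U,F)$; (ii) there exist a closed subspace $M\subseteq\ell_p$ and operators $R\in\mathcal{QN}_p(F^*,M)$ and $S\in\mathcal L(M,\mathcal H_v^\infty(U))$ such that $f^t=S\circ R$.
   Context: A weight on $U$ is a strictly positive continuous function. $\mathcal H_v^\infty(U,F)$ is the Banach space of holomorphic $f\colon U\to F$ with $\|f\|_v:=\sup_{x\in U}v(x)\|f(x)\|<\infty$; $\mathcal H_v^\infty(U):=\mathcal H_v^\infty(U,\mathbb C)$. $\mathcal L(X,Y)$ denotes the bounded linear operators. The transpose of $f\in\mathcal H_v^\infty(U,F)$ is the bounded linear operator $f^t\colon F^*\to\mathcal H_v^\infty(U)$, $f^t(y^* )=y^*\circ f$. $p^*$ is the conjugate index of $p$. For a Banach space $X$, $\ell_p(X)$ is the space of sequences in $X$ with $\|(x_n)\|_p=(\sum\|x_n\|^p)^{1/p}<\infty$. For $(x_n)\in\ell_p(X)$, $p\text{-}\mathrm{conv}(x_n)=\{\sum_n a_nx_n:(a_n)\in B\}$, where $B=B_{\ell_{p^*}}$ if $1<p<\infty$ and $B=B_{c_0}$ if $p=1$. A set $K\subseteq X$ is relatively $p$-compact if $K\subseteq p\text{-}\mathrm{conv}(x_n)$ for some $(x_n)\in\ell_p(X)$. $\mathcal H^\infty_{v\mathcal K_p}(U,F)$ is the set of $f\in\mathcal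 H_v^\infty(U,F)$ such that $(vf)(U)=\{v(x)f(x):x\in U\}$ is relatively $p$-compact. An operator $T\in\mathcal L(X,Y)$ is quasi $p$-nuclear, $T\in\mathcal{QN}_p(X,Y)$, if there is $(x_n^* )\in\ell_p(X^* )$ with $\|T(x)\|\le(\sum_n|x_n^*(x)|^p)^{1/p}$ for all $x\in X$. *)

theory Defs
  imports "HOL-Complex_Analysis.Complex_Analysis" "HOL-Library.Function_Algebras"
begin

section \<open>Complex Banach spaces\<close>

class complex_vector = ab_group_add +
  fixes scaleC :: "complex \<Rightarrow> 'a \<Rightarrow> 'a"  (infixr \<open>*\<^sub>C\<close> 75)
  assumes scaleC_add_right: "a *\<^sub>C (x + y) = a *\<^sub>C x + a *\<^sub>C y"
    and scaleC_add_left: "(a + b) *\<^sub>C x = a *\<^sub>C x + b *\<^sub>C x"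
    and scaleC_scaleC: "a *\<^sub>C b *\<^sub>C x = (a * b) *\<^sub>C x"
    and scaleC_one: "1 *\<^sub>C x = x"

interpretation complex_vector: vector_space "scaleC :: complex \<Rightarrow> 'a \<Rightarrow> 'a::complex_vector"
  by unfold_locales (simp_all add: scaleC_add_right scaleC_add_left scaleC_scaleC scaleC_one)

class complex_normed_vector = complex_vector + real_normed_vector +
  assumes scaleC_of_real: "complex_of_real r *\<^sub>C x = r *\<^sub>R x"
    and norm_scaleC: "norm (a *\<^sub>C x) = cmod a * norm x"

class complex_banach = complex_normed_vector + complete_space

subclass (in complex_banach) banach ..

instantiation complex :: complex_banach
begin
definition scaleC_complex :: "complex \<Rightarrow> complex \<Rightarrow> complex" where
  "scaleC_complex a x = a * x"
instance
  by standard (simp_all add: scaleC_complex_def distrib_left distrib_right norm_mult scaleR_conv_of_real)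
end

instantiation "fun" :: (type, complex_vector) complex_vector
begin
definition scaleC_fun :: "complex \<Rightarrow> ('a \<Rightarrow> 'b) \<Rightarrow> 'a \<Rightarrow> 'b" where
  "scaleC_fun a f = (\<lambda>x. a *\<^sub>C f x)"
instance
  by standard
    (simp_all add: scaleC_fun_def fun_eq_iff scaleC_add_right scaleC_add_left scaleC_scaleC scaleC_one)
end

section \<open>Normed spaces on a carrier\<close>

text \<open>
  Dual spaces, sequence spaces (for a real exponent), their subspaces and weighted spaces of
  holomorphic functions are not types. They are given by a linear subspace of an ambient vector
  space together with a norm on it. A function on a subset of a type is represented by its
  extension by zero, so that equality in these spaces is equality of functions.
\<close>

record 'a nspace =
  carrier :: "'a set"
  nrm :: "'a \<Rightarrow> real"

definition whole_space :: "'a::complex_normed_vector nspace" where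
  "whole_space = \<lparr>carrier = UNIV, nrm = norm\<rparr>"

definition closed_subspace :: "'a::complex_vector nspace \<Rightarrow> 'a set \<Rightarrow> bool" where
  "closed_subspace X M \<longleftrightarrow> complex_vector.subspace M \<and>
     closedin (Metric_space.mtopology (carrier X) (\<lambda>x y. nrm X (x - y))) M"

definition subspace_of :: "'a nspace \<Rightarrow> 'a set \<Rightarrow> 'a nspace" where
  "subspace_of X M = \<lparr>carrier = M, nrm = nrm X\<rparr>"

definition bounded_ops ::
    "'a::complex_vector nspace \<Rightarrow> 'b::complex_vector nspace \<Rightarrow> ('a \<Rightarrow> 'b) set" where
  "bounded_ops X Y = {T.
     (\<forall>x\<in>carrier X. T x \<in> carrier Y) \<and>
     (\<forall>x\<in>carrier X. \<forall>y\<in>carrier X. T (x + y) = T x + T y) \<and>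
     (\<forall>c. \<forall>x\<in>carrier X. T (c *\<^sub>C x) = c *\<^sub>C T x) \<and>
     (\<exists>C. \<forall>x\<in>carrier X. nrm Y (T x) \<le> C * nrm X x) \<and>
     (\<forall>x. x \<notin> carrier X \<longrightarrow> T x = 0)}"

definition op_norm :: "'a nspace \<Rightarrow> 'b nspace \<Rightarrow> ('a \<Rightarrow> 'b) \<Rightarrow> real" where
  "op_norm X Y T = (SUP x\<in>{x\<in>carrier X. nrm X x \<le> 1}. nrm Y (T x))"

definition dual_space :: "'a::complex_vector nspace \<Rightarrow> ('a \<Rightarrow> complex) nspace" where
  "dual_space X =
     \<lparr>carrier = bounded_ops X whole_space, nrm = op_norm X whole_space\<rparr>"

section \<open>Sequence spaces, \<open>p\<close>-compactness, quasi \<open>p\<close>-nuclear operators\<close>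

definition ell :: "real \<Rightarrow> 'a nspace \<Rightarrow> (nat \<Rightarrow> 'a) nspace" where
  "ell p X =
     \<lparr>carrier = {x. (\<forall>n. x n \<in> carrier X) \<and> summable (\<lambda>n. nrm X (x n) powr p)},
      nrm = (\<lambda>x. (\<Sum>n. nrm X (x n) powr p) powr (1 / p))\<rparr>"

abbreviation ell_scalar :: "real \<Rightarrow> (nat \<Rightarrow> complex) nspace" where
  "ell_scalar p \<equiv> ell p whole_space"

definition conjugate_index :: "real \<Rightarrow> real" where
  "conjugate_index p = p / (p - 1)"

definition coeff_ball :: "real \<Rightarrow> (nat \<Rightarrow> complex) set" where
  "coeff_ball p =
     (if p = 1 then {a. a \<longlonglongrightarrow> 0 \<and> (\<forall>n. cmod (a n) \<le> 1)}
      else {a \<in> carrier (ell_scalar (conjugate_index p)).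
              nrm (ell_scalar (conjugate_index p)) a \<le> 1})"

definition p_conv :: "real \<Rightarrow> (nat \<Rightarrow> 'a::complex_normed_vector) \<Rightarrow> 'a set" where
  "p_conv p x = {y. \<exists>a\<in>coeff_ball p. (\<lambda>n. a n *\<^sub>C x n) sums y}"

definition relatively_p_compact :: "real \<Rightarrow> 'a::complex_normed_vector set \<Rightarrow> bool" where
  "relatively_p_compact p K \<longleftrightarrow> (\<exists>x\<in>carrier (ell p whole_space). K \<subseteq> p_conv p x)"

definition quasi_nuclear ::
    "real \<Rightarrow> 'a::complex_vector nspace \<Rightarrow> 'b::complex_vector nspace \<Rightarrow> ('a \<Rightarrow> 'b) set" where
  "quasi_nuclear p X Y = {T \<in> bounded_ops X Y.
     \<exists>\<xi>\<in>carrier (ell p (dual_space X)).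
       \<forall>x\<in>carrier X. nrm Y (T x) \<le> (\<Sum>n. cmod (\<xi> n x) powr p) powr (1 / p)}"

section \<open>Weighted spaces of holomorphic mappings\<close>

definition is_weight :: "'e::topological_space set \<Rightarrow> ('e \<Rightarrow> real) \<Rightarrow> bool" where
  "is_weight U v \<longleftrightarrow> continuous_on U v \<and> (\<forall>x\<in>U. v x > 0)"

definition holomorphic_map ::
    "('e::complex_normed_vector \<Rightarrow> 'f::complex_normed_vector) \<Rightarrow> 'e set \<Rightarrow> bool" where
  "holomorphic_map f U \<longleftrightarrow>
     (\<forall>x\<in>U. \<exists>D. (f has_derivative D) (at x) \<and> (\<forall>c h. D (c *\<^sub>C h) = c *\<^sub>C D h))"

lemma holomorphic_map_iff_holomorphic_on:
  assumes "open U"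
  shows "holomorphic_map f U \<longleftrightarrow> f holomorphic_on U"
proof -
  have "(\<exists>D. (f has_derivative D) (at x) \<and> (\<forall>c h. D (c *\<^sub>C h) = c *\<^sub>C D h))
        \<longleftrightarrow> f field_differentiable (at x)" for x
  proof
    assume "\<exists>D. (f has_derivative D) (at x) \<and> (\<forall>c h. D (c *\<^sub>C h) = c *\<^sub>C D h)"
    then obtain D where D: "(f has_derivative D) (at x)" "\<And>c h. D (c * h) = c * D h"
      by (auto simp: scaleC_complex_def)
    have "D = (*) (D 1)"
    proof
      fix h show "D h = D 1 * h"
        using D(2)[of h 1] by (metis mult.commute mult_1_right)
    qed
    with D(1) have "(f has_derivative (*) (D 1)) (at x)"
      by simp
    then show "f field_differentiable (at x)"
      unfolding field_differentiable_def has_field_derivative_def by blast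
  next
    assume "f field_differentiable (at x)"
    then obtain d where "(f has_derivative (*) d) (at x)"
      unfolding field_differentiable_def has_field_derivative_def by blast
    then show "\<exists>D. (f has_derivative D) (at x) \<and> (\<forall>c h. D (c *\<^sub>C h) = c *\<^sub>C D h)"
      by (intro exI[of _ "(*) d"]) (simp add: scaleC_complex_def mult.left_commute)
  qed
  then show ?thesis
    using assms by (auto simp: holomorphic_map_def holomorphic_on_def at_within_open[OF _ assms])
qed

text \<open>The \<open>0\<close> inserted in the supremum only matters for empty \<open>U\<close>, where the norm is \<open>0\<close>.\<close>

definition H_weighted ::
    "'e::complex_normed_vector set \<Rightarrow> ('e \<Rightarrow> real) \<Rightarrow> ('e \<Rightarrow> 'f::complex_normed_vector) nspace" where
  "H_weighted U v =
     \<lparr>carrier = {f. holomorphic_map f U \<and> bdd_above ((\<lambda>x. v x * norm (f x)) ` U) \<and>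
                    (\<forall>x. x \<notin> U \<longrightarrow> f x = 0)},
      nrm = (\<lambda>f. Sup (insert 0 ((\<lambda>x. v x * norm (f x)) ` U)))\<rparr>"

definition H_weighted_p_compact ::
    "real \<Rightarrow> 'e::complex_normed_vector set \<Rightarrow> ('e \<Rightarrow> real) \<Rightarrow>
     ('e \<Rightarrow> 'f::complex_normed_vector) set" where
  "H_weighted_p_compact p U v =
     {f \<in> carrier (H_weighted U v). relatively_p_compact p ((\<lambda>x. v x *\<^sub>R f x) ` U)}"

definition transpose_map ::
    "('e \<Rightarrow> 'f::complex_normed_vector) \<Rightarrow> ('f \<Rightarrow> complex) \<Rightarrow> 'e \<Rightarrow> complex" where
  "transpose_map f \<phi> = (if \<phi> \<in> carrier (dual_space whole_space) then \<phi> \<circ> f else 0)"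

end

theory Submission
  imports Defs
begin

text \<open>
  If \<open>v f\<close> takes its values in the \<open>p\<close>-convex hull of \<open>(x\<^sub>n)\<close>, one takes \<open>R \<phi> = (\<phi> x\<^sub>n)\<close>
  and for \<open>M\<close> the closure of the range of \<open>R\<close> in \<open>\<ell>\<^sub>p\<close>. The coefficients of \<open>v(z) f(z)\<close> define
  \<open>S\<close> on \<open>M\<close>, and \<open>S m\<close> is holomorphic as a locally uniform limit of the functions \<open>\<phi> \<circ> f\<close>.

  Conversely, a factorization gives \<open>|\<phi> k| \<le> \<parallel>(\<xi>\<^sub>n \<phi>)\<parallel>\<^sub>p\<close> for all \<open>k = v(z) f(z)\<close> and all functionals
  \<open>\<phi>\<close>, but with \<open>\<xi>\<^sub>n\<close> in the bidual of \<open>F\<close>. By the Hahn--Banach theorem \<open>k = \<Sum> a\<^sub>n(k) \<xi>\<^sub>n\<close> with \<open>a(k)\<close> in the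
  unit ball of the dual of \<open>\<ell>\<^sub>p\<close>. The first \<open>N\<close> coefficients of all \<open>k\<close> lie within \<open>\<delta>\<close> of those of
  finitely many \<open>k\<^sub>i\<close>. A Helly type argument provides \<open>y\<^sub>n\<close> in \<open>F\<close>, with norms at most twice those of
  the \<open>\<xi>\<^sub>n\<close>, such that \<open>k\<^sub>i\<close> is almost equal to \<open>\<Sum> a\<^sub>n(k\<^sub>i) y\<^sub>n\<close> for all \<open>i\<close>, and then all the remainders
  \<open>k - \<Sum> a\<^sub>n(k) y\<^sub>n\<close> satisfy an estimate of the original form with an arbitrarily small sequence
  in the bidual. Iterating this and summing up yields a sequence in \<open>\<ell>\<^sub>p(F)\<close>.
\<close>

text \<open>The obstacle is that \<open>R\<close> acts on the dual of F, so the functionals bounding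
  it lie in the bidual and need not come from F. A Helly step treats only finitely many elements,
  and these only up to an error. The net makes finitely many suffice: if the coefficients of k and
  k_i differ by at most \<delta> on the first N places, the difference of their remainders is
  controlled by these differences and by the p-small tail of the functionals, while the remainder of
  k_i is small in norm. All contributions together are again dominated by the l_p norm of a sequence
  in the bidual, so the step can be repeated. From j = 1 on the bounds of stage j are at most
  4^(-j). This leaves room to multiply its vectors by 2^(j+1) and to divide its coefficients by the
  same number: the vectors stay p-summable, the coefficients of all stages together stay in the dual
  ball because the factors 2^(-j-1) add up to one, and they tend to zero because each stage uses
  finitely many vectors. The last point settles p = 1, where the hull is taken over c_0 but the
  Hahn-Banach theorem yields coefficients in l_infinity only.\<close>

section \<open>The Hahn--Banach theorem\<close>

text \<open>Functionals are extended as graphs: a linear subspace of pairs \<open>(x, t)\<close> with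
  \<open>t \<le> q x\<close> is automatically single valued, since \<open>(0, t)\<close> and \<open>(0, -t)\<close> both
  belong to it.\<close>

definition dominated_graph :: "'a::complex_vector set \<Rightarrow> ('a \<Rightarrow> real) \<Rightarrow> ('a \<times> real) set \<Rightarrow> bool" where
  "dominated_graph V q G \<longleftrightarrow>
     (\<forall>x t. (x, t) \<in> G \<longrightarrow> x \<in> V \<and> t \<le> q x) \<and>
     (0, 0) \<in> G \<and>
     (\<forall>x t y s. (x, t) \<in> G \<longrightarrow> (y, s) \<in> G \<longrightarrow> (x + y, t + s) \<in> G) \<and>
     (\<forall>x t r. (x, t) \<in> G \<longrightarrow> (of_real r *\<^sub>C x, r * t) \<in> G)"

lemma dominated_graph_functional:
  assumes "dominated_graph V q G" "(x, t) \<in> G" "(x, s) \<in> G" "q 0 = 0"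
  shows "t = s"
proof -
  have neg: "(of_real (-1) *\<^sub>C x, -1 * t) \<in> G" "(of_real (-1) *\<^sub>C x, -1 * s) \<in> G"
    using assms unfolding dominated_graph_def by blast+
  have "(x + of_real (-1) *\<^sub>C x, t + -1 * s) \<in> G" "(x + of_real (-1) *\<^sub>C x, s + -1 * t) \<in> G"
    using assms neg unfolding dominated_graph_def by blast+
  then have "t + -1 * s \<le> q 0" "s + -1 * t \<le> q 0"
    using assms(1) unfolding dominated_graph_def by (force simp: complex_vector.scale_minus_left)+
  with assms show ?thesis by simp
qed

text \<open>The one-dimensional extension. The value s at z must lie between all
  \<open>t - q (x - z)\<close> and all \<open>q (y + z) - t\<close>, and subadditivity
  (\<open>gap\<close>) leaves room for it. If z is already in the domain, these bounds force s to be
  the old value, so no case distinction is made.\<close>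

lemma dominated_graph_extend:
  fixes V :: "'a::complex_vector set"
  assumes V: "complex_vector.subspace V"
    and sub: "\<And>x y. x \<in> V \<Longrightarrow> y \<in> V \<Longrightarrow> q (x + y) \<le> q x + q y"
    and hom: "\<And>r x. r > 0 \<Longrightarrow> x \<in> V \<Longrightarrow> q (of_real r *\<^sub>C x) = r * q x"
    and G: "dominated_graph V q G" and z: "z \<in> V"
  shows "\<exists>G'. dominated_graph V q G' \<and> G \<subseteq> G' \<and> z \<in> fst ` G'"
proof -
  have dom: "\<And>x t. (x, t) \<in> G \<Longrightarrow> x \<in> V \<and> t \<le> q x" and z0: "(0, 0) \<in> G"
    and add: "\<And>x t y s. (x, t) \<in> G \<Longrightarrow> (y, s) \<in> G \<Longrightarrow> (x + y, t + s) \<in> G"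
    and scale: "\<And>x t r. (x, t) \<in> G \<Longrightarrow> (of_real r *\<^sub>C x, r * t) \<in> G"
    using G unfolding dominated_graph_def by blast+
  define A where "A = (\<lambda>(x, t). t - q (x - z)) ` G"
  have gap: "t - q (x - z) \<le> q (y + z) - s" if "(x, t) \<in> G" "(y, s) \<in> G" for x t y s
  proof -
    have "t + s \<le> q (x + y)" using dom[OF add[OF that]] by simp
    also have "x + y = (x - z) + (y + z)" by simp
    also have "q \<dots> \<le> q (x - z) + q (y + z)"
      using dom[OF that(1)] dom[OF that(2)] z
      by (intro sub complex_vector.subspace_diff[OF V] complex_vector.subspace_add[OF V]) auto
    finally show ?thesis by simp
  qed
  have "A \<noteq> {}" using z0 unfolding A_def by blast
  have bdd: "bdd_above A"
    unfolding A_def using gap[OF _ z0] by (intro bdd_aboveI[where M="q (0 + z) - 0"]) auto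
  define s where "s = Sup A"
  have lower: "t - q (x - z) \<le> s" if "(x, t) \<in> G" for x t
    unfolding s_def using that by (intro cSup_upper bdd) (force simp: A_def)
  have upper: "s \<le> q (y + z) - t" if "(y, t) \<in> G" for y t
    unfolding s_def using gap that by (intro cSup_least \<open>A \<noteq> {}\<close>) (auto simp: A_def)
  define G' where "G' = {(x + of_real l *\<^sub>C z, t + l * s) |x t l. (x, t) \<in> G}"
  \<comment> \<open>Division by \<bar>l\<bar> reduces the case l > 0 to \<open>upper\<close> and the
    case l < 0 to \<open>lower\<close>.\<close>
  have dom': "t + l * s \<le> q (x + of_real l *\<^sub>C z)" if xt: "(x, t) \<in> G" for x t l
  proof (cases "l = 0")
    case True with dom[OF xt] show ?thesis by simp
  next
    case False
    define k where "k = \<bar>l\<bar>"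
    have k: "k > 0" using False by (simp add: k_def)
    define y where "y = of_real (1 / k) *\<^sub>C x"
    have yt: "(y, t / k) \<in> G" using scale[OF xt, of "1/k"] by (simp add: y_def)
    have yV: "y \<in> V" using dom yt by blast
    have xy: "x = of_real k *\<^sub>C y"
      using k unfolding y_def scaleC_scaleC of_real_mult[symmetric] by (simp add: scaleC_one)
    show ?thesis
    proof (cases "l > 0")
      case True
      then have [simp]: "l = k" by (simp add: k_def)
      have "x + of_real l *\<^sub>C z = of_real k *\<^sub>C (y + z)" by (simp add: xy scaleC_add_right)
      then have "q (x + of_real l *\<^sub>C z) = k * q (y + z)"
        using hom[OF k] complex_vector.subspace_add[OF V yV z] by simp
      moreover have "k * (s + t / k) \<le> k * q (y + z)" using upper[OF yt] k by (intro mult_left_mono) auto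
      ultimately show ?thesis using k by (simp add: distrib_left)
    next
      case False
      then have [simp]: "l = -k" by (simp add: k_def)
      have "x + of_real l *\<^sub>C z = of_real k *\<^sub>C (y - z)"
        by (simp add: xy complex_vector.scale_right_diff_distrib complex_vector.scale_minus_left)
      then have "q (x + of_real l *\<^sub>C z) = k * q (y - z)"
        using hom[OF k] complex_vector.subspace_diff[OF V yV z] by simp
      moreover have "k * (t / k - s) \<le> k * q (y - z)" using lower[OF yt] k by (intro mult_left_mono) auto
      ultimately show ?thesis using k by (simp add: right_diff_distrib)
    qed
  qed
  have "dominated_graph V q G'"
    unfolding dominated_graph_def
  proof (intro conjI allI impI)
    fix x t assume "(x, t) \<in> G'"
    then obtain x' t' l where *: "x = x' + of_real l *\<^sub>C z" "t = t' + l * s" "(x', t') \<in> G"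
      unfolding G'_def by blast
    show "x \<in> V" using * dom z V by (auto simp: complex_vector.subspace_def)
    show "t \<le> q x" using * dom' by blast
  next
    show "(0, 0) \<in> G'" unfolding G'_def using z0
      by (intro CollectI exI[of _ 0]) auto
  next
    fix x t y u assume "(x, t) \<in> G'" "(y, u) \<in> G'"
    then obtain x' t' l y' u' m where "x = x' + of_real l *\<^sub>C z" "t = t' + l * s" "(x', t') \<in> G"
       "y = y' + of_real m *\<^sub>C z" "u = u' + m * s" "(y', u') \<in> G"
      unfolding G'_def by blast
    then have "x + y = (x' + y') + of_real (l + m) *\<^sub>C z" "t + u = (t' + u') + (l + m) * s"
      "(x' + y', t' + u') \<in> G"
      using add by (simp_all add: algebra_simps scaleC_add_left)
    then show "(x + y, t + u) \<in> G'" unfolding G'_def by blast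
  next
    fix x t r assume "(x, t) \<in> G'"
    then obtain x' t' l where "x = x' + of_real l *\<^sub>C z" "t = t' + l * s" "(x', t') \<in> G"
      unfolding G'_def by blast
    then have "of_real r *\<^sub>C x = of_real r *\<^sub>C x' + of_real (r * l) *\<^sub>C z" "r * t = r * t' + (r * l) * s"
      "(of_real r *\<^sub>C x', r * t') \<in> G"
      using scale by (simp_all add: distrib_left scaleC_add_right scaleC_scaleC)
    then show "(of_real r *\<^sub>C x, r * t) \<in> G'" unfolding G'_def by blast
  qed
  moreover have "G \<subseteq> G'"
  proof
    fix w assume w: "w \<in> G"
    then show "w \<in> G'" unfolding G'_def
      by (intro CollectI exI[of _ "fst w"] exI[of _ "snd w"] exI[of _ 0]) simp
  qed
  moreover have "(z, s) \<in> G'"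
    unfolding G'_def using z0
    by (intro CollectI exI[of _ "0::'a"] exI[of _ "0::real"] exI[of _ "1::real"]) (simp add: scaleC_one)
  ultimately show ?thesis by force
qed

lemma dominated_graph_Union:
  assumes "\<C> \<noteq> {}" and ch: "subset.chain {G. dominated_graph V q G \<and> G0 \<subseteq> G} \<C>"
  shows "dominated_graph V q (\<Union>\<C>) \<and> G0 \<subseteq> \<Union>\<C>"
proof
  have C: "dominated_graph V q G" "G0 \<subseteq> G" if "G \<in> \<C>" for G
    using ch that by (auto simp: subset.chain_def)
  show "G0 \<subseteq> \<Union>\<C>" using C \<open>\<C> \<noteq> {}\<close> by blast
  have two: "\<exists>G\<in>\<C>. a \<in> G \<and> b \<in> G" if "a \<in> \<Union>\<C>" "b \<in> \<Union>\<C>" for a b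
    using that ch unfolding subset.chain_def by blast
  have D: "x \<in> V \<and> t \<le> q x" "(of_real r *\<^sub>C x, r * t) \<in> G" if "G \<in> \<C>" "(x, t) \<in> G" for G x t r
    using C(1)[OF that(1)] that(2) unfolding dominated_graph_def by blast+
  have D2: "(x + y, t + s) \<in> G" if "G \<in> \<C>" "(x, t) \<in> G" "(y, s) \<in> G" for G x t y s
    using C(1)[OF that(1)] that(2,3) unfolding dominated_graph_def by blast
  have D0: "(0, 0) \<in> G" if "G \<in> \<C>" for G
    using C(1)[OF that] unfolding dominated_graph_def by blast
  show "dominated_graph V q (\<Union>\<C>)"
    unfolding dominated_graph_def
  proof (intro conjI allI impI)
    fix x t y s assume "(x, t) \<in> \<Union>\<C>" "(y, s) \<in> \<Union>\<C>"
    from two[OF this] obtain G where "G \<in> \<C>" "(x, t) \<in> G" "(y, s) \<in> G" by blast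
    with D2 show "(x + y, t + s) \<in> \<Union>\<C>" by blast
  next
    fix x t assume "(x, t) \<in> \<Union>\<C>"
    then obtain G where "G \<in> \<C>" "(x, t) \<in> G" by blast
    with D(1) show "x \<in> V" "t \<le> q x" by blast+
  next
    show "(0, 0) \<in> \<Union>\<C>" using D0 \<open>\<C> \<noteq> {}\<close> by blast
  next
    fix x t r assume "(x, t) \<in> \<Union>\<C>"
    then obtain G where "G \<in> \<C>" "(x, t) \<in> G" by blast
    with D(2) show "(of_real r *\<^sub>C x, r * t) \<in> \<Union>\<C>" by blast
  qed
qed

text \<open>Zorn's lemma gives a maximal dominated graph above \<open>G0\<close>. It is defined on
  all of V, because the extension at any x returns the graph itself.\<close>

lemma hahn_banach_real:
  fixes V :: "'a::complex_vector set"
  assumes V: "complex_vector.subspace V"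
    and sub: "\<And>x y. x \<in> V \<Longrightarrow> y \<in> V \<Longrightarrow> q (x + y) \<le> q x + q y"
    and hom: "\<And>r x. r \<ge> 0 \<Longrightarrow> x \<in> V \<Longrightarrow> q (of_real r *\<^sub>C x) = r * q x"
    and G0: "dominated_graph V q G0"
  obtains h where "\<And>x y. x \<in> V \<Longrightarrow> y \<in> V \<Longrightarrow> h (x + y) = h x + h y"
    and "\<And>r x. x \<in> V \<Longrightarrow> h (of_real r *\<^sub>C x) = r * h x"
    and "\<And>x. x \<in> V \<Longrightarrow> h x \<le> q x"
    and "\<And>x t. (x, t) \<in> G0 \<Longrightarrow> h x = t"
proof -
  let ?A = "{G. dominated_graph V q G \<and> G0 \<subseteq> G}"
  have "\<exists>M\<in>?A. \<forall>X\<in>?A. M \<subseteq> X \<longrightarrow> X = M"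
  proof (rule subset_Zorn_nonempty)
    show "?A \<noteq> {}" using G0 by auto
    show "\<Union>\<C> \<in> ?A" if "\<C> \<noteq> {}" "subset.chain ?A \<C>" for \<C>
      using dominated_graph_Union[OF that] by simp
  qed
  then obtain M where "M \<in> ?A" and max: "\<forall>X\<in>?A. M \<subseteq> X \<longrightarrow> X = M" ..
  then have M: "dominated_graph V q M" "G0 \<subseteq> M" by simp_all
  have q0: "q 0 = 0"
    using hom[of 0 0] complex_vector.subspace_0[OF V] by simp
  have total: "\<exists>t. (x, t) \<in> M" if x: "x \<in> V" for x
  proof -
    have "\<exists>G'. dominated_graph V q G' \<and> M \<subseteq> G' \<and> x \<in> fst ` G'"
      by (rule dominated_graph_extend[OF V sub hom M(1) x]) simp_all
    then obtain G' where G': "dominated_graph V q G'" "M \<subseteq> G'" "x \<in> fst ` G'" by blast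
    then have "G' = M" using max M(2) by simp
    with G'(3) show ?thesis by force
  qed
  define h where "h x = (SOME t. (x, t) \<in> M)" for x
  have hM: "(x, h x) \<in> M" if "x \<in> V" for x
    unfolding h_def using total[OF that] by (rule someI_ex)
  have h_eq: "h x = t" if "(x, t) \<in> M" for x t
  proof -
    have "x \<in> V" using that M(1) unfolding dominated_graph_def by blast
    then show ?thesis using dominated_graph_functional[OF M(1) hM that q0] by simp
  qed
  show thesis
  proof (rule that[of h])
    show "h (x + y) = h x + h y" if "x \<in> V" "y \<in> V" for x y
      using hM that M(1) unfolding dominated_graph_def by (intro h_eq) blast
    show "h (of_real r *\<^sub>C x) = r * h x" if "x \<in> V" for x r
      using hM that M(1) unfolding dominated_graph_def by (intro h_eq) blast
    show "h x \<le> q x" if "x \<in> V" for x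
      using hM[OF that] M(1) unfolding dominated_graph_def by blast
    show "h x = t" if "(x, t) \<in> G0" for x t
      using that M(2) h_eq by blast
  qed
qed

lemma complex_phase:
  obtains c :: complex where "cmod c = 1" "c * z = of_real (cmod z)"
proof (cases "z = 0")
  case True
  with that[of 1] show thesis by simp
next
  case False
  have "cnj z / of_real (cmod z) * z = of_real (cmod z)"
    using False complex_norm_square[of z] by (simp add: field_simps power2_eq_square)
  with that[of "cnj z / of_real (cmod z)"] False show thesis
    by (simp add: norm_divide)
qed

text \<open>The real parts are extended to a real functional g, and the complex functional is g x -
  i g (i x); a rotation turns the bound on its real part into one on its modulus. The data form a
  graph, not a function, so a functional may be prescribed through a parametrization of its domain;
  domination by q makes it well defined.\<close>

theorem hahn_banach_complex:
  fixes V :: "'a::complex_vector set" and G :: "('a \<times> complex) set"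
  assumes V: "complex_vector.subspace V"
    and sub: "\<And>x y. x \<in> V \<Longrightarrow> y \<in> V \<Longrightarrow> q (x + y) \<le> q x + q y"
    and hom: "\<And>c x. x \<in> V \<Longrightarrow> q (c *\<^sub>C x) = cmod c * q x"
    and dom: "\<And>x t. (x, t) \<in> G \<Longrightarrow> x \<in> V \<and> cmod t \<le> q x"
    and z0: "(0, 0) \<in> G"
    and add: "\<And>x t y s. (x, t) \<in> G \<Longrightarrow> (y, s) \<in> G \<Longrightarrow> (x + y, t + s) \<in> G"
    and scale: "\<And>x t c. (x, t) \<in> G \<Longrightarrow> (c *\<^sub>C x, c * t) \<in> G"
  obtains h where "\<And>x y. x \<in> V \<Longrightarrow> y \<in> V \<Longrightarrow> h (x + y) = h x + h y"
    and "\<And>c x. x \<in> V \<Longrightarrow> h (c *\<^sub>C x) = c * h x"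
    and "\<And>x. x \<in> V \<Longrightarrow> cmod (h x) \<le> q x"
    and "\<And>x t. (x, t) \<in> G \<Longrightarrow> h x = t"
proof -
  let ?G = "{(x, Re t) |x t. (x, t) \<in> G}"
  have "dominated_graph V q ?G"
    unfolding dominated_graph_def
  proof (intro conjI allI impI)
    fix x t assume "(x, t) \<in> ?G"
    then show "x \<in> V" "t \<le> q x" using dom by (auto intro: order_trans[OF complex_Re_le_cmod])
  next
    show "(0, 0) \<in> ?G" using z0 by force
  next
    fix x t y s assume "(x, t) \<in> ?G" "(y, s) \<in> ?G"
    then obtain t' s' where "t = Re t'" "(x, t') \<in> G" "s = Re s'" "(y, s') \<in> G" by blast
    then show "(x + y, t + s) \<in> ?G" using add[of x t' y s'] by (intro CollectI exI[of _ "x + y"] exI[of _ "t' + s'"]) simp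
  next
    fix x t r assume "(x, t) \<in> ?G"
    then obtain t' where "t = Re t'" "(x, t') \<in> G" by blast
    then show "(of_real r *\<^sub>C x, r * t) \<in> ?G" using scale[of x t' "of_real r"]
      by (intro CollectI exI[of _ "of_real r *\<^sub>C x"] exI[of _ "of_real r * t'"]) simp
  qed
  moreover have "q (of_real r *\<^sub>C x) = r * q x" if "r \<ge> 0" "x \<in> V" for r x
    using hom that by simp
  ultimately obtain g where g: "\<And>x y. x \<in> V \<Longrightarrow> y \<in> V \<Longrightarrow> g (x + y) = g x + g y"
    "\<And>r x. x \<in> V \<Longrightarrow> g (of_real r *\<^sub>C x) = r * g x"
    "\<And>x. x \<in> V \<Longrightarrow> g x \<le> q x" "\<And>x t. (x, t) \<in> ?G \<Longrightarrow> g x = t"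
    using hahn_banach_real[OF V sub] by blast
  have VS: "c *\<^sub>C x \<in> V" if "x \<in> V" for c x using V that by (rule complex_vector.subspace_scale)
  define h where "h x = Complex (g x) (- g (\<i> *\<^sub>C x))" for x
  have h_scale: "h (c *\<^sub>C x) = c * h x" if x: "x \<in> V" for c x
  proof -
    have *: "g (c *\<^sub>C x) = Re c * g x + Im c * g (\<i> *\<^sub>C x)" for c
    proof -
      have "c *\<^sub>C x = of_real (Re c) *\<^sub>C x + of_real (Im c) *\<^sub>C \<i> *\<^sub>C x"
        by (subst complex_eq[of c]) (simp add: scaleC_add_left scaleC_scaleC mult.commute[of \<i>])
      then show ?thesis using g(1)[OF VS VS] g(2) VS[OF x] x by (metis (no_types))
    qed
    have "g (\<i> *\<^sub>C c *\<^sub>C x) = - Im c * g x + Re c * g (\<i> *\<^sub>C x)"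
      using *[of "\<i> * c"] by (simp add: scaleC_scaleC)
    then show ?thesis by (simp add: h_def complex_eq_iff *[of c])
  qed
  show thesis
  proof (rule that[of h])
    show "h (x + y) = h x + h y" if "x \<in> V" "y \<in> V" for x y
      using that g VS by (simp add: h_def complex_eq_iff scaleC_add_right)
    show "h (c *\<^sub>C x) = c * h x" if "x \<in> V" for c x using h_scale that .
    show "cmod (h x) \<le> q x" if x: "x \<in> V" for x
    proof -
      obtain c where c: "cmod c = 1" "c * h x = of_real (cmod (h x))" by (rule complex_phase)
      have "cmod (h x) = Re (h (c *\<^sub>C x))" using h_scale[OF x, of c] c by simp
      also have "\<dots> \<le> q (c *\<^sub>C x)" using g(3)[OF VS[OF x]] by (simp add: h_def)
      finally show ?thesis using hom[OF x, of c] c by simp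
    qed
    show "h x = t" if "(x, t) \<in> G" for x t
    proof -
      have "g x = Re t" using g(4) that by blast
      moreover have "g (\<i> *\<^sub>C x) = Re (\<i> * t)" using g(4) scale[OF that, of \<i>] by blast
      ultimately show ?thesis by (simp add: h_def complex_eq_iff)
    qed
  qed
qed

text \<open>Hahn-Banach for the Minkowski gauge q of C, which is finite as C is absorbing, a
  seminorm as C is convex and balanced, and at least 1 at z. No topology is involved, so the ambient
  space can be the space of all sequences in a normed space.\<close>

lemma separation_balanced_convex:
  fixes C :: "'a::complex_vector set"
  assumes conv: "\<And>x y r. x \<in> C \<Longrightarrow> y \<in> C \<Longrightarrow> 0 \<le> r \<Longrightarrow> r \<le> 1 \<Longrightarrow> of_real (1 - r) *\<^sub>C x + of_real r *\<^sub>C y \<in> C"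
    and bal: "\<And>x c. x \<in> C \<Longrightarrow> cmod c \<le> 1 \<Longrightarrow> c *\<^sub>C x \<in> C"
    and absorb: "\<And>x. \<exists>r>0. of_real r *\<^sub>C x \<in> C"
    and z: "z \<notin> C"
  obtains h where "\<And>x y. h (x + y) = h x + h y" and "\<And>c x. h (c *\<^sub>C x) = c * h x"
    and "\<And>x. x \<in> C \<Longrightarrow> cmod (h x) \<le> 1" and "h z = 1"
proof -
  define T where "T x = {t. t > 0 \<and> of_real (1 / t) *\<^sub>C x \<in> C}" for x
  define q where "q x = Inf (T x)" for x
  have Tne: "T x \<noteq> {}" for x
  proof -
    obtain r where "r > 0" "of_real r *\<^sub>C x \<in> C" using absorb by blast
    then have "1 / r \<in> T x" by (simp add: T_def)
    then show ?thesis by blast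
  qed
  have Tbd: "bdd_below (T x)" for x by (rule bdd_belowI[of _ 0]) (simp add: T_def)
  have q_le: "q x \<le> t" if "t \<in> T x" for x t unfolding q_def using that Tbd by (rule cInf_lower)
  have q_ge: "b \<le> q x" if "\<And>t. t \<in> T x \<Longrightarrow> b \<le> t" for x b unfolding q_def using Tne that by (rule cInf_greatest)
  have q_nonneg: "0 \<le> q x" for x by (rule q_ge) (simp add: T_def)
  have T_add: "t + s \<in> T (x + y)" if "t \<in> T x" "s \<in> T y" for t s x y
  proof -
    have pos: "t > 0" "s > 0" using that by (auto simp: T_def)
    \<comment> \<open>With this weight both terms of the convex combination receive the common
      factor 1 / (t + s).\<close>
    let ?r = "s / (t + s)"
    have "of_real (1 - ?r) *\<^sub>C of_real (1 / t) *\<^sub>C x + of_real ?r *\<^sub>C of_real (1 / s) *\<^sub>C y \<in> C"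
      using that pos by (intro conv) (auto simp: T_def)
    also have "of_real (1 - ?r) *\<^sub>C of_real (1 / t) *\<^sub>C x + of_real ?r *\<^sub>C of_real (1 / s) *\<^sub>C y
      = of_real ((1 - ?r) * (1 / t)) *\<^sub>C x + of_real (?r * (1 / s)) *\<^sub>C y"
      by (simp only: scaleC_scaleC of_real_mult)
    also have "(1 - ?r) * (1 / t) = 1 / (t + s)"
      using pos by (simp add: field_simps)
    also have "?r * (1 / s) = 1 / (t + s)"
      using pos by (simp add: field_simps)
    finally show ?thesis using pos by (simp add: T_def scaleC_add_right)
  qed
  have sub: "q (x + y) \<le> q x + q y" for x y
  proof -
    have "q (x + y) - s \<le> q x" if s: "s \<in> T y" for s
    proof (rule q_ge)
      fix t assume "t \<in> T x"
      from q_le[OF T_add[OF this s]] show "q (x + y) - s \<le> t" by simp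
    qed
    then have "q (x + y) - q x \<le> q y" by (intro q_ge) (simp add: algebra_simps)
    then show ?thesis by simp
  qed
  \<comment> \<open>The modulus of c acts as a dilation; its phase is absorbed because C is
    balanced.\<close>
  have T_scale: "cmod c * t \<in> T (c *\<^sub>C x)" if "t \<in> T x" "c \<noteq> 0" for c t x
  proof -
    have "(c / of_real (cmod c)) *\<^sub>C of_real (1 / t) *\<^sub>C x \<in> C"
      using that by (intro bal[of "of_real (1 / t) *\<^sub>C x"]) (simp_all add: T_def norm_divide)
    also have "(c / of_real (cmod c)) *\<^sub>C of_real (1 / t) *\<^sub>C x = of_real (1 / (cmod c * t)) *\<^sub>C c *\<^sub>C x"
      by (simp add: scaleC_scaleC)
    finally show ?thesis using that by (simp add: T_def)
  qed
  have hom_le: "q (c *\<^sub>C x) \<le> cmod c * q x" if "c \<noteq> 0" for c x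
  proof -
    have "q (c *\<^sub>C x) / cmod c \<le> q x"
      using q_le[OF T_scale[OF _ that]] that by (intro q_ge) (simp add: field_simps)
    then show ?thesis using that by (simp add: field_simps)
  qed
  \<comment> \<open>So far the scalars are nonzero; the scalar 1/2 applied to the zero vector gives
    \<open>q 0 \<le> q 0 / 2\<close>.\<close>
  have q0: "q 0 = 0"
  proof -
    have "q 0 \<le> 1/2 * q (0::'a)"
      using hom_le[of "1/2" 0] by (simp add: norm_divide)
    with q_nonneg[of 0] show ?thesis by simp
  qed
  have hom: "q (c *\<^sub>C x) = cmod c * q x" for c x
  proof (cases "c = 0")
    case True
    then show ?thesis by (simp add: q0)
  next
    case False
    have "q x \<le> cmod (inverse c) * q (c *\<^sub>C x)"
      using hom_le[of "inverse c" "c *\<^sub>C x"] False by (simp add: scaleC_scaleC scaleC_one)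
    then have "cmod c * q x \<le> q (c *\<^sub>C x)" using False by (simp add: norm_divide field_simps)
    with hom_le[OF False, of x] show ?thesis by simp
  qed
  have qz: "1 \<le> q z"
  proof (rule q_ge)
    fix t assume t: "t \<in> T z"
    show "1 \<le> t"
    proof (rule ccontr)
      assume "\<not> 1 \<le> t"
      then have "of_real t *\<^sub>C of_real (1 / t) *\<^sub>C z \<in> C"
        using t by (intro bal[of "of_real (1 / t) *\<^sub>C z"]) (simp_all add: T_def)
      also have "of_real t *\<^sub>C of_real (1 / t) *\<^sub>C z = z"
        using t unfolding scaleC_scaleC of_real_mult[symmetric] by (simp add: T_def scaleC_one)
      finally show False using z by simp
    qed
  qed
  let ?G = "{(c *\<^sub>C z, c) |c. True}"
  show thesis
  proof (rule hahn_banach_complex[of UNIV q ?G])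
    show "x \<in> UNIV \<and> cmod t \<le> q x" if "(x, t) \<in> ?G" for x t
      using that mult_left_mono[OF qz, of "cmod t"] by (auto simp: hom)
    show "(c *\<^sub>C x, c * t) \<in> ?G" if "(x, t) \<in> ?G" for x t c
      using that by (auto simp: scaleC_scaleC)
    show "(x + y, t + s) \<in> ?G" if "(x, t) \<in> ?G" "(y, s) \<in> ?G" for x t y s
      using that by (auto simp: scaleC_add_left)
    show "(0, 0) \<in> ?G" by (intro CollectI exI[of _ 0]) simp
    fix h
    assume h: "\<And>x y. x \<in> UNIV \<Longrightarrow> y \<in> UNIV \<Longrightarrow> h (x + y) = h x + h y"
      "\<And>c x. x \<in> UNIV \<Longrightarrow> h (c *\<^sub>C x) = c * h x" "\<And>x. x \<in> UNIV \<Longrightarrow> cmod (h x) \<le> q x"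
      "\<And>x t. (x, t) \<in> ?G \<Longrightarrow> h x = t"
    show thesis
    proof (rule that[of h])
      show "cmod (h x) \<le> 1" if "x \<in> C" for x
      proof -
        have "1 \<in> T x" using that by (simp add: T_def scaleC_one)
        then show ?thesis using h(3)[of x] q_le[of 1 x] by simp
      qed
      show "h z = 1" by (rule h(4)) (intro CollectI exI[of _ 1], simp add: scaleC_one)
    qed (use h(1,2) in simp_all)
  qed (simp_all add: sub hom complex_vector.subspace_UNIV)
qed

section \<open>Sequences with summable \<open>p\<close>-th powers\<close>

lemma powr_inverse_powr:
  fixes x p :: real
  assumes "0 \<le> x" "p \<noteq> 0"
  shows "(x powr (1 / p)) powr p = x"
  using assms by (simp add: powr_powr)

lemma powr_powr_inverse:
  fixes x p :: real
  assumes "0 \<le> x" "p \<noteq> 0"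
  shows "(x powr p) powr (1 / p) = x"
  using assms by (simp add: powr_powr)

lemma powr_inverse_le_iff:
  fixes x y p :: real
  assumes "0 \<le> x" "0 \<le> y" "0 < p"
  shows "x powr (1 / p) \<le> y \<longleftrightarrow> x \<le> y powr p"
proof
  assume "x powr (1 / p) \<le> y"
  then have "(x powr (1 / p)) powr p \<le> y powr p" using assms by (intro powr_mono2) auto
  then show "x \<le> y powr p" using assms by (simp add: powr_inverse_powr)
next
  assume "x \<le> y powr p"
  then have "x powr (1 / p) \<le> (y powr p) powr (1 / p)" using assms by (intro powr_mono2) auto
  then show "x powr (1 / p) \<le> y" using assms by (simp add: powr_powr_inverse)
qed

text \<open>In the interior this is convexity of the power function; at the endpoints x = 0 and y =
  0 it reduces to \<open>s powr p \<le> s\<close> for s between 0 and 1.\<close>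

lemma powr_convex_combination:
  fixes p t x y :: real
  assumes p: "1 \<le> p" and t: "0 \<le> t" "t \<le> 1" and x: "0 \<le> x" and y: "0 \<le> y"
  shows "((1 - t) * x + t * y) powr p \<le> (1 - t) * x powr p + t * y powr p"
proof -
  have le: "s powr p \<le> s" if "0 \<le> s" "s \<le> 1" for s :: real
    using powr_mono'[of 1 p s] p that by simp
  have scaled: "(s * w) powr p \<le> s * w powr p" if "0 \<le> s" "s \<le> 1" "0 \<le> w" for s w :: real
    using mult_right_mono[OF le[OF that(1,2)], of "w powr p"] that by (simp add: powr_mult)
  consider "x = 0" | "y = 0" | "0 < x" "0 < y" using x y by fastforce
  then show ?thesis
  proof cases
    case 1
    then show ?thesis using scaled[of t y] t y by simp
  next
    case 2
    then show ?thesis using scaled[of "1 - t" x] t x by simp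
  next
    case 3
    then show ?thesis using convex_onD[OF powr_convex[OF p], of t x y] t by simp
  qed
qed

text \<open>(x + y) / (a + b) is the convex combination of x / a and y / b with weights a / (a + b)
  and b / (a + b). With a and b the p-norms of two families, summation of this bound is Minkowski's
  inequality.\<close>

lemma minkowski_powr_bound:
  fixes a b p x y :: real
  assumes p: "1 \<le> p" and a: "0 < a" and b: "0 < b" and x: "0 \<le> x" and y: "0 \<le> y"
  shows "(x + y) powr p \<le> (a + b) powr p * (a / (a + b) * (x powr p / a powr p) + b / (a + b) * (y powr p / b powr p))"
proof -
  let ?t = "b / (a + b)"
  have ab: "a + b > 0" using a b by simp
  have t: "1 - ?t = a / (a + b)" using ab by (simp add: field_simps)
  have "((1 - ?t) * (x / a) + ?t * (y / b)) powr p \<le> (1 - ?t) * (x / a) powr p + ?t * (y / b) powr p"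
    using p a b x y by (intro powr_convex_combination) auto
  moreover have "(1 - ?t) * (x / a) + ?t * (y / b) = (x + y) / (a + b)"
    unfolding t using a b by (simp add: add_divide_distrib)
  ultimately have "((x + y) / (a + b)) powr p \<le> a / (a + b) * (x / a) powr p + ?t * (y / b) powr p"
    unfolding t by simp
  then have "(a + b) powr p * ((x + y) / (a + b)) powr p
      \<le> (a + b) powr p * (a / (a + b) * (x / a) powr p + ?t * (y / b) powr p)"
    by (intro mult_left_mono) auto
  then show ?thesis using a b x y by (simp add: powr_divide)
qed

lemma minkowski_finite:
  fixes r s :: "'i \<Rightarrow> real"
  assumes p: "1 \<le> p" and r: "\<And>i. 0 \<le> r i" and s: "\<And>i. 0 \<le> s i"
  shows "(\<Sum>i\<in>A. (r i + s i) powr p) powr (1 / p)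
    \<le> (\<Sum>i\<in>A. r i powr p) powr (1 / p) + (\<Sum>i\<in>A. s i powr p) powr (1 / p)"
proof (cases "finite A")
  case False
  then show ?thesis by simp
next
  case fin: True
  define X where "X = (\<Sum>i\<in>A. r i powr p)"
  define Y where "Y = (\<Sum>i\<in>A. s i powr p)"
  have XY: "0 \<le> X" "0 \<le> Y" by (auto simp: X_def Y_def intro: sum_nonneg)
  have zero: "\<forall>i\<in>A. f i = 0" if "(\<Sum>i\<in>A. f i powr p) = 0" for f :: "'i \<Rightarrow> real"
    using that fin by (subst (asm) sum_nonneg_eq_0_iff) auto
  show ?thesis
  proof (cases "X = 0 \<or> Y = 0")
    case True
    then have "(\<forall>i\<in>A. r i = 0) \<or> (\<forall>i\<in>A. s i = 0)" using zero unfolding X_def Y_def by blast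
    then show ?thesis
    proof
      assume "\<forall>i\<in>A. r i = 0"
      then have "(\<Sum>i\<in>A. (r i + s i) powr p) = (\<Sum>i\<in>A. s i powr p)" by (intro sum.cong) auto
      then show ?thesis by simp
    next
      assume "\<forall>i\<in>A. s i = 0"
      then have "(\<Sum>i\<in>A. (r i + s i) powr p) = (\<Sum>i\<in>A. r i powr p)" by (intro sum.cong) auto
      then show ?thesis by simp
    qed
  next
    case False
    define a where "a = X powr (1 / p)"
    define b where "b = Y powr (1 / p)"
    have ab: "0 < a" "0 < b" using False XY by (auto simp: a_def b_def)
    have pow: "a powr p = X" "b powr p = Y" using XY p by (simp_all add: a_def b_def powr_inverse_powr)
    have "(\<Sum>i\<in>A. (r i + s i) powr p)
      \<le> (\<Sum>i\<in>A. (a + b) powr p * (a / (a + b) * (r i powr p / a powr p) + b / (a + b) * (s i powr p / b powr p)))"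
      using ab r s p by (intro sum_mono minkowski_powr_bound) auto
    also have "\<dots> = (a + b) powr p * (a / (a + b) * (X / a powr p) + b / (a + b) * (Y / b powr p))"
      unfolding X_def Y_def sum_divide_distrib sum_distrib_left sum.distrib[symmetric] ..
    also have "\<dots> = (a + b) powr p * (a / (a + b) + b / (a + b))" using False by (simp add: pow)
    also have "a / (a + b) + b / (a + b) = 1" using ab by (simp flip: add_divide_distrib)
    finally have "(\<Sum>i\<in>A. (r i + s i) powr p) \<le> (a + b) powr p" by simp
    then have "(\<Sum>i\<in>A. (r i + s i) powr p) powr (1 / p) \<le> a + b"
      using ab p by (subst powr_inverse_le_iff) (auto intro: sum_nonneg)
    then show ?thesis by (simp add: a_def b_def X_def Y_def)
  qed
qed

text \<open>With a the p-norm of r, Young's inequality for \<open>r i / a\<close> and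
  \<open>s i\<close> bounds the normalized sum by 1/p + 1/q = 1.\<close>

lemma holder_finite:
  fixes r s :: "'i \<Rightarrow> real"
  assumes p: "1 < p" and q: "1 / p + 1 / q = 1" and r: "\<And>i. 0 \<le> r i" and s: "\<And>i. 0 \<le> s i"
    and le: "(\<Sum>i\<in>A. s i powr q) \<le> 1"
  shows "(\<Sum>i\<in>A. s i * r i) \<le> (\<Sum>i\<in>A. r i powr p) powr (1 / p)"
proof (cases "finite A")
  case False
  then show ?thesis by simp
next
  case fin: True
  have "1 / q = (p - 1) / p" using p q by (simp add: field_simps)
  then have "q = p / (p - 1)" by (metis inverse_divide inverse_eq_divide inverse_inverse_eq)
  then have q1: "1 < q" using p by simp
  define X where "X = (\<Sum>i\<in>A. r i powr p)"
  have X: "0 \<le> X" by (auto simp: X_def intro: sum_nonneg)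
  show ?thesis
  proof (cases "X = 0")
    case True
    then have "\<forall>i\<in>A. r i = 0" using fin unfolding X_def by (subst (asm) sum_nonneg_eq_0_iff) auto
    then show ?thesis by simp
  next
    case False
    define a where "a = X powr (1 / p)"
    have a: "0 < a" using False X by (simp add: a_def)
    have pow: "a powr p = X" using X p by (simp add: a_def powr_inverse_powr)
    have "(\<Sum>i\<in>A. s i * (r i / a)) \<le> (\<Sum>i\<in>A. (r i / a) powr p / p + s i powr q / q)"
    proof (intro sum_mono)
      fix i assume "i \<in> A"
      show "s i * (r i / a) \<le> (r i / a) powr p / p + s i powr q / q"
        using Youngs_inequality[of p q "r i / a" "s i"] p q1 q r s a by (simp add: mult.commute)
    qed
    also have "\<dots> = (\<Sum>i\<in>A. r i powr p / X / p) + (\<Sum>i\<in>A. s i powr q / q)"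
      using r a by (simp add: sum.distrib powr_divide pow)
    also have "\<dots> = X / X / p + (\<Sum>i\<in>A. s i powr q) / q"
      unfolding sum_divide_distrib[symmetric] by (simp add: X_def)
    also have "\<dots> \<le> 1 / p + 1 / q"
      using False le q1 p by (intro add_mono divide_right_mono) auto
    finally have "(\<Sum>i\<in>A. s i * (r i / a)) \<le> 1" using q by simp
    then have "(\<Sum>i\<in>A. s i * r i) / a \<le> 1" by (simp add: sum_divide_distrib)
    then show ?thesis using a by (simp add: a_def X_def)
  qed
qed

text \<open>Applied to sequences of norms, of moduli and of bounds for functionals alike. For a
  sequence that is not p-summable the value is unspecified, which is why summability is carried
  along as a separate fact.\<close>

definition lp_norm :: "real \<Rightarrow> (nat \<Rightarrow> real) \<Rightarrow> real" where
  "lp_norm p r = (\<Sum>n. r n powr p) powr (1 / p)"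

lemma lp_norm_nonneg: "0 \<le> lp_norm p r"
  by (simp add: lp_norm_def)

lemma lp_norm_powr:
  assumes "summable (\<lambda>n. r n powr p)" "1 \<le> p"
  shows "lp_norm p r powr p = (\<Sum>n. r n powr p)"
  using assms by (simp add: lp_norm_def powr_inverse_powr suminf_nonneg)

lemma lp_norm_finite_le:
  assumes "summable (\<lambda>n. r n powr p)" "1 \<le> p" "finite A"
  shows "(\<Sum>n\<in>A. r n powr p) powr (1 / p) \<le> lp_norm p r"
  unfolding lp_norm_def using assms by (intro powr_mono2 sum_le_suminf) (auto intro: sum_nonneg)

lemma le_lp_norm:
  assumes "summable (\<lambda>n. r n powr p)" "1 \<le> p" "0 \<le> r n"
  shows "r n \<le> lp_norm p r"
  using lp_norm_finite_le[OF assms(1,2), of "{n}"] assms by (simp add: powr_powr_inverse)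

lemma lp_norm_leI:
  assumes p: "1 \<le> p" and b: "0 \<le> b"
    and le: "\<And>N. (\<Sum>n<N. r n powr p) powr (1 / p) \<le> b"
  shows "summable (\<lambda>n. r n powr p)" "lp_norm p r \<le> b"
proof -
  have le': "(\<Sum>n<N. r n powr p) \<le> b powr p" for N
    using le[of N] b p by (subst (asm) powr_inverse_le_iff) (auto intro: sum_nonneg)
  show sm: "summable (\<lambda>n. r n powr p)"
    by (rule bounded_imp_summable[of _ "b powr p"]) (use le'[of "Suc _"] in \<open>auto simp: lessThan_Suc_atMost\<close>)
  show "lp_norm p r \<le> b"
    unfolding lp_norm_def using p b sm le'
    by (subst powr_inverse_le_iff) (auto intro: suminf_nonneg suminf_le_const)
qed

lemma lp_norm_mono:
  assumes "1 \<le> p" "summable (\<lambda>n. s n powr p)" "\<And>n. 0 \<le> r n" "\<And>n. r n \<le> s n"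
  shows "summable (\<lambda>n. r n powr p)" "lp_norm p r \<le> lp_norm p s"
proof -
  have le: "r n powr p \<le> s n powr p" for n using assms by (intro powr_mono2) auto
  show sm: "summable (\<lambda>n. r n powr p)" by (rule summable_comparison_test'[OF assms(2)]) (use le in auto)
  show "lp_norm p r \<le> lp_norm p s"
    unfolding lp_norm_def using assms sm le by (intro powr_mono2 suminf_le suminf_nonneg) auto
qed

lemma lp_norm_add:
  assumes p: "1 \<le> p" and r: "\<And>n. 0 \<le> r n" and s: "\<And>n. 0 \<le> s n"
    and sm: "summable (\<lambda>n. r n powr p)" "summable (\<lambda>n. s n powr p)"
  shows "summable (\<lambda>n. (r n + s n) powr p)" "lp_norm p (\<lambda>n. r n + s n) \<le> lp_norm p r + lp_norm p s"
proof -
  have "(\<Sum>n<N. (r n + s n) powr p) powr (1 / p) \<le> lp_norm p r + lp_norm p s" for N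
    using minkowski_finite[OF p, of r s "{..<N}"] lp_norm_finite_le[OF sm(1) p, of "{..<N}"]
      lp_norm_finite_le[OF sm(2) p, of "{..<N}"] r s by simp
  from lp_norm_leI[OF p _ this] lp_norm_nonneg[of p r] lp_norm_nonneg[of p s]
  show "summable (\<lambda>n. (r n + s n) powr p)" "lp_norm p (\<lambda>n. r n + s n) \<le> lp_norm p r + lp_norm p s"
    by auto
qed

lemma lp_norm_scale:
  assumes p: "1 \<le> p" and c: "0 \<le> c" and r: "\<And>n. 0 \<le> r n"
    and sm: "summable (\<lambda>n. r n powr p)"
  shows "summable (\<lambda>n. (c * r n) powr p)" "lp_norm p (\<lambda>n. c * r n) = c * lp_norm p r"
proof -
  have eq: "(c * r n) powr p = c powr p * r n powr p" for n using c r by (simp add: powr_mult)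
  show "summable (\<lambda>n. (c * r n) powr p)" unfolding eq using sm by (rule summable_mult)
  show "lp_norm p (\<lambda>n. c * r n) = c * lp_norm p r"
    unfolding lp_norm_def eq using p c sm
    by (simp add: suminf_mult powr_mult suminf_nonneg powr_powr_inverse)
qed

text \<open>The unit ball of the dual of \<open>\<ell>\<^sub>p\<close>, described by its action on finitely supported
  elements. For \<open>p = 1\<close> this is the ball of \<open>\<ell>\<^sub>\<infinity>\<close>, so it is larger than \<^const>\<open>coeff_ball\<close>.\<close>

definition dual_ball :: "real \<Rightarrow> ('i \<Rightarrow> complex) set" where
  "dual_ball p = {a. \<forall>A u. finite A \<longrightarrow> (\<forall>i. 0 \<le> u i) \<longrightarrow>
     (\<Sum>i\<in>A. cmod (a i) * u i) \<le> (\<Sum>i\<in>A. u i powr p) powr (1 / p)}"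

lemma dual_ballD:
  assumes "a \<in> dual_ball p" "finite A" "\<And>i. 0 \<le> u i"
  shows "(\<Sum>i\<in>A. cmod (a i) * u i) \<le> (\<Sum>i\<in>A. u i powr p) powr (1 / p)"
  using assms by (auto simp: dual_ball_def)

lemma dual_ball_cmod_le_1:
  assumes "a \<in> dual_ball p"
  shows "cmod (a n) \<le> 1"
  using dual_ballD[OF assms, of "{n}" "\<lambda>_. 1"] by simp

lemma dual_ball_abs_sums:
  assumes a: "a \<in> dual_ball p" and p: "1 \<le> p" and u: "\<And>n. 0 \<le> u n"
    and sm: "summable (\<lambda>n. u n powr p)"
  shows "summable (\<lambda>n. cmod (a n) * u n)" "(\<Sum>n. cmod (a n) * u n) \<le> lp_norm p u"
proof -
  have le: "(\<Sum>n\<in>A. cmod (a n) * u n) \<le> lp_norm p u" if "finite A" for A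
    using dual_ballD[of a p A u] lp_norm_finite_le[OF sm p that] a u that by force
  show *: "summable (\<lambda>n. cmod (a n) * u n)"
    by (rule bounded_imp_summable[of _ "lp_norm p u"]) (use u le in auto)
  show "(\<Sum>n. cmod (a n) * u n) \<le> lp_norm p u"
    using le by (intro suminf_le_const *) auto
qed

lemma dual_ball_sums:
  fixes u :: "nat \<Rightarrow> complex"
  assumes a: "a \<in> dual_ball p" and p: "1 \<le> p" and sm: "summable (\<lambda>n. cmod (u n) powr p)"
  shows "summable (\<lambda>n. a n * u n)" "cmod (\<Sum>n. a n * u n) \<le> lp_norm p (\<lambda>n. cmod (u n))"
proof -
  note * = dual_ball_abs_sums[OF a p _ sm]
  have nm: "summable (\<lambda>n. norm (a n * u n))" using *(1) by (simp add: norm_mult)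
  then show "summable (\<lambda>n. a n * u n)" by (rule summable_norm_cancel)
  show "cmod (\<Sum>n. a n * u n) \<le> lp_norm p (\<lambda>n. cmod (u n))"
    using summable_norm[OF nm] *(2) by (simp add: norm_mult)
qed

lemma conjugate_index_eq:
  assumes "1 < p"
  shows "1 < conjugate_index p" "1 / p + 1 / conjugate_index p = 1"
  using assms by (auto simp: conjugate_index_def field_simps)

text \<open>For p = 1 the moduli are at most one, and for p > 1 this is Hoelder's
  inequality.\<close>

lemma coeff_ball_subset_dual_ball:
  assumes p: "1 \<le> p"
  shows "coeff_ball p \<subseteq> dual_ball p"
proof
  fix a assume a: "a \<in> coeff_ball p"
  show "a \<in> dual_ball p"
    unfolding dual_ball_def
  proof (intro CollectI allI impI)
    fix A :: "nat set" and u :: "nat \<Rightarrow> real" assume A: "finite A" and "\<forall>i. 0 \<le> u i"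
    then have u: "\<And>i. 0 \<le> u i" by blast
    show "(\<Sum>i\<in>A. cmod (a i) * u i) \<le> (\<Sum>i\<in>A. u i powr p) powr (1 / p)"
    proof (cases "p = 1")
      case True
      with a have "cmod (a i) \<le> 1" for i by (simp add: coeff_ball_def)
      then have "(\<Sum>i\<in>A. cmod (a i) * u i) \<le> (\<Sum>i\<in>A. u i)"
        using u by (intro sum_mono mult_left_le_one_le) auto
      then show ?thesis using True u by (simp add: sum_nonneg)
    next
      case False
      with p have p1: "1 < p" by simp
      let ?q = "conjugate_index p"
      have "summable (\<lambda>n. cmod (a n) powr ?q)" "lp_norm ?q (\<lambda>n. cmod (a n)) \<le> 1"
        using a False by (simp_all add: coeff_ball_def ell_def whole_space_def lp_norm_def)
      with lp_norm_finite_le[OF this(1) _ A] conjugate_index_eq[OF p1]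
      have "(\<Sum>i\<in>A. cmod (a i) powr ?q) powr (1 / ?q) \<le> 1" by simp
      then have "(\<Sum>i\<in>A. cmod (a i) powr ?q) \<le> 1"
        using conjugate_index_eq[OF p1] by (subst (asm) powr_inverse_le_iff) (auto intro: sum_nonneg)
      with holder_finite[OF p1 conjugate_index_eq(2)[OF p1], of u "\<lambda>i. cmod (a i)" A] u
      show ?thesis by simp
    qed
  qed
qed

text \<open>The converse duality. For p = 1 the dual ball is that of l_infinity, so convergence to
  zero has to be supplied.\<close>

lemma dual_ball_imp_coeff_ball:
  assumes p: "1 \<le> p" and a: "a \<in> dual_ball p" and lim: "p = 1 \<Longrightarrow> a \<longlonglongrightarrow> 0"
  shows "a \<in> coeff_ball p"
proof (cases "p = 1")
  case True
  then show ?thesis using lim dual_ball_cmod_le_1[OF a] by (simp add: coeff_ball_def)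
next
  case False
  with p have p1: "1 < p" by simp
  let ?q = "conjugate_index p"
  have q: "1 < ?q" "1 / p + 1 / ?q = 1" by (rule conjugate_index_eq[OF p1])+
  have qp: "(?q - 1) * p = ?q" using p1 by (simp add: conjugate_index_def field_simps)
  have le: "(\<Sum>n<N. cmod (a n) powr ?q) powr (1 / ?q) \<le> 1" for N
  proof -
    define s where "s = (\<Sum>n<N. cmod (a n) powr ?q)"
    have s: "0 \<le> s" by (auto simp: s_def intro: sum_nonneg)
    \<comment> \<open>The extremal case of Hoelder's inequality: since (q - 1) p = q, the test
      sequence |a_n|^(q - 1) yields \<open>s \<le> s powr (1 / p)\<close>, and 1 - 1/p =
      1/q.\<close>
    have "(\<Sum>n<N. cmod (a n) * cmod (a n) powr (?q - 1)) \<le> (\<Sum>n<N. (cmod (a n) powr (?q - 1)) powr p) powr (1 / p)"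
      by (rule dual_ballD[OF a]) auto
    moreover have "cmod (a n) * cmod (a n) powr (?q - 1) = cmod (a n) powr ?q" for n
      using powr_mult_base[of "cmod (a n)" "?q - 1"] by simp
    ultimately have "s \<le> s powr (1 / p)" by (simp add: powr_powr qp s_def)
    have "s powr (1 / ?q) \<le> 1"
    proof (cases "s = 0")
      case False
      with s have s0: "s > 0" by simp
      have "1 / ?q = 1 - 1 / p" using q(2) by simp
      then have "s powr (1 / ?q) = s / s powr (1 / p)" using s0 by (simp add: powr_diff)
      with \<open>s \<le> s powr (1 / p)\<close> s0 show ?thesis by simp
    qed simp
    then show ?thesis by (simp add: s_def)
  qed
  then show ?thesis
    using lp_norm_leI[of ?q 1 "\<lambda>n. cmod (a n)"] q False
    by (simp add: coeff_ball_def ell_def whole_space_def lp_norm_def)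
qed

lemma lp_norm_tail_tendsto_0:
  assumes p: "1 \<le> p" and sm: "summable (\<lambda>n. r n powr p)"
  shows "(\<lambda>N. lp_norm p (\<lambda>n. if n < N then 0 else r n)) \<longlonglongrightarrow> 0"
proof -
  define f where "f n = r n powr p" for n
  have smf: "summable f" using sm by (simp add: f_def[abs_def])
  have eq: "(\<Sum>n. (if n < N then 0 else r n) powr p) = suminf f - (\<Sum>n<N. f n)" for N
  proof -
    have "(\<lambda>n. if n \<in> {..<N} then f n else 0) sums (\<Sum>n<N. f n)"
      by (rule sums_If_finite_set) simp
    with smf have "(\<lambda>n. f n - (if n \<in> {..<N} then f n else 0)) sums (suminf f - (\<Sum>n<N. f n))"
      by (intro sums_diff summable_sums)
    moreover have "f n - (if n \<in> {..<N} then f n else 0) = (if n < N then 0 else r n) powr p" for n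
      by (simp add: f_def)
    ultimately show ?thesis by (simp add: sums_iff)
  qed
  have "(\<lambda>N. suminf f - (\<Sum>n<N. f n)) \<longlonglongrightarrow> suminf f - suminf f"
    using smf by (intro tendsto_diff tendsto_const summable_LIMSEQ)
  then have "(\<lambda>N. (suminf f - (\<Sum>n<N. f n)) powr (1 / p)) \<longlonglongrightarrow> 0 powr (1 / p)"
    using p sum_le_suminf[OF smf, of "{..<_}"] by (intro tendsto_powr') (auto simp: f_def)
  then show ?thesis using p by (simp add: lp_norm_def eq)
qed

section \<open>Duals and biduals\<close>

abbreviation dual_carrier :: "('f::complex_normed_vector \<Rightarrow> complex) set" where
  "dual_carrier \<equiv> carrier (dual_space whole_space)"

lemma mem_dual_carrier:
  "\<phi> \<in> dual_carrier \<longleftrightarrow> (\<forall>x y. \<phi> (x + y) = \<phi> x + \<phi> y) \<and> (\<forall>c x. \<phi> (c *\<^sub>C x) = c * \<phi> x) \<and>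
     (\<exists>L\<ge>0. \<forall>x. cmod (\<phi> x) \<le> L * norm x)"
proof -
  have "(\<exists>C. \<forall>x. cmod (\<phi> x) \<le> C * norm x) \<longleftrightarrow> (\<exists>L\<ge>0. \<forall>x. cmod (\<phi> x) \<le> L * norm x)"
  proof
    assume "\<exists>C. \<forall>x. cmod (\<phi> x) \<le> C * norm x"
    then obtain C where "cmod (\<phi> x) \<le> C * norm x" for x by blast
    then have "cmod (\<phi> x) \<le> \<bar>C\<bar> * norm x" for x
      by (meson abs_ge_self mult_right_mono norm_ge_zero order_trans)
    then show "\<exists>L\<ge>0. \<forall>x. cmod (\<phi> x) \<le> L * norm x" by (intro exI[of _ "\<bar>C\<bar>"]) simp
  qed blast
  then show ?thesis
    by (simp add: dual_space_def bounded_ops_def whole_space_def scaleC_complex_def)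
qed

lemma dual_carrier_add: "\<phi> \<in> dual_carrier \<Longrightarrow> \<phi> (x + y) = \<phi> x + \<phi> y"
  by (simp add: mem_dual_carrier)

lemma dual_carrier_scaleC: "\<phi> \<in> dual_carrier \<Longrightarrow> \<phi> (c *\<^sub>C x) = c * \<phi> x"
  by (simp add: mem_dual_carrier)

lemma dual_carrier_0: "\<phi> \<in> dual_carrier \<Longrightarrow> \<phi> 0 = 0"
  using dual_carrier_scaleC[of \<phi> 0 0] by simp

lemma dual_carrier_diff: "\<phi> \<in> dual_carrier \<Longrightarrow> \<phi> (x - y) = \<phi> x - \<phi> y"
  using dual_carrier_add[of \<phi> "x - y" y] by simp

lemma dual_carrier_sum: "\<phi> \<in> dual_carrier \<Longrightarrow> \<phi> (\<Sum>i\<in>A. g i) = (\<Sum>i\<in>A. \<phi> (g i))"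
  by (induction A rule: infinite_finite_induct) (simp_all add: dual_carrier_0 dual_carrier_add)

lemma dual_carrier_bound:
  assumes "\<phi> \<in> dual_carrier"
  obtains L where "0 \<le> L" "\<And>x. cmod (\<phi> x) \<le> L * norm x"
  using assms by (auto simp: mem_dual_carrier)

lemma subspace_dual_carrier: "complex_vector.subspace (dual_carrier :: ('f::complex_normed_vector \<Rightarrow> complex) set)"
  unfolding complex_vector.subspace_def
proof (intro conjI ballI allI)
  show "(0 :: 'f \<Rightarrow> complex) \<in> dual_carrier"
    by (auto simp: mem_dual_carrier intro: exI[of _ 0])
next
  fix \<phi> \<psi> :: "'f \<Rightarrow> complex" assume *: "\<phi> \<in> dual_carrier" "\<psi> \<in> dual_carrier"
  obtain L M where L: "0 \<le> L" "\<And>x. cmod (\<phi> x) \<le> L * norm x" and M: "0 \<le> M" "\<And>x. cmod (\<psi> x) \<le> M * norm x"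
    using * by (metis dual_carrier_bound)
  have "cmod ((\<phi> + \<psi>) x) \<le> (L + M) * norm x" for x
    using norm_triangle_ineq[of "\<phi> x" "\<psi> x"] L(2)[of x] M(2)[of x] by (simp add: distrib_right)
  with L M * show "\<phi> + \<psi> \<in> dual_carrier"
    by (auto simp: mem_dual_carrier distrib_left intro!: exI[of _ "L + M"])
next
  fix \<phi> :: "'f \<Rightarrow> complex" and c assume *: "\<phi> \<in> dual_carrier"
  obtain L where L: "0 \<le> L" "\<And>x. cmod (\<phi> x) \<le> L * norm x" using * by (metis dual_carrier_bound)
  have "cmod ((c *\<^sub>C \<phi>) x) \<le> (cmod c * L) * norm x" for x
    using mult_left_mono[OF L(2)[of x], of "cmod c"] by (simp add: scaleC_fun_def scaleC_complex_def norm_mult mult.assoc)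
  with L * show "c *\<^sub>C \<phi> \<in> dual_carrier"
    by (auto simp: mem_dual_carrier distrib_left scaleC_fun_def scaleC_complex_def intro!: exI[of _ "cmod c * L"])
qed

text \<open>The functional sending c y to c times the norm of y extends with norm at most one. The
  form with an upper bound B turns estimates for all functionals into a norm estimate.\<close>

lemma dual_carrier_norming:
  fixes y :: "'f::complex_normed_vector"
  assumes "\<And>\<phi>. \<phi> \<in> dual_carrier \<Longrightarrow> (\<And>x. cmod (\<phi> x) \<le> norm x) \<Longrightarrow> cmod (\<phi> y) \<le> B"
  shows "norm y \<le> B"
proof -
  let ?G = "{(c *\<^sub>C y, c * of_real (norm y)) |c. True}"
  show ?thesis
  proof (rule hahn_banach_complex[of UNIV norm ?G])
    show "(0, 0) \<in> ?G" by (intro CollectI exI[of _ 0]) simp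
    show "(x + x', t + s) \<in> ?G" if "(x, t) \<in> ?G" "(x', s) \<in> ?G" for x t x' s
    proof -
      obtain c d where "x = c *\<^sub>C y" "t = c * of_real (norm y)" "x' = d *\<^sub>C y" "s = d * of_real (norm y)"
        using \<open>(x, t) \<in> ?G\<close> \<open>(x', s) \<in> ?G\<close> by blast
      then show ?thesis by (intro CollectI exI[of _ "c + d"]) (simp add: scaleC_add_left distrib_right)
    qed
    show "(c *\<^sub>C x, c * t) \<in> ?G" if "(x, t) \<in> ?G" for x t c
    proof -
      obtain d where "x = d *\<^sub>C y" "t = d * of_real (norm y)" using \<open>(x, t) \<in> ?G\<close> by blast
      then show ?thesis by (intro CollectI exI[of _ "c * d"]) (simp add: scaleC_scaleC)
    qed
    fix h assume h: "\<And>x y. x \<in> UNIV \<Longrightarrow> y \<in> UNIV \<Longrightarrow> h (x + y) = h x + h y"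
      "\<And>c x. x \<in> UNIV \<Longrightarrow> h (c *\<^sub>C x) = c * h x" "\<And>x. x \<in> UNIV \<Longrightarrow> cmod (h x) \<le> norm x"
      "\<And>x t. (x, t) \<in> ?G \<Longrightarrow> h x = t"
    have "h \<in> dual_carrier" using h(1-3) by (auto simp: mem_dual_carrier intro!: exI[of _ 1])
    moreover have "h y = of_real (norm y)"
      by (rule h(4)) (intro CollectI exI[of _ 1], simp add: scaleC_one)
    ultimately show "norm y \<le> B" using assms[of h] h(3) by simp
  qed (auto simp: norm_scaleC norm_mult norm_triangle_ineq)
qed

text \<open>The condition \<open>0 \<le> L\<close> matters only for the zero space.\<close>

definition bidual_bound :: "real \<Rightarrow> (('f::complex_normed_vector \<Rightarrow> complex) \<Rightarrow> complex) \<Rightarrow> bool" where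
  "bidual_bound c \<xi> \<longleftrightarrow>
     (\<forall>\<phi>\<in>dual_carrier. \<forall>\<psi>\<in>dual_carrier. \<xi> (\<phi> + \<psi>) = \<xi> \<phi> + \<xi> \<psi>) \<and>
     (\<forall>a. \<forall>\<phi>\<in>dual_carrier. \<xi> (a *\<^sub>C \<phi>) = a * \<xi> \<phi>) \<and>
     (\<forall>\<phi>\<in>dual_carrier. \<forall>L\<ge>0. (\<forall>x. cmod (\<phi> x) \<le> L * norm x) \<longrightarrow> cmod (\<xi> \<phi>) \<le> c * L)"

lemma bidual_boundD:
  assumes "bidual_bound c \<xi>"
  shows "\<phi> \<in> dual_carrier \<Longrightarrow> \<psi> \<in> dual_carrier \<Longrightarrow> \<xi> (\<phi> + \<psi>) = \<xi> \<phi> + \<xi> \<psi>"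
    and "\<phi> \<in> dual_carrier \<Longrightarrow> \<xi> (a *\<^sub>C \<phi>) = a * \<xi> \<phi>"
    and "\<phi> \<in> dual_carrier \<Longrightarrow> 0 \<le> L \<Longrightarrow> (\<And>x. cmod (\<phi> x) \<le> L * norm x) \<Longrightarrow> cmod (\<xi> \<phi>) \<le> c * L"
  using assms by (auto simp: bidual_bound_def)

lemma bidual_bound_eval: "bidual_bound (norm y) (\<lambda>\<phi>. \<phi> y)"
  by (auto simp: bidual_bound_def scaleC_fun_def scaleC_complex_def mult.commute)

lemma bidual_bound_diff:
  fixes \<xi> \<zeta> :: "('f::complex_normed_vector \<Rightarrow> complex) \<Rightarrow> complex"
  assumes "bidual_bound c \<xi>" "bidual_bound d \<zeta>"
  shows "bidual_bound (c + d) (\<lambda>\<phi>. \<xi> \<phi> - \<zeta> \<phi>)"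
  unfolding bidual_bound_def
proof (intro conjI ballI allI impI)
  fix \<phi> :: "'f \<Rightarrow> complex" and L :: real
  assume *: "\<phi> \<in> dual_carrier" "0 \<le> L" "\<forall>x. cmod (\<phi> x) \<le> L * norm x"
  then have "cmod (\<xi> \<phi>) \<le> c * L" "cmod (\<zeta> \<phi>) \<le> d * L"
    using bidual_boundD(3)[OF assms(1)] bidual_boundD(3)[OF assms(2)] by blast+
  then show "cmod (\<xi> \<phi> - \<zeta> \<phi>) \<le> (c + d) * L"
    using norm_triangle_ineq4[of "\<xi> \<phi>" "\<zeta> \<phi>"] by (simp add: distrib_right)
qed (use bidual_boundD(1,2)[OF assms(1)] bidual_boundD(1,2)[OF assms(2)] in \<open>simp_all add: right_diff_distrib\<close>)

lemma bidual_bound_scale: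
  fixes \<xi> :: "('f::complex_normed_vector \<Rightarrow> complex) \<Rightarrow> complex"
  assumes "bidual_bound c \<xi>" "0 \<le> r"
  shows "bidual_bound (r * c) (\<lambda>\<phi>. of_real r * \<xi> \<phi>)"
  unfolding bidual_bound_def
proof (intro conjI ballI allI impI)
  fix \<phi> :: "'f \<Rightarrow> complex" and L :: real
  assume *: "\<phi> \<in> dual_carrier" "0 \<le> L" "\<forall>x. cmod (\<phi> x) \<le> L * norm x"
  then have "cmod (\<xi> \<phi>) \<le> c * L" using bidual_boundD(3)[OF assms(1)] by blast
  from mult_left_mono[OF this assms(2)] show "cmod (of_real r * \<xi> \<phi>) \<le> (r * c) * L"
    using assms(2) by (simp add: norm_mult mult.assoc)
qed (use bidual_boundD(1,2)[OF assms(1)] in \<open>simp_all add: distrib_left\<close>)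

lemma bidual_bound_mono: "bidual_bound c \<xi> \<Longrightarrow> c \<le> d \<Longrightarrow> bidual_bound d \<xi>"
  unfolding bidual_bound_def by (meson mult_right_mono order_trans)

lemma bidual_bound_summable:
  assumes p: "1 \<le> p" and c: "\<And>n. 0 < c n" "summable (\<lambda>n. c n powr p)"
    and \<xi>: "\<And>n. bidual_bound (c n) (\<xi> n)" and \<phi>: "\<phi> \<in> dual_carrier"
  shows "summable (\<lambda>n. cmod (\<xi> n \<phi>) powr p)"
    and "0 \<le> L \<Longrightarrow> (\<And>x. cmod (\<phi> x) \<le> L * norm x) \<Longrightarrow> lp_norm p (\<lambda>n. cmod (\<xi> n \<phi>)) \<le> L * lp_norm p c"
proof -
  have *: "summable (\<lambda>n. cmod (\<xi> n \<phi>) powr p)" "lp_norm p (\<lambda>n. cmod (\<xi> n \<phi>)) \<le> L * lp_norm p c"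
    if L: "0 \<le> L" "\<And>x. cmod (\<phi> x) \<le> L * norm x" for L
  proof -
    note sc = lp_norm_scale[OF p L(1), of c, OF _ c(2)]
    have le: "cmod (\<xi> n \<phi>) \<le> L * c n" for n
      using bidual_boundD(3)[OF \<xi> \<phi> L] by (simp add: mult.commute)
    note m = lp_norm_mono[OF p sc(1), of "\<lambda>n. cmod (\<xi> n \<phi>)", OF _ _ le]
    show "summable (\<lambda>n. cmod (\<xi> n \<phi>) powr p)" using m(1) c(1) by (simp add: less_imp_le)
    show "lp_norm p (\<lambda>n. cmod (\<xi> n \<phi>)) \<le> L * lp_norm p c" using m(2) sc(2) c(1) by (simp add: less_imp_le)
  qed
  show "summable (\<lambda>n. cmod (\<xi> n \<phi>) powr p)"
    by (rule dual_carrier_bound[OF \<phi>]) (rule *(1))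
  show "0 \<le> L \<Longrightarrow> (\<And>x. cmod (\<phi> x) \<le> L * norm x) \<Longrightarrow> lp_norm p (\<lambda>n. cmod (\<xi> n \<phi>)) \<le> L * lp_norm p c"
    by (rule *(2))
qed

section \<open>Functionals on l_p and representation of elements by bidual sequences\<close>

lemma subspace_lp:
  assumes p: "1 \<le> p"
  shows "complex_vector.subspace {u. summable (\<lambda>n. cmod (u n) powr p)}"
    and "summable (\<lambda>n. cmod (u n) powr p) \<Longrightarrow> summable (\<lambda>n. cmod (w n) powr p) \<Longrightarrow>
      lp_norm p (\<lambda>n. cmod ((u + w) n)) \<le> lp_norm p (\<lambda>n. cmod (u n)) + lp_norm p (\<lambda>n. cmod (w n))"
    and "summable (\<lambda>n. cmod (u n) powr p) \<Longrightarrow>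
      lp_norm p (\<lambda>n. cmod ((c *\<^sub>C u) n)) = cmod c * lp_norm p (\<lambda>n. cmod (u n))"
proof -
  have add: "summable (\<lambda>n. cmod ((u + w) n) powr p) \<and>
      lp_norm p (\<lambda>n. cmod ((u + w) n)) \<le> lp_norm p (\<lambda>n. cmod (u n)) + lp_norm p (\<lambda>n. cmod (w n))"
    if *: "summable (\<lambda>n. cmod (u n) powr p)" "summable (\<lambda>n. cmod (w n) powr p)" for u w
  proof -
    note a = lp_norm_add[OF p _ _ *]
    note m = lp_norm_mono[OF p a(1), of "\<lambda>n. cmod ((u + w) n)"]
    have "summable (\<lambda>n. cmod ((u + w) n) powr p)" by (rule m(1)) (auto intro: norm_triangle_ineq)
    moreover have "lp_norm p (\<lambda>n. cmod ((u + w) n)) \<le> lp_norm p (\<lambda>n. cmod (u n) + cmod (w n))"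
      by (rule m(2)) (auto intro: norm_triangle_ineq)
    ultimately show ?thesis using a(2) by force
  qed
  have scale: "summable (\<lambda>n. cmod ((c *\<^sub>C u) n) powr p) \<and>
      lp_norm p (\<lambda>n. cmod ((c *\<^sub>C u) n)) = cmod c * lp_norm p (\<lambda>n. cmod (u n))"
    if *: "summable (\<lambda>n. cmod (u n) powr p)" for u c
    using lp_norm_scale[OF p _ _ *, of "cmod c"] by (simp add: scaleC_fun_def scaleC_complex_def norm_mult)
  show "complex_vector.subspace {u. summable (\<lambda>n. cmod (u n) powr p)}"
    unfolding complex_vector.subspace_def using add scale by (simp add: zero_fun_def)
  show "summable (\<lambda>n. cmod (u n) powr p) \<Longrightarrow> summable (\<lambda>n. cmod (w n) powr p) \<Longrightarrow>
      lp_norm p (\<lambda>n. cmod ((u + w) n)) \<le> lp_norm p (\<lambda>n. cmod (u n)) + lp_norm p (\<lambda>n. cmod (w n))"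
    using add by blast
  show "summable (\<lambda>n. cmod (u n) powr p) \<Longrightarrow>
      lp_norm p (\<lambda>n. cmod ((c *\<^sub>C u) n)) = cmod c * lp_norm p (\<lambda>n. cmod (u n))"
    using scale by blast
qed

text \<open>The dual of l_p, treated uniformly for p = 1 and p > 1. The coefficients are the values
  at the unit vectors; finitely supported test sequences place them in the dual ball, and the series
  converges to h because the tails of u tend to zero in norm.\<close>

lemma lp_functional_representation:
  fixes h :: "(nat \<Rightarrow> complex) \<Rightarrow> complex"
  assumes p: "1 \<le> p"
    and add: "\<And>u w. summable (\<lambda>n. cmod (u n) powr p) \<Longrightarrow> summable (\<lambda>n. cmod (w n) powr p) \<Longrightarrow> h (u + w) = h u + h w"
    and scale: "\<And>c u. summable (\<lambda>n. cmod (u n) powr p) \<Longrightarrow> h (c *\<^sub>C u) = c * h u"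
    and le: "\<And>u. summable (\<lambda>n. cmod (u n) powr p) \<Longrightarrow> cmod (h u) \<le> lp_norm p (\<lambda>n. cmod (u n))"
  obtains a where "a \<in> dual_ball p" "\<And>u. summable (\<lambda>n. cmod (u n) powr p) \<Longrightarrow> (\<lambda>n. a n * u n) sums h u"
proof -
  define e :: "nat \<Rightarrow> nat \<Rightarrow> complex" where "e n = (\<lambda>m. if m = n then 1 else 0)" for n
  define a where "a n = h (e n)" for n
  have trunc_sm: "summable (\<lambda>n. cmod (if n \<in> A then w n else 0) powr p)" if "finite A" for A and w :: "nat \<Rightarrow> complex"
    by (rule summable_finite[OF that]) auto
  have e_sm: "summable (\<lambda>m. cmod (e n m) powr p)" for n
    by (rule summable_finite[of "{n}"]) (auto simp: e_def)
  have trunc: "h (\<lambda>n. if n \<in> A then w n else 0) = (\<Sum>n\<in>A. a n * w n)" if "finite A" for A w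
    using that
  proof (induction A)
    case empty
    have "h (0 *\<^sub>C (\<lambda>n. 0)) = 0" by (subst scale) auto
    then show ?case by (simp add: zero_fun_def)
  next
    case (insert x A)
    have "(\<lambda>n. if n \<in> insert x A then w n else 0) = (\<lambda>n. if n \<in> A then w n else 0) + w x *\<^sub>C e x"
      using insert(2) by (auto simp: fun_eq_iff e_def scaleC_fun_def scaleC_complex_def)
    moreover have "h \<dots> = h (\<lambda>n. if n \<in> A then w n else 0) + h (w x *\<^sub>C e x)"
      using complex_vector.subspace_scale[OF subspace_lp(1)[OF p], of "e x" "w x"] e_sm
      by (intro add trunc_sm insert) auto
    ultimately show ?case using insert by (simp add: scale[OF e_sm] a_def mult.commute)
  qed
  show thesis
  proof (rule that[of a])
    show "a \<in> dual_ball p"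
      unfolding dual_ball_def
    proof (intro CollectI allI impI)
      fix A :: "nat set" and u :: "nat \<Rightarrow> real" assume A: "finite A" and "\<forall>i. 0 \<le> u i"
      then have u: "\<And>i. 0 \<le> u i" by blast
      have "\<exists>c. cmod c = 1 \<and> c * a n = of_real (cmod (a n))" for n by (rule complex_phase[of "a n"]) blast
      then obtain c where c: "\<And>n. cmod (c n) = 1" "\<And>n. c n * a n = of_real (cmod (a n))" by metis
      \<comment> \<open>The phases make every \<open>a n * w n\<close> equal to the nonnegative
        number \<open>cmod (a n) * u n\<close>.\<close>
      define w where "w n = of_real (u n) * c n" for n
      have "h (\<lambda>n. if n \<in> A then w n else 0) = of_real (\<Sum>n\<in>A. cmod (a n) * u n)"
      proof -
        have "a n * w n = of_real (cmod (a n) * u n)" for n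
          using c(2)[of n] by (simp add: w_def mult.commute mult.left_commute)
        then show ?thesis unfolding trunc[OF A] by simp
      qed
      then have "(\<Sum>n\<in>A. cmod (a n) * u n) = cmod (h (\<lambda>n. if n \<in> A then w n else 0))"
        using u by (simp add: sum_nonneg flip: of_real_sum of_real_mult)
      also have "\<dots> \<le> lp_norm p (\<lambda>n. cmod (if n \<in> A then w n else 0))"
        by (intro le trunc_sm A)
      also have "(\<Sum>n. cmod (if n \<in> A then w n else 0) powr p) = (\<Sum>n\<in>A. cmod (if n \<in> A then w n else 0) powr p)"
        by (intro suminf_finite A) auto
      then have "lp_norm p (\<lambda>n. cmod (if n \<in> A then w n else 0)) = (\<Sum>n\<in>A. u n powr p) powr (1 / p)"
        using u c by (simp add: lp_norm_def w_def norm_mult)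
      finally show "(\<Sum>n\<in>A. cmod (a n) * u n) \<le> (\<Sum>n\<in>A. u n powr p) powr (1 / p)" .
    qed
    fix u :: "nat \<Rightarrow> complex" assume u: "summable (\<lambda>n. cmod (u n) powr p)"
    define t where "t N = (\<lambda>n. if n < N then 0 else u n)" for N
    have t: "summable (\<lambda>n. cmod (t N n) powr p)" for N
      by (rule summable_comparison_test'[OF u]) (simp add: t_def)
    have diff: "h u - (\<Sum>n<N. a n * u n) = h (t N)" for N
    proof -
      have "u = (\<lambda>n. if n \<in> {..<N} then u n else 0) + t N" by (auto simp: t_def fun_eq_iff)
      then have "h u = h (\<lambda>n. if n \<in> {..<N} then u n else 0) + h (t N)"
        using add[OF trunc_sm t] by (metis finite_lessThan)
      then show ?thesis using trunc[of "{..<N}" u] by simp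
    qed
    have "(\<lambda>N. h (t N)) \<longlonglongrightarrow> 0"
    proof (rule Lim_null_comparison)
      show "(\<lambda>N. lp_norm p (\<lambda>n. if n < N then 0 else cmod (u n))) \<longlonglongrightarrow> 0"
        by (rule lp_norm_tail_tendsto_0[OF p u])
      have "(\<lambda>n. cmod (t N n)) = (\<lambda>n. if n < N then 0 else cmod (u n))" for N by (auto simp: t_def)
      then show "\<forall>\<^sub>F N in sequentially. norm (h (t N)) \<le> lp_norm p (\<lambda>n. if n < N then 0 else cmod (u n))"
        using le[OF t] by simp
    qed
    then have "(\<lambda>N. h u - (h u - (\<Sum>n<N. a n * u n))) \<longlonglongrightarrow> h u - 0"
      unfolding diff by (intro tendsto_diff tendsto_const)
    then show "(\<lambda>n. a n * u n) sums h u" by (simp add: sums_def)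
  qed
qed

text \<open>The assignment of \<phi> k to the sequence of all \<open>\<xi> n \<phi>\<close> is a
  functional of norm at most one on a subspace of l_p. It is well defined by the estimate for k, and
  the coefficients of an extension to l_p represent k.\<close>

lemma bidual_representation:
  fixes k :: "'f::complex_normed_vector"
  assumes p: "1 \<le> p" and c: "\<And>n. 0 < c n" "summable (\<lambda>n. c n powr p)"
    and \<xi>: "\<And>n. bidual_bound (c n) (\<xi> n)"
    and k: "\<And>\<phi>. \<phi> \<in> dual_carrier \<Longrightarrow> cmod (\<phi> k) \<le> lp_norm p (\<lambda>n. cmod (\<xi> n \<phi>))"
  obtains a where "a \<in> dual_ball p" "\<And>\<phi>. \<phi> \<in> dual_carrier \<Longrightarrow> (\<lambda>n. a n * \<xi> n \<phi>) sums \<phi> k"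
proof -
  note sm = bidual_bound_summable(1)[OF p c \<xi>]
  let ?V = "{u::nat \<Rightarrow> complex. summable (\<lambda>n. cmod (u n) powr p)}"
  let ?G = "{((\<lambda>n. \<xi> n \<phi>), \<phi> k) |\<phi>. \<phi> \<in> dual_carrier}"
  note D = complex_vector.subspace_0[OF subspace_dual_carrier] complex_vector.subspace_add[OF subspace_dual_carrier]
    complex_vector.subspace_scale[OF subspace_dual_carrier]
  have \<xi>0: "\<xi> n 0 = 0" for n
    using bidual_boundD(2)[OF \<xi>, of 0 n 0] D(1) by simp
  show thesis
  proof (rule hahn_banach_complex[of ?V "\<lambda>u. lp_norm p (\<lambda>n. cmod (u n))" ?G])
    show "x \<in> ?V \<and> cmod t \<le> lp_norm p (\<lambda>n. cmod (x n))" if "(x, t) \<in> ?G" for x t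
      using that sm k by auto
    show "(0, 0) \<in> ?G"
      using D(1) \<xi>0 by (intro CollectI exI[of _ 0]) (auto simp: fun_eq_iff)
    show "(x + y, t + s) \<in> ?G" if "(x, t) \<in> ?G" "(y, s) \<in> ?G" for x t y s
    proof -
      obtain \<phi> \<psi> where "\<phi> \<in> dual_carrier" "x = (\<lambda>n. \<xi> n \<phi>)" "t = \<phi> k" "\<psi> \<in> dual_carrier" "y = (\<lambda>n. \<xi> n \<psi>)" "s = \<psi> k"
        using \<open>(x, t) \<in> ?G\<close> \<open>(y, s) \<in> ?G\<close> by blast
      then show ?thesis using D(2) bidual_boundD(1)[OF \<xi>]
        by (intro CollectI exI[of _ "\<phi> + \<psi>"]) (auto simp: fun_eq_iff)
    qed
    show "(d *\<^sub>C x, d * t) \<in> ?G" if "(x, t) \<in> ?G" for x t d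
    proof -
      obtain \<phi> where "\<phi> \<in> dual_carrier" "x = (\<lambda>n. \<xi> n \<phi>)" "t = \<phi> k"
        using \<open>(x, t) \<in> ?G\<close> by blast
      then show ?thesis using D(3) bidual_boundD(2)[OF \<xi>]
        by (intro CollectI exI[of _ "d *\<^sub>C \<phi>"]) (auto simp: fun_eq_iff scaleC_fun_def scaleC_complex_def)
    qed
    fix h assume h: "\<And>x y. x \<in> ?V \<Longrightarrow> y \<in> ?V \<Longrightarrow> h (x + y) = h x + h y"
      "\<And>c x. x \<in> ?V \<Longrightarrow> h (c *\<^sub>C x) = c * h x" "\<And>x. x \<in> ?V \<Longrightarrow> cmod (h x) \<le> lp_norm p (\<lambda>n. cmod (x n))"
      "\<And>x t. (x, t) \<in> ?G \<Longrightarrow> h x = t"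
    obtain a where "a \<in> dual_ball p" "\<And>u. summable (\<lambda>n. cmod (u n) powr p) \<Longrightarrow> (\<lambda>n. a n * u n) sums h u"
      by (rule lp_functional_representation[of p h]) (use p h in auto)
    moreover have "h (\<lambda>n. \<xi> n \<phi>) = \<phi> k" if "\<phi> \<in> dual_carrier" for \<phi> using h(4) that by blast
    ultimately show thesis using sm that by metis
  qed (use subspace_lp[OF p] in auto)
qed

text \<open>L is the norm of \<phi>. It need not be attained, so y reaches only three quarters of
  it, with a phase that makes the value real. Any fraction in (1/2, 1) would serve in
  \<open>helly_approximation\<close>, whose bounds carry a factor 2.\<close>

lemma dual_carrier_near_norming:
  assumes \<phi>: "\<phi> \<in> dual_carrier"
  obtains L y r where "0 \<le> L" "\<And>x. cmod (\<phi> x) \<le> L * norm x" "norm y \<le> 1" "\<phi> y = of_real r" "3 / 4 * L \<le> r"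
proof -
  define S where "S = (\<lambda>x. cmod (\<phi> x)) ` {x. norm x \<le> 1}"
  obtain K where K: "0 \<le> K" "\<And>x. cmod (\<phi> x) \<le> K * norm x" using dual_carrier_bound[OF \<phi>] by blast
  have bdd: "bdd_above S"
  proof (rule bdd_aboveI)
    fix s assume "s \<in> S"
    then obtain x where "s = cmod (\<phi> x)" "norm x \<le> 1" by (auto simp: S_def)
    then show "s \<le> K" using K(2)[of x] mult_left_mono[of "norm x" 1 K] K(1) by simp
  qed
  define L where "L = Sup S"
  have upper: "cmod (\<phi> x) \<le> L" if "norm x \<le> 1" for x
    unfolding L_def using that by (intro cSup_upper bdd) (auto simp: S_def)
  have L0: "0 \<le> L" using upper[of 0] by (simp add: dual_carrier_0[OF \<phi>])
  have bound: "cmod (\<phi> x) \<le> L * norm x" for x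
  proof (cases "x = 0")
    case True
    then show ?thesis by (simp add: dual_carrier_0[OF \<phi>])
  next
    case False
    have "cmod (\<phi> (of_real (1 / norm x) *\<^sub>C x)) \<le> L"
      using False by (intro upper) (simp add: norm_scaleC norm_divide)
    then show ?thesis using False by (simp add: dual_carrier_scaleC[OF \<phi>] norm_mult norm_divide field_simps)
  qed
  show thesis
  proof (cases "L = 0")
    case True
    show thesis by (rule that[OF L0 bound, of 0 0]) (simp_all add: True dual_carrier_0[OF \<phi>])
  next
    case False
    have "cmod (\<phi> 0) \<in> S" unfolding S_def by (rule imageI) simp
    then have "S \<noteq> {}" by blast
    moreover have "3 / 4 * L < Sup S" using False L0 by (simp add: L_def)
    ultimately obtain s where "s \<in> S" "3 / 4 * L < s" using less_cSup_iff[OF _ bdd] by blast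
    then obtain x where x: "norm x \<le> 1" "3 / 4 * L < cmod (\<phi> x)" by (auto simp: S_def)
    obtain c where c: "cmod c = 1" "c * \<phi> x = of_real (cmod (\<phi> x))" by (rule complex_phase)
    show thesis
      by (rule that[OF L0 bound, of "c *\<^sub>C x" "cmod (\<phi> x)"])
        (use x c in \<open>simp_all add: norm_scaleC dual_carrier_scaleC[OF \<phi>]\<close>)
  qed
qed

section \<open>From relations in the bidual to approximate relations in the space\<close>

lemma bidual_bound_sum:
  assumes \<xi>: "bidual_bound c \<xi>" and \<phi>: "\<And>i. i \<in> A \<Longrightarrow> \<phi> i \<in> dual_carrier"
  shows "\<xi> (\<Sum>i\<in>A. a i *\<^sub>C \<phi> i) = (\<Sum>i\<in>A. a i * \<xi> (\<phi> i))"
  using \<phi>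
proof (induction A rule: infinite_finite_induct)
  case (insert i A)
  have "a i *\<^sub>C \<phi> i \<in> dual_carrier" "(\<Sum>i\<in>A. a i *\<^sub>C \<phi> i) \<in> dual_carrier"
    using insert by (auto intro!: complex_vector.subspace_scale complex_vector.subspace_sum subspace_dual_carrier)
  from bidual_boundD(1)[OF \<xi> this] bidual_boundD(2)[OF \<xi>, of "\<phi> i" "a i"] insert(4)[of i]
  have "\<xi> (a i *\<^sub>C \<phi> i + (\<Sum>j\<in>A. a j *\<^sub>C \<phi> j)) = a i * \<xi> (\<phi> i) + \<xi> (\<Sum>j\<in>A. a j *\<^sub>C \<phi> j)"
    by (metis insertI1)
  also have "a i *\<^sub>C \<phi> i + (\<Sum>j\<in>A. a j *\<^sub>C \<phi> j) = (\<Sum>j\<in>insert i A. a j *\<^sub>C \<phi> j)"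
    by (rule sum.insert[OF insert(1,2), symmetric])
  finally have "\<xi> (\<Sum>j\<in>insert i A. a j *\<^sub>C \<phi> j) = a i * \<xi> (\<phi> i) + \<xi> (\<Sum>j\<in>A. a j *\<^sub>C \<phi> j)" .
  moreover have "\<xi> (\<Sum>j\<in>A. a j *\<^sub>C \<phi> j) = (\<Sum>j\<in>A. a j * \<xi> (\<phi> j))"
    using insert(3) insert(4) by blast
  ultimately show ?case by (simp only: sum.insert[OF insert(1,2), of "\<lambda>j. a j * \<xi> (\<phi> j)"])
qed (use bidual_boundD(2)[OF \<xi>, of 0 0] complex_vector.subspace_0[OF subspace_dual_carrier] in auto)

lemma sum_fun_apply: "(\<Sum>i\<in>A. g i) x = (\<Sum>i\<in>A. g i x)"
  for g :: "'i \<Rightarrow> 'a \<Rightarrow> 'b::comm_monoid_add"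
  by (induction A rule: infinite_finite_induct) auto

lemma norm_convex_combination_le:
  fixes u w :: "'f::complex_normed_vector"
  assumes "norm u \<le> b" "norm w \<le> b" "0 \<le> r" "r \<le> 1"
  shows "norm (of_real (1 - r) *\<^sub>C u + of_real r *\<^sub>C w) \<le> b"
proof -
  have "norm (of_real (1 - r) *\<^sub>C u + of_real r *\<^sub>C w) \<le> (1 - r) * norm u + r * norm w"
    using norm_triangle_ineq[of "of_real (1 - r) *\<^sub>C u" "of_real r *\<^sub>C w"] assms
    by (simp only: norm_scaleC norm_of_real abs_of_nonneg diff_ge_0_iff_ge)
  also have "\<dots> \<le> (1 - r) * b + r * b"
    using assms by (intro add_mono mult_left_mono) auto
  finally show ?thesis by (simp add: algebra_simps)
qed

text \<open>A form of Helly's theorem; it takes the place of the principle of local reflexivity.\<close>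

lemma helly_approximation:
  fixes k :: "nat \<Rightarrow> 'f::complex_normed_vector" and \<alpha> :: "nat \<Rightarrow> nat \<Rightarrow> complex"
  assumes c: "\<And>n. 0 < c n" and \<xi>: "\<And>n. bidual_bound (c n) (\<xi> n)" and \<tau>: "0 < \<tau>"
    and res: "\<And>i. i < m \<Longrightarrow> bidual_bound \<tau> (\<lambda>\<phi>. \<phi> (k i) - (\<Sum>n<N. \<alpha> i n * \<xi> n \<phi>))"
  obtains y where "\<And>n. norm (y n) \<le> 2 * c n"
    and "\<And>i. i < m \<Longrightarrow> norm (k i - (\<Sum>n<N. \<alpha> i n *\<^sub>C y n)) \<le> 2 * \<tau>"
proof -
  define \<Phi> where "\<Phi> y i = (\<Sum>n<N. \<alpha> i n *\<^sub>C y n)" for y :: "nat \<Rightarrow> 'f" and i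
  have \<Phi>_add: "\<Phi> (\<lambda>n. y n + y' n) i = \<Phi> y i + \<Phi> y' i" for y y' i
    by (simp add: \<Phi>_def scaleC_add_right sum.distrib)
  have \<Phi>_scale: "\<Phi> (\<lambda>n. a *\<^sub>C y n) i = a *\<^sub>C \<Phi> y i" for y a i
    by (simp add: \<Phi>_def complex_vector.scale_sum_right scaleC_scaleC mult.commute)
  have \<Phi>0: "\<Phi> (\<lambda>n. 0) i = 0" for i by (simp add: \<Phi>_def)
  \<comment> \<open>The right-hand sides that are approximately solvable within the bounds. Tuples
    of length m are encoded as functions on all naturals, whose coordinates from m on are left
    free.\<close>
  define C where "C = {z. \<exists>y. (\<forall>n. norm (y n) \<le> 2 * c n) \<and> (\<forall>i<m. norm (z i - \<Phi> y i) \<le> 2 * \<tau>)}"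
  \<comment> \<open>Extension by zero makes \<open>h k'\<close> computable from the components of h
    below m by \<open>h_sum\<close>.\<close>
  define k' where "k' i = (if i < m then k i else 0)" for i
  have "k' \<in> C"
  proof (rule ccontr)
    assume notin: "k' \<notin> C"
    have conv: "of_real (1 - r) *\<^sub>C z + of_real r *\<^sub>C w \<in> C" if "z \<in> C" "w \<in> C" "0 \<le> r" "r \<le> 1" for z w r
    proof -
      obtain y y' where y: "\<And>n. norm (y n) \<le> 2 * c n" "\<And>i. i < m \<Longrightarrow> norm (z i - \<Phi> y i) \<le> 2 * \<tau>"
        and y': "\<And>n. norm (y' n) \<le> 2 * c n" "\<And>i. i < m \<Longrightarrow> norm (w i - \<Phi> y' i) \<le> 2 * \<tau>"
        using \<open>z \<in> C\<close> \<open>w \<in> C\<close> unfolding C_def by blast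
      let ?y = "\<lambda>n. of_real (1 - r) *\<^sub>C y n + of_real r *\<^sub>C y' n"
      have eq: "(of_real (1 - r) *\<^sub>C z + of_real r *\<^sub>C w) i - \<Phi> ?y i
          = of_real (1 - r) *\<^sub>C (z i - \<Phi> y i) + of_real r *\<^sub>C (w i - \<Phi> y' i)" for i
        unfolding \<Phi>_add \<Phi>_scale plus_fun_apply scaleC_fun_def complex_vector.scale_right_diff_distrib
        by (simp only: add_diff_add)
      show ?thesis
        unfolding C_def mem_Collect_eq
      proof (intro exI[of _ ?y] conjI allI impI)
        show "norm (?y n) \<le> 2 * c n" for n
          using y(1) y'(1) that(3,4) by (rule norm_convex_combination_le)
        show "norm ((of_real (1 - r) *\<^sub>C z + of_real r *\<^sub>C w) i - \<Phi> ?y i) \<le> 2 * \<tau>" if "i < m" for i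
          unfolding eq using y(2)[OF that] y'(2)[OF that] \<open>0 \<le> r\<close> \<open>r \<le> 1\<close> by (rule norm_convex_combination_le)
      qed
    qed
    have bal: "a *\<^sub>C z \<in> C" if "z \<in> C" "cmod a \<le> 1" for z a
    proof -
      obtain y where y: "\<And>n. norm (y n) \<le> 2 * c n" "\<And>i. i < m \<Longrightarrow> norm (z i - \<Phi> y i) \<le> 2 * \<tau>"
        using \<open>z \<in> C\<close> unfolding C_def by blast
      have le: "norm (a *\<^sub>C u) \<le> b" if "norm u \<le> b" for u :: 'f and b
        using mult_left_le_one_le[of "norm u" "cmod a"] that \<open>cmod a \<le> 1\<close> by (simp add: norm_scaleC)
      have "norm ((a *\<^sub>C z) i - \<Phi> (\<lambda>n. a *\<^sub>C y n) i) \<le> 2 * \<tau>" if "i < m" for i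
        using le[OF y(2)[OF that]] by (simp add: \<Phi>_scale scaleC_fun_def complex_vector.scale_right_diff_distrib)
      with le[OF y(1)] show ?thesis
        unfolding C_def by (intro CollectI exI[of _ "\<lambda>n. a *\<^sub>C y n"]) blast
    qed
    \<comment> \<open>The zero sequence solves every system with small right-hand sides. This makes
      C absorbing and later bounds the components of the separating functional.\<close>
    have small: "z \<in> C" if "\<And>i. i < m \<Longrightarrow> norm (z i) \<le> 2 * \<tau>" for z
      unfolding C_def using that c by (intro CollectI exI[of _ "\<lambda>n. 0"]) (auto simp: \<Phi>0 less_imp_le)
    have absorb: "\<exists>r>0. of_real r *\<^sub>C z \<in> C" for z
    proof -
      define s where "s = 1 + (\<Sum>i<m. norm (z i))"
      have s: "0 < s" unfolding s_def by (intro add_pos_nonneg sum_nonneg) auto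
      have le: "norm (z i) \<le> s" if "i < m" for i
        using member_le_sum[of i "{..<m}" "\<lambda>i. norm (z i)"] that by (simp add: s_def)
      show ?thesis
      proof (intro exI[of _ "2 * \<tau> / s"] conjI small)
        show "norm ((of_real (2 * \<tau> / s) *\<^sub>C z) i) \<le> 2 * \<tau>" if "i < m" for i
          unfolding scaleC_fun_def norm_scaleC norm_of_real using le[OF that] s \<tau> by (simp add: field_simps)
      qed (use s \<tau> in simp)
    qed
    obtain h where h: "\<And>x y. h (x + y) = h x + h y" "\<And>c x. h (c *\<^sub>C x) = c * h x"
      "\<And>x. x \<in> C \<Longrightarrow> cmod (h x) \<le> 1" "h k' = 1"
      using separation_balanced_convex[OF conv bal absorb notin] by blast
    have h0: "h 0 = 0" using h(2)[of 0 0] by simp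
    \<comment> \<open>\<open>\<delta> i\<close> embeds the space as the i-th coordinate, and the
      separating functional is the sum of its components \<open>\<phi> i\<close> on tuples supported
      below m.\<close>
    define \<delta> :: "nat \<Rightarrow> 'f \<Rightarrow> nat \<Rightarrow> 'f" where "\<delta> i x = (\<lambda>j. if j = i then x else 0)" for i x
    define \<phi> where "\<phi> i x = h (\<delta> i x)" for i x
    have \<delta>_scale: "\<delta> i (a *\<^sub>C x) = a *\<^sub>C \<delta> i x" for i a x by (auto simp: \<delta>_def scaleC_fun_def)
    have \<phi>_scale: "\<phi> i (a *\<^sub>C x) = a * \<phi> i x" for i a x by (simp add: \<phi>_def \<delta>_scale h(2))
    have "\<delta> i (x + y) = \<delta> i x + \<delta> i y" for i x y by (auto simp: \<delta>_def)
    then have \<phi>_add: "\<phi> i (x + y) = \<phi> i x + \<phi> i y" for i x y by (simp add: \<phi>_def h(1))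
    have \<phi>_bound: "cmod (\<phi> i x) \<le> 1 / (2 * \<tau>) * norm x" for i x
    proof (cases "x = 0")
      case True
      then have "\<delta> i x = 0" by (auto simp: \<delta>_def)
      then show ?thesis using \<tau> by (simp add: \<phi>_def h0)
    next
      case False
      have "\<delta> i (of_real (2 * \<tau> / norm x) *\<^sub>C x) \<in> C"
        using False \<tau> by (intro small) (simp add: \<delta>_def norm_scaleC norm_mult norm_divide)
      from h(3)[OF this] have "2 * \<tau> / norm x * cmod (\<phi> i x) \<le> 1"
        using \<tau> unfolding \<phi>_def[symmetric] \<phi>_scale norm_mult norm_of_real by simp
      then show ?thesis using False \<tau> by (simp add: field_simps)
    qed
    have \<phi>D: "\<phi> i \<in> dual_carrier" for i
      using \<phi>_add \<phi>_scale \<phi>_bound \<tau> by (auto simp: mem_dual_carrier intro!: exI[of _ "1 / (2 * \<tau>)"])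
    have h_sum: "h (\<lambda>j. if j < l then z j else 0) = (\<Sum>i<l. \<phi> i (z i))" for l and z :: "nat \<Rightarrow> 'f"
    proof (induction l)
      case 0
      then show ?case using h0 by (simp add: zero_fun_def)
    next
      case (Suc l)
      have "(\<lambda>j. if j < Suc l then z j else 0) = (\<lambda>j. if j < l then z j else 0) + \<delta> l (z l)"
        by (auto simp: \<delta>_def fun_eq_iff)
      then show ?case using Suc by (simp add: h(1) \<phi>_def)
    qed
    \<comment> \<open>The adjoint of \<Phi>: the sum of all \<open>\<phi> i (\<Phi> y i)\<close>
      over i < m equals the sum of all \<open>\<psi> n (y n)\<close> over n < N.\<close>
    define \<psi> where "\<psi> n = (\<Sum>i<m. \<alpha> i n *\<^sub>C \<phi> i)" for n
    have \<psi>D: "\<psi> n \<in> dual_carrier" for n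
      unfolding \<psi>_def by (intro complex_vector.subspace_sum complex_vector.subspace_scale subspace_dual_carrier \<phi>D)
    have \<psi>_apply: "\<psi> n x = (\<Sum>i<m. \<alpha> i n * \<phi> i x)" for n x
      by (simp add: \<psi>_def sum_fun_apply scaleC_fun_def scaleC_complex_def)
    have "\<exists>M x s. 0 \<le> M \<and> (\<forall>w. cmod (\<phi> i w) \<le> M * norm w) \<and> norm x \<le> 1 \<and> \<phi> i x = of_real s \<and> 3 / 4 * M \<le> s" for i
      by (rule dual_carrier_near_norming[OF \<phi>D[of i]]) blast
    then obtain M x s where M: "\<And>i. 0 \<le> M i" "\<And>i w. cmod (\<phi> i w) \<le> M i * norm w"
      and x: "\<And>i. norm (x i) \<le> 1" "\<And>i. \<phi> i (x i) = of_real (s i)" "\<And>i. 3 / 4 * M i \<le> s i" by metis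
    have "\<exists>L y r. 0 \<le> L \<and> (\<forall>w. cmod (\<psi> n w) \<le> L * norm w) \<and> norm y \<le> 1 \<and> \<psi> n y = of_real r \<and> 3 / 4 * L \<le> r" for n
      by (rule dual_carrier_near_norming[OF \<psi>D[of n]]) blast
    then obtain L y r where L: "\<And>n. 0 \<le> L n" "\<And>n w. cmod (\<psi> n w) \<le> L n * norm w"
      and y: "\<And>n. norm (y n) \<le> 1" "\<And>n. \<psi> n (y n) = of_real (r n)" "\<And>n. 3 / 4 * L n \<le> r n" by metis
    \<comment> \<open>The bounds \<tau> and \<open>c n\<close> in the bidual give 1 =
      \<open>h k'\<close> \<le> S. An element of C built with twice these bounds and almost norming
      vectors has a value of h of at least 3/2 S, contradicting the bound 1 on C.\<close>
    define S where "S = (\<Sum>i<m. \<tau> * M i) + (\<Sum>n<N. c n * L n)"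
    have "1 \<le> S"
    proof -
      \<comment> \<open>Each \<open>\<phi> i (k i)\<close> splits into its residual, of modulus at
        most \<tau> times \<open>M i\<close>, and a part that recombines over i into
        \<open>\<xi> n (\<psi> n)\<close>, of modulus at most \<open>c n * L n\<close>.\<close>
      have "h k' = (\<Sum>i<m. \<phi> i (k i))"
        using h_sum[of m k] by (simp add: k'_def[abs_def])
      also have "\<dots> = (\<Sum>i<m. (\<phi> i (k i) - (\<Sum>n<N. \<alpha> i n * \<xi> n (\<phi> i)))) + (\<Sum>i<m. \<Sum>n<N. \<alpha> i n * \<xi> n (\<phi> i))"
        by (simp flip: sum.distrib)
      also have "(\<Sum>i<m. \<Sum>n<N. \<alpha> i n * \<xi> n (\<phi> i)) = (\<Sum>n<N. \<xi> n (\<psi> n))"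
        unfolding \<psi>_def bidual_bound_sum[OF \<xi> \<phi>D] by (rule sum.swap)
      finally have "cmod (h k') \<le> (\<Sum>i<m. cmod (\<phi> i (k i) - (\<Sum>n<N. \<alpha> i n * \<xi> n (\<phi> i)))) + (\<Sum>n<N. cmod (\<xi> n (\<psi> n)))"
        by (smt (verit) norm_triangle_ineq sum_norm_le norm_sum)
      also have "\<dots> \<le> S"
        unfolding S_def
        by (intro add_mono sum_mono bidual_boundD(3)[OF res] bidual_boundD(3)[OF \<xi>] \<phi>D \<psi>D L M) auto
      finally show ?thesis using h(4) by simp
    qed
    \<comment> \<open>Both the vectors and the errors exhaust the bounds allowed in C, in directions
      where \<open>\<psi> n\<close> and \<open>\<phi> i\<close> are almost maximal.\<close>
    define z where "z i = (if i < m then \<Phi> (\<lambda>n. of_real (2 * c n) *\<^sub>C y n) i + of_real (2 * \<tau>) *\<^sub>C x i else 0)" for i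
    have "z \<in> C"
      unfolding C_def
    proof (intro CollectI exI[of _ "\<lambda>n. of_real (2 * c n) *\<^sub>C y n"] conjI allI impI)
      show "norm (of_real (2 * c n) *\<^sub>C y n) \<le> 2 * c n" for n
        unfolding norm_scaleC norm_of_real using c[of n] y(1)[of n] by simp
      show "norm (z i - \<Phi> (\<lambda>n. of_real (2 * c n) *\<^sub>C y n) i) \<le> 2 * \<tau>" if "i < m" for i
        using that x(1)[of i] \<tau> by (simp add: z_def norm_scaleC norm_mult)
    qed
    moreover have "h z = of_real ((\<Sum>n<N. 2 * c n * r n) + (\<Sum>i<m. 2 * \<tau> * s i))"
    proof -
      have "h z = (\<Sum>i<m. \<phi> i (\<Phi> (\<lambda>n. of_real (2 * c n) *\<^sub>C y n) i + of_real (2 * \<tau>) *\<^sub>C x i))"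
        using h_sum[of m "\<lambda>i. \<Phi> (\<lambda>n. of_real (2 * c n) *\<^sub>C y n) i + of_real (2 * \<tau>) *\<^sub>C x i"]
        by (simp only: z_def[abs_def])
      also have "\<dots> = (\<Sum>i<m. (\<Sum>n<N. of_real (2 * c n) * (\<alpha> i n * \<phi> i (y n))) + of_real (2 * \<tau>) * of_real (s i))"
        by (simp only: \<phi>_add \<phi>_scale \<Phi>_def dual_carrier_sum[OF \<phi>D] x(2) mult.left_commute)
      also have "\<dots> = (\<Sum>i<m. \<Sum>n<N. of_real (2 * c n) * (\<alpha> i n * \<phi> i (y n))) + (\<Sum>i<m. of_real (2 * \<tau>) * of_real (s i))"
        by (rule sum.distrib)
      also have "(\<Sum>i<m. \<Sum>n<N. of_real (2 * c n) * (\<alpha> i n * \<phi> i (y n))) = (\<Sum>n<N. of_real (2 * c n) * of_real (r n))"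
        unfolding y(2)[symmetric] \<psi>_apply sum_distrib_left by (rule sum.swap)
      finally show ?thesis by simp
    qed
    ultimately have "\<bar>(\<Sum>n<N. 2 * c n * r n) + (\<Sum>i<m. 2 * \<tau> * s i)\<bar> \<le> 1"
      using h(3)[of z] by (simp only: norm_of_real)
    moreover have "(\<Sum>n<N. 2 * c n * (3 / 4 * L n)) + (\<Sum>i<m. 2 * \<tau> * (3 / 4 * M i))
        \<le> (\<Sum>n<N. 2 * c n * r n) + (\<Sum>i<m. 2 * \<tau> * s i)"
      using c \<tau> x(3) y(3) by (intro add_mono sum_mono mult_left_mono) (auto simp: less_imp_le)
    moreover have "(\<Sum>n<N. 2 * c n * (3 / 4 * L n)) + (\<Sum>i<m. 2 * \<tau> * (3 / 4 * M i)) = 3 / 2 * S"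
      by (simp add: S_def sum_distrib_left distrib_left mult_ac)
    ultimately show False using \<open>1 \<le> S\<close> by linarith
  qed
  then obtain y where "\<And>n. norm (y n) \<le> 2 * c n" "\<And>i. i < m \<Longrightarrow> norm (k' i - \<Phi> y i) \<le> 2 * \<tau>"
    unfolding C_def by blast
  with that[of y] show thesis by (simp add: k'_def \<Phi>_def)
qed

section \<open>Gluing of sequences and finite nets of coefficients\<close>

lemma powr_add_powr_le:
  fixes x y p :: real
  assumes p: "1 \<le> p" and "0 \<le> x" "0 \<le> y"
  shows "x powr p + y powr p \<le> (x + y) powr p"
proof -
  have "(x powr p + y powr p) powr (1 / p) \<le> x + y"
    \<comment> \<open>Minkowski's inequality in the plane for the vectors (x, 0) and (0, y).\<close>
    using minkowski_finite[OF p, of "\<lambda>b. if b then x else 0" "\<lambda>b. if b then 0 else y" UNIV] assms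
    by (simp add: UNIV_bool powr_powr_inverse add.commute)
  then show ?thesis using assms by (subst (asm) powr_inverse_le_iff) auto
qed

text \<open>In \<open>polar_set_step\<close> this puts the errors at the m net points in front of a
  sequence of functionals. The factor \<open>m + 1\<close> in place of m^(1/p) is crude, which is
  harmless there, since t is chosen after m.\<close>

lemma lp_norm_glue:
  fixes r s :: "nat \<Rightarrow> real" and m :: nat
  assumes p: "1 \<le> p" and r: "\<And>n. 0 \<le> r n" and s: "\<And>n. 0 \<le> s n"
    and sm: "summable (\<lambda>n. r n powr p)"
  defines "g \<equiv> \<lambda>i. if i < m then s i else r (i - m)"
  shows "summable (\<lambda>i. g i powr p)" and "lp_norm p r \<le> lp_norm p g"
    and "\<And>t. (\<And>n. s n \<le> t) \<Longrightarrow> lp_norm p g \<le> real (m + 1) * t + lp_norm p r"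
proof -
  have shift: "g (n + m) = r n" for n by (simp add: g_def)
  have "summable (\<lambda>n. g (n + m) powr p)" using sm by (simp add: shift)
  then show smg: "summable (\<lambda>i. g i powr p)" by (subst (asm) summable_iff_shift)
  have eq: "(\<Sum>i. g i powr p) = (\<Sum>n. r n powr p) + (\<Sum>i<m. s i powr p)"
    using suminf_split_initial_segment[OF smg, of m] by (simp add: shift) (simp add: g_def)
  have nonneg: "0 \<le> (\<Sum>i<m. s i powr p)" by (intro sum_nonneg) auto
  show "lp_norm p r \<le> lp_norm p g"
    unfolding lp_norm_def eq using nonneg sm p by (intro powr_mono2) (auto intro: suminf_nonneg)
  show "lp_norm p g \<le> real (m + 1) * t + lp_norm p r" if t: "\<And>n. s n \<le> t" for t
  proof -
    have t0: "0 \<le> t" using s[of 0] t[of 0] by simp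
    have "(\<Sum>i<m. s i powr p) \<le> (\<Sum>i<m. t powr p)" using s t p by (intro sum_mono powr_mono2) auto
    also have "\<dots> \<le> real (m + 1) powr 1 * t powr p" by (simp add: mult_right_mono)
    also have "\<dots> \<le> real (m + 1) powr p * t powr p" using p by (intro mult_right_mono powr_mono) auto
    also have "\<dots> = (real (m + 1) * t) powr p" using t0 by (simp add: powr_mult)
    finally have "(\<Sum>i. g i powr p) \<le> (real (m + 1) * t) powr p + lp_norm p r powr p"
      unfolding eq lp_norm_powr[OF sm p] by simp
    also have "\<dots> \<le> (real (m + 1) * t + lp_norm p r) powr p"
      using t0 p by (intro powr_add_powr_le) (auto simp: lp_norm_nonneg)
    finally show ?thesis
      unfolding lp_norm_def[of p g] using t0 p smg
      by (subst powr_inverse_le_iff) (auto simp: lp_norm_nonneg intro!: suminf_nonneg add_nonneg_nonneg)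
  qed
qed

text \<open>The net has to consist of members of K. Each member is assigned the centres of a finite
  cover of the disc that are near its first N coordinates; only finitely many such keys occur, and
  one member is kept for each. Centres within \<delta>/2 give distance \<delta> between members with
  equal keys.\<close>

lemma finite_coordinate_net:
  fixes a :: "'k \<Rightarrow> nat \<Rightarrow> complex"
  assumes a: "\<And>k n. k \<in> K \<Longrightarrow> cmod (a k n) \<le> 1" and \<delta>: "0 < \<delta>"
  obtains T where "finite T" "T \<subseteq> K" "\<And>k. k \<in> K \<Longrightarrow> \<exists>t\<in>T. \<forall>n<N. cmod (a k n - a t n) \<le> \<delta>"
proof -
  have "compact (cball (0::complex) 1)" by simp
  then obtain G where G: "finite G" "cball (0::complex) 1 \<subseteq> (\<Union>x\<in>G. ball x (\<delta> / 2))"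
    using \<delta> unfolding compact_eq_totally_bounded by (meson half_gt_zero)
  have "\<exists>x\<in>G. dist x (a k n) < \<delta> / 2" if "k \<in> K" for k n
  proof -
    have "a k n \<in> cball 0 1" using a[OF that, of n] by simp
    with G(2) show ?thesis by fastforce
  qed
  then obtain g where g: "\<And>k n. k \<in> K \<Longrightarrow> g k n \<in> G" "\<And>k n. k \<in> K \<Longrightarrow> dist (g k n) (a k n) < \<delta> / 2" by metis
  define key where "key k = restrict (g k) {..<N}" for k
  have "key ` K \<subseteq> {..<N} \<rightarrow>\<^sub>E G" using g(1) by (simp add: key_def image_subset_iff restrict_PiE_iff)
  then have "finite (key ` K)" using G(1) by (meson finite_PiE finite_lessThan finite_subset)
  then obtain T where T: "T \<subseteq> K" "finite T" "key ` K = key ` T"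
    by (metis finite_subset_image order_refl)
  show thesis
  proof (rule that[OF T(2,1)])
    fix k assume k: "k \<in> K"
    then obtain t where t: "t \<in> T" "key k = key t" using T(3) by blast
    have "cmod (a k n - a t n) \<le> \<delta>" if "n < N" for n
    proof -
      have "g k n = g t n" using fun_cong[OF t(2), of n] that by (simp add: key_def)
      moreover have "dist (g k n) (a k n) < \<delta> / 2" "dist (g t n) (a t n) < \<delta> / 2"
        using g(2) k t(1) T(1) by blast+
      ultimately have "dist (a k n) (a t n) < \<delta>" by (metis dist_commute dist_triangle_half_r)
      then show ?thesis by (simp add: dist_norm)
    qed
    with t(1) show "\<exists>t\<in>T. \<forall>n<N. cmod (a k n - a t n) \<le> \<delta>" by blast
  qed
qed

section \<open>Approximation of bidual sequences by sequences in the space\<close>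

text \<open>For linear \<xi>, the polar in the space of the functionals \<phi> whose sequence of
  values \<open>\<xi> n \<phi>\<close> has p-norm at most one. It plays the part of the p-convex
  hull of \<xi> intersected with the space, and \<open>bidual_representation\<close> supplies the
  coefficients.\<close>

definition polar_set :: "real \<Rightarrow> (nat \<Rightarrow> ('f::complex_normed_vector \<Rightarrow> complex) \<Rightarrow> complex) \<Rightarrow> 'f set" where
  "polar_set p \<xi> = {k. \<forall>\<phi>\<in>dual_carrier. cmod (\<phi> k) \<le> lp_norm p (\<lambda>n. cmod (\<xi> n \<phi>))}"

text \<open>The order of the choices matters: \<open>N\<close> and \<open>\<delta>\<close> determine the net \<open>t\<close>, whose size \<open>m\<close> determines
  the accuracy \<open>\<tau>\<close>, which in turn determines \<open>N'\<close>.\<close>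

lemma polar_set_step:
  fixes \<xi> :: "nat \<Rightarrow> ('f::complex_normed_vector \<Rightarrow> complex) \<Rightarrow> complex"
  assumes p: "1 \<le> p" and c: "\<And>n. 0 < c n" and smc: "summable (\<lambda>n. c n powr p)"
    and \<xi>: "\<And>n. bidual_bound (c n) (\<xi> n)" and \<epsilon>: "0 < \<epsilon>"
  obtains N y \<xi>' c' where "\<And>n. norm (y n) \<le> 2 * c n" "\<And>n. 0 < c' n" "summable (\<lambda>n. c' n powr p)"
    "lp_norm p c' \<le> \<epsilon>" "\<And>n. bidual_bound (c' n) (\<xi>' n)"
    "\<And>k. k \<in> polar_set p \<xi> \<Longrightarrow> \<exists>a\<in>dual_ball p. k - (\<Sum>n<N. a n *\<^sub>C y n) \<in> polar_set p \<xi>'"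
proof -
  define tail where "tail N n = (if n < N then 0 else c n)" for N n
  have tail0: "0 \<le> tail N n" for N n using c[of n] by (simp add: tail_def)
  have tail_sm: "summable (\<lambda>n. tail N n powr p)" for N
    using c by (intro lp_norm_mono(1)[OF p smc]) (simp_all add: tail_def less_imp_le)
  have tail_small: "\<exists>N\<ge>M. lp_norm p (tail N) \<le> e" if "0 < e" for e M
  proof -
    have "(\<lambda>N. lp_norm p (tail N)) \<longlonglongrightarrow> 0" unfolding tail_def by (rule lp_norm_tail_tendsto_0[OF p smc])
    from order_tendstoD(2)[OF this that] obtain M' where "\<And>N. N \<ge> M' \<Longrightarrow> lp_norm p (tail N) < e"
      unfolding eventually_sequentially by blast
    then show ?thesis by (intro exI[of _ "max M M'"]) (simp add: less_imp_le)
  qed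
  \<comment> \<open>The norm of the new bounds \<open>c'\<close> is made of three parts of size at
    most \<epsilon>/3: 18 times this tail, 9 \<kappa> times the norm of c, and 6 \<tau> times m +
    1.\<close>
  obtain N where N: "lp_norm p (tail N) \<le> \<epsilon> / 54" using tail_small[of "\<epsilon> / 54" 0] \<epsilon> by auto
  define \<kappa> where "\<kappa> = \<epsilon> / (27 * (lp_norm p c + 1))"
  have \<kappa>: "0 < \<kappa>" "9 * \<kappa> * lp_norm p c \<le> \<epsilon> / 3"
    using \<epsilon> lp_norm_nonneg[of p c] by (auto simp: \<kappa>_def field_simps)
  \<comment> \<open>Division by N + 1 lets the sum of N terms \<delta> times \<open>z n\<close> be
    bounded by the largest \<kappa> times \<open>z n\<close>, hence by a single p-norm.\<close>
  define \<delta> where "\<delta> = \<kappa> / real (N + 1)"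
  have \<delta>: "0 < \<delta>" using \<kappa> by (simp add: \<delta>_def)
  have "\<exists>a. a \<in> dual_ball p \<and> (\<forall>\<phi>\<in>dual_carrier. (\<lambda>n. a n * \<xi> n \<phi>) sums \<phi> k)" if "k \<in> polar_set p \<xi>" for k
    by (rule bidual_representation[OF p c smc \<xi>, of k]) (use that in \<open>auto simp: polar_set_def\<close>)
  then obtain a where a: "\<And>k. k \<in> polar_set p \<xi> \<Longrightarrow> a k \<in> dual_ball p"
    "\<And>k \<phi>. k \<in> polar_set p \<xi> \<Longrightarrow> \<phi> \<in> dual_carrier \<Longrightarrow> (\<lambda>n. a k n * \<xi> n \<phi>) sums \<phi> k" by metis
  obtain T where T: "finite T" "T \<subseteq> polar_set p \<xi>"
    "\<And>k. k \<in> polar_set p \<xi> \<Longrightarrow> \<exists>t\<in>T. \<forall>n<N. cmod (a k n - a t n) \<le> \<delta>"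
    using finite_coordinate_net[of "polar_set p \<xi>" a \<delta> N] dual_ball_cmod_le_1[OF a(1)] \<delta> by blast
  obtain m and t :: "nat \<Rightarrow> 'f" where t: "T = t ` {..<m}"
    using finite_imp_nat_seg_image_inj_on[OF T(1)] by (auto simp: lessThan_def)
  have tP: "t i \<in> polar_set p \<xi>" if "i < m" for i using that t T(2) by auto
  define \<tau> where "\<tau> = \<epsilon> / (18 * real (m + 1))"
  have \<tau>: "0 < \<tau>" "real (m + 1) * (6 * \<tau>) = \<epsilon> / 3" using \<epsilon> by (auto simp: \<tau>_def field_simps)
  obtain N' where N': "N' \<ge> N" "lp_norm p (tail N') \<le> \<tau>" using tail_small[OF \<tau>(1)] by blast
  \<comment> \<open>The remainder of the series for \<open>\<phi> (t i)\<close> has coefficients in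
    the dual ball, so its norm in the bidual is at most the p-norm of the tail of c from N'
    on.\<close>
  have res: "bidual_bound \<tau> (\<lambda>\<phi>. \<phi> (t i) - (\<Sum>n<N'. a (t i) n * \<xi> n \<phi>))" if i: "i < m" for i
    unfolding bidual_bound_def
  proof (intro conjI ballI allI impI)
    fix \<phi> \<psi> :: "'f \<Rightarrow> complex" assume "\<phi> \<in> dual_carrier" "\<psi> \<in> dual_carrier"
    then show "(\<phi> + \<psi>) (t i) - (\<Sum>n<N'. a (t i) n * \<xi> n (\<phi> + \<psi>)) =
        \<phi> (t i) - (\<Sum>n<N'. a (t i) n * \<xi> n \<phi>) + (\<psi> (t i) - (\<Sum>n<N'. a (t i) n * \<xi> n \<psi>))"
      by (simp add: bidual_boundD(1)[OF \<xi>] distrib_left sum.distrib del: plus_fun_def)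
  next
    fix b and \<phi> :: "'f \<Rightarrow> complex" assume "\<phi> \<in> dual_carrier"
    then show "(b *\<^sub>C \<phi>) (t i) - (\<Sum>n<N'. a (t i) n * \<xi> n (b *\<^sub>C \<phi>)) =
        b * (\<phi> (t i) - (\<Sum>n<N'. a (t i) n * \<xi> n \<phi>))"
      using bidual_boundD(2)[OF \<xi>, of \<phi> _ b]
      by (simp add: right_diff_distrib sum_distrib_left mult.left_commute) (simp add: scaleC_fun_def scaleC_complex_def)
  next
    fix \<phi> :: "'f \<Rightarrow> complex" and L :: real
    assume \<phi>: "\<phi> \<in> dual_carrier" and L: "0 \<le> L" "\<forall>x. cmod (\<phi> x) \<le> L * norm x"
    define z where "z n = (if n < N' then 0 else \<xi> n \<phi>)" for n
    have "(\<lambda>n. if n \<in> {..<N'} then a (t i) n * \<xi> n \<phi> else 0) sums (\<Sum>n<N'. a (t i) n * \<xi> n \<phi>)"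
      by (rule sums_If_finite_set) simp
    from sums_diff[OF a(2)[OF tP[OF i] \<phi>] this]
    have "(\<lambda>n. a (t i) n * z n) sums (\<phi> (t i) - (\<Sum>n<N'. a (t i) n * \<xi> n \<phi>))"
      by (rule sums_cong[THEN iffD1, rotated]) (simp add: z_def)
    then have eq: "\<phi> (t i) - (\<Sum>n<N'. a (t i) n * \<xi> n \<phi>) = (\<Sum>n. a (t i) n * z n)" by (simp add: sums_iff)
    note sc = lp_norm_scale[OF p L(1) tail0 tail_sm, of N']
    have le: "cmod (z n) \<le> L * tail N' n" for n
      using bidual_boundD(3)[OF \<xi> \<phi> L(1), of n] L(2) by (simp add: z_def tail_def mult.commute)
    note mono = lp_norm_mono[OF p sc(1) norm_ge_zero le]
    have "cmod (\<Sum>n. a (t i) n * z n) \<le> L * lp_norm p (tail N')"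
      using dual_ball_sums(2)[OF a(1)[OF tP[OF i]] p mono(1)] mono(2) sc(2) by simp
    also have "\<dots> \<le> \<tau> * L" using mult_left_mono[OF N'(2) L(1)] by (simp add: mult.commute)
    finally show "cmod (\<phi> (t i) - (\<Sum>n<N'. a (t i) n * \<xi> n \<phi>)) \<le> \<tau> * L" by (simp add: eq)
  qed
  obtain y where y: "\<And>n. norm (y n) \<le> 2 * c n"
    "\<And>i. i < m \<Longrightarrow> norm (t i - (\<Sum>n<N'. a (t i) n *\<^sub>C y n)) \<le> 2 * \<tau>"
  proof (rule helly_approximation[OF c \<xi> \<tau>(1) res])
    fix y :: "nat \<Rightarrow> 'f"
    assume "\<And>n. norm (y n) \<le> 2 * c n"
      "\<And>i. i < m \<Longrightarrow> norm (t i - (\<Sum>n<N'. a (t i) n *\<^sub>C y n)) \<le> 2 * \<tau>"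
    then show thesis by (rule that)
  qed
  \<comment> \<open>The functionals corrected by the vectors found in the space. The remainder of
    every k is represented by \<zeta> with the same coefficients as k by \<xi>; the bound 3
    \<open>c n\<close> is \<open>c n\<close> plus 2 \<open>c n\<close>.\<close>
  define \<zeta> where "\<zeta> n \<phi> = \<xi> n \<phi> - \<phi> (if n < N' then y n else 0)" for n and \<phi> :: "'f \<Rightarrow> complex"
  have \<zeta>: "bidual_bound (3 * c n) (\<zeta> n)" for n
    unfolding \<zeta>_def
    by (rule bidual_bound_mono[OF bidual_bound_diff[OF \<xi> bidual_bound_eval]])
      (use y(1)[of n] c[of n] in auto)
  have sm3c: "summable (\<lambda>n. (3 * c n) powr p)" using lp_norm_scale(1)[OF p _ _ smc, of 3] c by (simp add: less_imp_le)
  have \<zeta>_sm: "summable (\<lambda>n. cmod (\<zeta> n \<phi>) powr p)" if "\<phi> \<in> dual_carrier" for \<phi>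
    by (rule bidual_bound_summable(1)[OF p _ sm3c \<zeta> that]) (use c in simp)
  have rep: "(\<lambda>n. a k n * \<zeta> n \<phi>) sums \<phi> (k - (\<Sum>n<N'. a k n *\<^sub>C y n))"
    if k: "k \<in> polar_set p \<xi>" and \<phi>: "\<phi> \<in> dual_carrier" for k \<phi>
  proof -
    have "(\<lambda>n. if n \<in> {..<N'} then a k n * \<phi> (y n) else 0) sums (\<Sum>n<N'. a k n * \<phi> (y n))"
      by (rule sums_If_finite_set) simp
    from sums_diff[OF a(2)[OF k \<phi>] this]
    have "(\<lambda>n. a k n * \<zeta> n \<phi>) sums (\<phi> k - (\<Sum>n<N'. a k n * \<phi> (y n)))"
      by (rule sums_cong[THEN iffD1, rotated]) (simp add: \<zeta>_def dual_carrier_0[OF \<phi>] right_diff_distrib)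
    then show ?thesis by (simp add: dual_carrier_diff[OF \<phi>] dual_carrier_sum[OF \<phi>] dual_carrier_scaleC[OF \<phi>])
  qed
  define w where "w i = t i - (\<Sum>n<N'. a (t i) n *\<^sub>C y n)" for i
  \<comment> \<open>Below N the coefficients of k and of a nearby net point almost agree, whence the
    small weight; from N on the two coefficient sequences are estimated separately, which costs the
    factor 2.\<close>
  define s where "s n = (if n < N then \<kappa> else 2)" for n
  have s: "0 < s n" for n using \<kappa> by (simp add: s_def)
  \<comment> \<open>All entries of \<open>\<xi>'\<close> carry a factor 3, needed at the end to
    dominate a sum by one norm. Thus 6 \<tau> is 3 times the bound 2 \<tau> for the error
    \<open>w i\<close>, and 9 is 3 times the factor in the bound for \<zeta>.\<close>
  define c' where "c' i = (if i < m then 6 * \<tau> else 9 * s (i - m) * c (i - m))" for i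
  define \<xi>' where "\<xi>' i \<phi> = (if i < m then of_real 3 * \<phi> (w i) else of_real (3 * s (i - m)) * \<zeta> (i - m) \<phi>)"
    for i and \<phi> :: "'f \<Rightarrow> complex"
  have sc_le: "9 * s n * c n \<le> 9 * \<kappa> * c n + 18 * tail N n" for n
    using \<kappa> c[of n] by (simp add: s_def tail_def)
  note l1 = lp_norm_scale[OF p, of "9 * \<kappa>" c, OF _ _ smc]
  note l2 = lp_norm_scale[OF p, of 18 "tail N", OF _ _ tail_sm]
  have l3: "summable (\<lambda>n. (9 * \<kappa> * c n + 18 * tail N n) powr p)"
    "lp_norm p (\<lambda>n. 9 * \<kappa> * c n + 18 * tail N n) \<le> 9 * \<kappa> * lp_norm p c + 18 * lp_norm p (tail N)"
    using lp_norm_add[OF p _ _ l1(1) l2(1)] l1(2) l2(2) \<kappa> c tail0 by (simp_all add: less_imp_le)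
  have l4: "summable (\<lambda>n. (9 * s n * c n) powr p)" "lp_norm p (\<lambda>n. 9 * s n * c n) \<le> 2 * \<epsilon> / 3"
    using lp_norm_mono[OF p l3(1) _ sc_le] l3(2) \<kappa>(2) N s c by (simp_all add: less_imp_le)
  note gc = lp_norm_glue[OF p, where r = "\<lambda>n. 9 * s n * c n" and s = "\<lambda>_. 6 * \<tau>" and m = m, OF _ _ l4(1)]
  show thesis
  proof (rule that[of y c' \<xi>' N', OF y(1)])
    show "0 < c' n" for n using \<tau>(1) s c by (simp add: c'_def)
    show "summable (\<lambda>n. c' n powr p)"
      unfolding c'_def using gc(1) s c \<tau>(1) by (simp add: less_imp_le)
    have "lp_norm p c' \<le> real (m + 1) * (6 * \<tau>) + 2 * \<epsilon> / 3"
      unfolding c'_def[abs_def] using gc(3)[where t = "6 * \<tau>"] l4(2) s c \<tau>(1) by (simp add: less_imp_le)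
    then show "lp_norm p c' \<le> \<epsilon>" unfolding \<tau>(2) by simp
    show "bidual_bound (c' i) (\<xi>' i)" for i
    proof (cases "i < m")
      case True
      have "bidual_bound (3 * norm (w i)) (\<lambda>\<phi>. of_real 3 * \<phi> (w i))"
        by (rule bidual_bound_scale[OF bidual_bound_eval]) simp
      then have "bidual_bound (6 * \<tau>) (\<lambda>\<phi>. of_real 3 * \<phi> (w i))"
        by (rule bidual_bound_mono) (use y(2)[OF True] in \<open>simp add: w_def\<close>)
      with True show ?thesis by (simp add: c'_def \<xi>'_def[abs_def])
    next
      case False
      have "bidual_bound (3 * s (i - m) * (3 * c (i - m))) (\<lambda>\<phi>. of_real (3 * s (i - m)) * \<zeta> (i - m) \<phi>)"
        by (rule bidual_bound_scale[OF \<zeta>]) (use s[of "i - m"] in simp)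
      with False show ?thesis by (simp add: c'_def \<xi>'_def[abs_def] mult.assoc mult.left_commute)
    qed
    fix k assume k: "k \<in> polar_set p \<xi>"
    \<comment> \<open>The remainder of k is compared with the remainder \<open>w i\<close> of a net
      point whose first N coefficients are close to those of k.\<close>
    obtain i where i: "i < m" "\<And>n. n < N \<Longrightarrow> cmod (a k n - a (t i) n) \<le> \<delta>"
      using T(3)[OF k] unfolding t by auto
    let ?e = "k - (\<Sum>n<N'. a k n *\<^sub>C y n)"
    have "?e \<in> polar_set p \<xi>'"
      unfolding polar_set_def
    proof (intro CollectI ballI)
      fix \<phi> :: "'f \<Rightarrow> complex" assume \<phi>: "\<phi> \<in> dual_carrier"
      define z where "z n = cmod (\<zeta> n \<phi>)" for n
      define z2 where "z2 n = (if n < N then 0 else z n)" for n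
      define \<eta> where "\<eta> n = s n * z n" for n
      have z: "0 \<le> z n" "0 \<le> z2 n" "0 \<le> \<eta> n" for n using s[of n] by (simp_all add: z_def z2_def \<eta>_def)
      have smz: "summable (\<lambda>n. z n powr p)" using \<zeta>_sm[OF \<phi>] by (simp add: z_def)
      have smz2: "summable (\<lambda>n. z2 n powr p)"
        by (rule lp_norm_mono(1)[OF p smz]) (use z in \<open>auto simp: z2_def\<close>)
      have sm\<eta>: "summable (\<lambda>n. \<eta> n powr p)"
      proof (rule lp_norm_mono(1)[OF p lp_norm_scale(1)[OF p, of "\<kappa> + 2" z, OF _ _ smz]])
        show "\<eta> n \<le> (\<kappa> + 2) * z n" for n
          unfolding \<eta>_def using \<kappa>(1) z by (intro mult_right_mono) (auto simp: s_def)
      qed (use z \<kappa>(1) in auto)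
      define A where "A = lp_norm p \<eta>"
      have z2A: "2 * lp_norm p z2 \<le> A"
      proof -
        have "lp_norm p (\<lambda>n. 2 * z2 n) \<le> A"
          unfolding A_def by (rule lp_norm_mono(2)[OF p sm\<eta>]) (use z \<kappa>(1) in \<open>auto simp: z2_def \<eta>_def s_def\<close>)
        then show ?thesis using lp_norm_scale(2)[OF p, of 2 z2, OF _ _ smz2] z by simp
      qed
      have sum1: "(\<Sum>n<N. \<delta> * z n) \<le> A"
      proof -
        have "\<delta> * z n \<le> A / real (N + 1)" if "n < N" for n
        proof -
          have "\<eta> n \<le> A" unfolding A_def by (rule le_lp_norm[OF sm\<eta> p z(3)])
          then have "\<eta> n / real (N + 1) \<le> A / real (N + 1)" by (rule divide_right_mono) simp
          then show ?thesis using that by (simp add: \<delta>_def \<eta>_def s_def)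
        qed
        then have "(\<Sum>n<N. \<delta> * z n) \<le> (\<Sum>n<N. A / real (N + 1))" by (intro sum_mono) auto
        also have "\<dots> = A * (real N / real (N + 1))" by simp
        also have "\<dots> \<le> A * 1" by (rule mult_left_mono) (auto simp: A_def lp_norm_nonneg)
        finally show ?thesis by simp
      qed
      note dk = dual_ball_abs_sums[OF a(1)[OF k] p z(2) smz2]
      note dt = dual_ball_abs_sums[OF a(1)[OF tP[OF i(1)]] p z(2) smz2]
      \<comment> \<open>A summable majorant for the difference of the two series: the coefficient
        difference is at most \<delta> below N, and is split by the triangle inequality from N
        on.\<close>
      define u where "u n = (if n \<in> {..<N} then \<delta> * z n else 0) + (cmod (a k n) * z2 n + cmod (a (t i) n) * z2 n)" for n
      have su: "u sums ((\<Sum>n<N. \<delta> * z n) + ((\<Sum>n. cmod (a k n) * z2 n) + (\<Sum>n. cmod (a (t i) n) * z2 n)))"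
        unfolding u_def by (intro sums_add sums_If_finite_set summable_sums dk(1) dt(1)) simp
      have "(\<lambda>n. a k n * \<zeta> n \<phi> - a (t i) n * \<zeta> n \<phi>) sums (\<phi> ?e - \<phi> (w i))"
        unfolding w_def using rep[OF k \<phi>] rep[OF tP[OF i(1)] \<phi>] by (rule sums_diff)
      then have eq: "\<phi> ?e - \<phi> (w i) = (\<Sum>n. (a k n - a (t i) n) * \<zeta> n \<phi>)"
        by (simp add: sums_iff left_diff_distrib)
      have le: "norm ((a k n - a (t i) n) * \<zeta> n \<phi>) \<le> u n" for n
      proof (cases "n < N")
        case True
        then show ?thesis using i(2)[OF True] z(1)[of n] unfolding norm_mult z_def[symmetric]
          by (simp add: u_def z2_def mult_right_mono)
      next
        case False
        then show ?thesis
          using mult_right_mono[OF norm_triangle_ineq4[of "a k n" "a (t i) n"] z(1)[of n]]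
          unfolding norm_mult z_def[symmetric] by (simp add: u_def z2_def distrib_right)
      qed
      have "cmod (\<phi> ?e - \<phi> (w i)) \<le> suminf u"
        unfolding eq by (rule norm_suminf_le[OF le sums_summable[OF su]])
      also have "\<dots> \<le> 2 * A"
        using sums_unique[OF su] sum1 dk(2) dt(2) z2A by linarith
      finally have le1: "cmod (\<phi> ?e) \<le> 2 * A + cmod (\<phi> (w i))"
        using norm_triangle_sub[of "\<phi> ?e" "\<phi> (w i)"] by linarith
      \<comment> \<open>Both A and \<open>cmod (\<phi> (w i))\<close> are at most a third of the
        norm of g, which therefore dominates 2 A + \<open>cmod (\<phi> (w i))\<close>.\<close>
      define g where "g j = (if j < m then 3 * cmod (\<phi> (w j)) else 3 * \<eta> (j - m))" for j
      have \<xi>'g: "(\<lambda>n. cmod (\<xi>' n \<phi>)) = g"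
        using s by (auto simp: \<xi>'_def g_def \<eta>_def z_def norm_mult fun_eq_iff less_imp_le)
      note sc3 = lp_norm_scale[OF p, of 3 \<eta>, OF _ z(3) sm\<eta>]
      have smg: "summable (\<lambda>j. g j powr p)" and Ag: "3 * A \<le> lp_norm p g"
        using lp_norm_glue(1,2)[OF p, where r = "\<lambda>n. 3 * \<eta> n" and s = "\<lambda>j. 3 * cmod (\<phi> (w j))" and m = m, OF _ _ sc3(1)] sc3(2) z
        by (simp_all add: g_def[abs_def] A_def)
      have "g i \<le> lp_norm p g" by (rule le_lp_norm[OF smg p]) (simp add: g_def i)
      then have "3 * cmod (\<phi> (w i)) \<le> lp_norm p g" by (simp add: g_def i)
      with le1 Ag show "cmod (\<phi> ?e) \<le> lp_norm p (\<lambda>n. cmod (\<xi>' n \<phi>))"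
        unfolding \<xi>'g by linarith
    qed
    with a(1)[OF k] show "\<exists>a\<in>dual_ball p. k - (\<Sum>n<N'. a n *\<^sub>C y n) \<in> polar_set p \<xi>'" by blast
  qed
qed

section \<open>Double sequences indexed by stage and position\<close>

lemma sum_pairs_le_suminf:
  fixes g :: "nat \<times> nat \<Rightarrow> real"
  assumes g: "\<And>q. 0 \<le> g q" and row: "\<And>j M. (\<Sum>n<M. g (j, n)) \<le> B j" and B: "summable B" and F: "finite F"
  shows "sum g F \<le> suminf B"
proof -
  \<comment> \<open>A finite set of pairs lies in a square, which is then summed by rows; the
    inserted 0 covers the empty set.\<close>
  define J where "J = Suc (Max (insert 0 (fst ` F \<union> snd ` F)))"
  have "F \<subseteq> {..<J} \<times> {..<J}"
  proof
    fix q assume q: "q \<in> F"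
    have "fst q \<le> Max (insert 0 (fst ` F \<union> snd ` F))" "snd q \<le> Max (insert 0 (fst ` F \<union> snd ` F))"
      using q F by (auto intro!: Max_ge)
    then show "q \<in> {..<J} \<times> {..<J}" by (cases q) (simp add: J_def)
  qed
  then have "sum g F \<le> sum g ({..<J} \<times> {..<J})" using g by (intro sum_mono2) auto
  also have "\<dots> = (\<Sum>j<J. \<Sum>n<J. g (j, n))" by (simp add: sum.cartesian_product)
  also have "\<dots> \<le> (\<Sum>j<J. B j)" by (intro sum_mono row)
  also have "\<dots> \<le> suminf B"
    using row[of _ 0] by (intro sum_le_suminf B) auto
  finally show ?thesis .
qed

lemma dual_ball_reindex:
  fixes f :: "'a \<Rightarrow> 'b"
  assumes \<alpha>: "\<alpha> \<in> dual_ball p" and f: "bij f"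
  shows "(\<lambda>i. \<alpha> (f i)) \<in> dual_ball p"
  unfolding dual_ball_def
proof (intro CollectI allI impI)
  fix A :: "'a set" and u :: "'a \<Rightarrow> real" assume A: "finite A" "\<forall>i. 0 \<le> u i"
  have inj: "inj_on f A" using f by (auto simp: bij_def intro: inj_on_subset)
  have inv: "inv f (f i) = i" for i using f by (simp add: bij_def)
  show "(\<Sum>i\<in>A. cmod (\<alpha> (f i)) * u i) \<le> (\<Sum>i\<in>A. u i powr p) powr (1 / p)"
    using dual_ballD[OF \<alpha>, of "f ` A" "\<lambda>q. u (inv f q)"] A
    by (simp add: sum.reindex[OF inj] inv)
qed

text \<open>The row weights (1/2)^(j+1) add up to one, and the p-norm of u on a single row is at
  most its p-norm on all of F.\<close>

lemma dual_ball_rows: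
  fixes A :: "nat \<Rightarrow> nat \<Rightarrow> complex"
  assumes p: "1 \<le> p" and A: "\<And>j. A j \<in> dual_ball p"
  shows "(\<lambda>(j, n). if n < N j then of_real ((1/2) ^ Suc j) * A j n else 0) \<in> dual_ball p" (is "?\<alpha> \<in> _")
  unfolding dual_ball_def
proof (intro CollectI allI impI)
  fix F :: "(nat \<times> nat) set" and u :: "nat \<times> nat \<Rightarrow> real" assume F: "finite F" and "\<forall>i. 0 \<le> u i"
  then have u: "\<And>q. 0 \<le> u q" by blast
  define W where "W = (\<Sum>q\<in>F. u q powr p) powr (1 / p)"
  \<comment> \<open>Padding by zero outside F makes the row sums over initial segments see only
    pairs of F.\<close>
  have "(\<Sum>q\<in>F. cmod (?\<alpha> q) * u q) = (\<Sum>q\<in>F. if q \<in> F then cmod (?\<alpha> q) * u q else 0)"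
    by (intro sum.cong) auto
  also have "\<dots> \<le> (\<Sum>j. (1/2) ^ Suc j * W)"
  proof (rule sum_pairs_le_suminf)
    fix j M :: nat
    define R where "R = {n \<in> {..<M}. (j, n) \<in> F}"
    have "(\<Sum>n<M. if (j, n) \<in> F then cmod (?\<alpha> (j, n)) * u (j, n) else 0) = (\<Sum>n\<in>R. cmod (?\<alpha> (j, n)) * u (j, n))"
      unfolding R_def by (subst sum.inter_filter[symmetric]) auto
    also have "\<dots> \<le> (\<Sum>n\<in>R. (1/2) ^ Suc j * (cmod (A j n) * u (j, n)))"
      using u by (intro sum_mono) (auto simp: norm_mult norm_power)
    also have "\<dots> = (1/2) ^ Suc j * (\<Sum>n\<in>R. cmod (A j n) * u (j, n))" by (simp only: sum_distrib_left)
    also have "\<dots> \<le> (1/2) ^ Suc j * W"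
    proof (rule mult_left_mono)
      show "(\<Sum>n\<in>R. cmod (A j n) * u (j, n)) \<le> W"
      proof (cases "R = {}")
        case False
        have "(\<Sum>n\<in>R. cmod (A j n) * u (j, n)) \<le> (\<Sum>n\<in>R. u (j, n) powr p) powr (1 / p)"
          by (rule dual_ballD[OF A]) (auto simp: R_def u)
        also have "\<dots> \<le> W"
        proof -
          have "(\<Sum>n\<in>R. u (j, n) powr p) = (\<Sum>q\<in>Pair j ` R. u q powr p)"
            by (subst sum.reindex) (auto simp: inj_on_def)
          also have "\<dots> \<le> (\<Sum>q\<in>F. u q powr p)"
            using F by (intro sum_mono2) (auto simp: R_def)
          finally show ?thesis unfolding W_def using p by (intro powr_mono2) (auto intro: sum_nonneg)
        qed
        finally show ?thesis .
      qed (simp add: W_def)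
    qed simp
    finally show "(\<Sum>n<M. if (j, n) \<in> F then cmod (?\<alpha> (j, n)) * u (j, n) else 0) \<le> (1/2) ^ Suc j * W" .
  qed (use u F in \<open>auto intro!: summable_mult2 summable_geometric summable_Suc_iff[THEN iffD2]\<close>)
  also have "(\<Sum>j. (1/2) ^ Suc j * W) = W"
  proof -
    have "(\<lambda>j. (1/2::real) ^ Suc j) sums 1" by (rule power_half_series)
    from sums_mult2[OF this, of W] show ?thesis by (simp add: sums_iff)
  qed
  finally show "(\<Sum>q\<in>F. cmod (?\<alpha> q) * u q) \<le> (\<Sum>q\<in>F. u q powr p) powr (1 / p)"
    by (simp add: W_def)
qed

text \<open>The estimate for functionals of norm at most one, read through
  \<open>dual_carrier_norming\<close>. It makes the remainders of the iteration tend to zero in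
  norm.\<close>

lemma norm_le_lp_norm_of_polar_set:
  fixes \<xi> :: "nat \<Rightarrow> ('f::complex_normed_vector \<Rightarrow> complex) \<Rightarrow> complex"
  assumes p: "1 \<le> p" and c: "\<And>n. 0 < c n" "summable (\<lambda>n. c n powr p)"
    and \<xi>: "\<And>n. bidual_bound (c n) (\<xi> n)" and k: "k \<in> polar_set p \<xi>"
  shows "norm k \<le> lp_norm p c"
proof (rule dual_carrier_norming)
  fix \<phi> :: "'f \<Rightarrow> complex" assume \<phi>: "\<phi> \<in> dual_carrier" "\<And>x. cmod (\<phi> x) \<le> norm x"
  have "cmod (\<phi> k) \<le> lp_norm p (\<lambda>n. cmod (\<xi> n \<phi>))" using k \<phi>(1) by (simp add: polar_set_def)
  also have "\<dots> \<le> 1 * lp_norm p c" using bidual_bound_summable(2)[OF p c \<xi> \<phi>(1), of 1] \<phi>(2) by simp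
  finally show "cmod (\<phi> k) \<le> lp_norm p c" by simp
qed

text \<open>The gain of 4^(-j) at stage j is shared: a factor 2^(-j) remains with the rescaled
  vectors for their p-summability, and 2^(-j-1) goes to the coefficients, which places them in the
  coefficient ball even for p = 1.\<close>

theorem polar_set_relatively_p_compact:
  fixes \<xi> :: "nat \<Rightarrow> ('f::complex_banach \<Rightarrow> complex) \<Rightarrow> complex"
  assumes p: "1 \<le> p" and c: "\<And>n. 0 < c n" "summable (\<lambda>n. c n powr p)"
    and \<xi>: "\<And>n. bidual_bound (c n) (\<xi> n)"
  shows "relatively_p_compact p (polar_set p \<xi>)"
proof -
  define good where "good s \<longleftrightarrow> (\<forall>n. 0 < snd s n) \<and> summable (\<lambda>n. snd s n powr p) \<and> (\<forall>n. bidual_bound (snd s n) (fst s n))"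
    for s :: "(nat \<Rightarrow> ('f \<Rightarrow> complex) \<Rightarrow> complex) \<times> (nat \<Rightarrow> real)"
  define rel where "rel s s' \<longleftrightarrow> (\<exists>N y. (\<forall>n. norm (y n) \<le> 2 * snd s n) \<and>
      (\<forall>k\<in>polar_set p (fst s). \<exists>a\<in>dual_ball p. k - (\<Sum>n<N. a n *\<^sub>C y n) \<in> polar_set p (fst s')))"
    for s s' :: "(nat \<Rightarrow> ('f \<Rightarrow> complex) \<Rightarrow> complex) \<times> (nat \<Rightarrow> real)"
  \<comment> \<open>Stage 0 is the given data, whose norm is arbitrary; the decay is demanded from
    stage 1 on.\<close>
  define P where "P j s \<longleftrightarrow> good s \<and> (j = 0 \<longrightarrow> s = (\<xi>, c)) \<and> (0 < j \<longrightarrow> lp_norm p (snd s) \<le> (1/4) ^ j)"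
    for j :: nat and s
  have "\<exists>\<sigma>. \<forall>j. P j (\<sigma> j) \<and> rel (\<sigma> j) (\<sigma> (Suc j))"
  proof (rule dependent_nat_choice)
    show "\<exists>s. P 0 s" using c \<xi> by (intro exI[of _ "(\<xi>, c)"]) (simp add: P_def good_def)
    fix s j assume "P j s"
    then have s: "\<And>n. 0 < snd s n" "summable (\<lambda>n. snd s n powr p)" "\<And>n. bidual_bound (snd s n) (fst s n)"
      by (auto simp: P_def good_def)
    have "(0::real) < (1/4) ^ Suc j" by simp
    show "\<exists>s'. P (Suc j) s' \<and> rel s s'"
    proof (rule polar_set_step[OF p s \<open>(0::real) < (1/4) ^ Suc j\<close>])
      fix N :: nat and y :: "nat \<Rightarrow> 'f" and \<xi>' :: "nat \<Rightarrow> ('f \<Rightarrow> complex) \<Rightarrow> complex" and c' :: "nat \<Rightarrow> real"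
      assume *: "\<And>n. norm (y n) \<le> 2 * snd s n" "\<And>n. 0 < c' n" "summable (\<lambda>n. c' n powr p)"
        "lp_norm p c' \<le> (1/4) ^ Suc j" "\<And>n. bidual_bound (c' n) (\<xi>' n)"
        "\<And>k. k \<in> polar_set p (fst s) \<Longrightarrow> \<exists>a\<in>dual_ball p. k - (\<Sum>n<N. a n *\<^sub>C y n) \<in> polar_set p \<xi>'"
      show ?thesis
      proof (intro exI[of _ "(\<xi>', c')"] conjI)
        show "P (Suc j) (\<xi>', c')" using *(2-5) by (simp add: P_def good_def)
        show "rel s (\<xi>', c')"
          unfolding rel_def by (intro exI[of _ N] exI[of _ y]) (use *(1,6) in simp)
      qed
    qed
  qed
  then obtain \<sigma> where \<sigma>: "\<And>j. P j (\<sigma> j)" "\<And>j. rel (\<sigma> j) (\<sigma> (Suc j))" by blast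
  define \<Xi> where "\<Xi> j = fst (\<sigma> j)" for j
  define d where "d j = snd (\<sigma> j)" for j
  have good: "0 < d j n" "summable (\<lambda>n. d j n powr p)" "bidual_bound (d j n) (\<Xi> j n)" for j n
    using \<sigma>(1)[of j] by (auto simp: P_def good_def \<Xi>_def d_def)
  have \<Xi>0: "\<Xi> 0 = \<xi>" using \<sigma>(1)[of 0] by (simp add: P_def \<Xi>_def)
  \<comment> \<open>In \<open>dK\<close> the first summand is the left-hand side for j = 0, and the
    second is the constant in 2^(j+1) * 2 * 4^(-j) = 4 * 2^(-j) for j > 0.\<close>
  define K where "K = 4 * lp_norm p (d 0) + 4"
  have K: "4 \<le> K" using lp_norm_nonneg[of p "d 0"] by (simp add: K_def)
  have dK: "2 ^ Suc j * (2 * lp_norm p (d j)) \<le> K * (1/2) ^ j" for j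
  proof (cases "j = 0")
    case False
    then have "lp_norm p (d j) \<le> (1/4) ^ j" using \<sigma>(1)[of j] by (simp add: P_def d_def)
    then have "2 ^ Suc j * (2 * lp_norm p (d j)) \<le> 2 ^ Suc j * (2 * (1/4) ^ j)" by simp
    also have "\<dots> = 4 * (2 * (1/4)) ^ j" by (simp only: power_mult_distrib) simp
    also have "\<dots> \<le> K * (1/2) ^ j" using K by (simp add: mult_right_mono)
    finally show ?thesis .
  qed (simp add: K_def)
  have "\<forall>j. \<exists>N y. (\<forall>n. norm (y n) \<le> 2 * d j n) \<and>
      (\<forall>k\<in>polar_set p (\<Xi> j). \<exists>a\<in>dual_ball p. k - (\<Sum>n<N. a n *\<^sub>C y n) \<in> polar_set p (\<Xi> (Suc j)))"
    using \<sigma>(2) by (simp add: rel_def \<Xi>_def d_def)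
  \<comment> \<open>The vectors are fixed before any k is considered, so one sequence serves the
    whole polar set; only the coefficients \<open>A j k\<close> depend on k.\<close>
  then obtain N y where y: "\<And>j n. norm (y j n) \<le> 2 * d j n"
    and "\<And>j. \<forall>k\<in>polar_set p (\<Xi> j). \<exists>a\<in>dual_ball p. k - (\<Sum>n<N j. a n *\<^sub>C y j n) \<in> polar_set p (\<Xi> (Suc j))"
    by metis
  then obtain A where A: "\<And>j k. k \<in> polar_set p (\<Xi> j) \<Longrightarrow> A j k \<in> dual_ball p"
    "\<And>j k. k \<in> polar_set p (\<Xi> j) \<Longrightarrow> k - (\<Sum>n<N j. A j k n *\<^sub>C y j n) \<in> polar_set p (\<Xi> (Suc j))"
    by metis
  have y_sm: "summable (\<lambda>n. norm (y j n) powr p)" "lp_norm p (\<lambda>n. norm (y j n)) \<le> 2 * lp_norm p (d j)" for j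
    using lp_norm_mono[OF p lp_norm_scale(1)[OF p, of 2 "d j", OF _ _ good(2)] norm_ge_zero y]
      lp_norm_scale(2)[OF p, of 2 "d j", OF _ _ good(2)] good(1)[of j] by (simp_all add: less_imp_le)
  define Y where "Y = (\<lambda>(j, n). if n < N j then of_real (2 ^ Suc j) *\<^sub>C y j n else 0)"
  define x where "x i = Y (prod_decode i)" for i
  have half_sm: "summable (\<lambda>j. C * (1/2) ^ j)" for C :: real by (intro summable_mult summable_geometric) simp
  have Y_row: "(\<Sum>n<M. norm (Y (j, n)) powr p) \<le> K powr p * (1/2) ^ j" for j M
  proof -
    have le: "norm (Y (j, n)) \<le> 2 ^ Suc j * norm (y j n)" for n
      by (simp add: Y_def norm_scaleC norm_mult norm_power)
    note sc = lp_norm_scale[OF p, of "2 ^ Suc j" "\<lambda>n. norm (y j n)", OF _ _ y_sm(1)]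
    have sm: "summable (\<lambda>n. norm (Y (j, n)) powr p)"
      using lp_norm_mono(1)[OF p sc(1) norm_ge_zero le] by simp
    have "lp_norm p (\<lambda>n. norm (Y (j, n))) \<le> 2 ^ Suc j * lp_norm p (\<lambda>n. norm (y j n))"
      using lp_norm_mono(2)[OF p sc(1) norm_ge_zero le] sc(2) by simp
    also have "\<dots> \<le> 2 ^ Suc j * (2 * lp_norm p (d j))" by (intro mult_left_mono y_sm(2)) simp
    also have "\<dots> \<le> K * (1/2) ^ j" by (rule dK)
    finally have "lp_norm p (\<lambda>n. norm (Y (j, n))) \<le> K * (1/2) ^ j" .
    then have "lp_norm p (\<lambda>n. norm (Y (j, n))) powr p \<le> (K * (1/2) ^ j) powr p"
      using p by (intro powr_mono2) (auto simp: lp_norm_nonneg)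
    then have "(\<Sum>n. norm (Y (j, n)) powr p) \<le> (K * (1/2) ^ j) powr p"
      by (simp only: lp_norm_powr[OF sm p])
    moreover have "(\<Sum>n<M. norm (Y (j, n)) powr p) \<le> (\<Sum>n. norm (Y (j, n)) powr p)"
      by (intro sum_le_suminf sm) auto
    \<comment> \<open>The p-th power of a number in [0, 1] is at most the number itself, so the rows
      have geometrically decreasing sums of p-th powers for every p.\<close>
    moreover have "((1/2) ^ j) powr p \<le> ((1/2::real) ^ j)"
      using powr_mono'[of 1 p "(1/2::real) ^ j"] p by (simp add: power_le_one)
    then have "(K * (1/2) ^ j) powr p \<le> K powr p * (1/2) ^ j"
      using K by (simp add: powr_mult mult_left_mono)
    ultimately show ?thesis by linarith
  qed
  have x_sm: "summable (\<lambda>i. norm (x i) powr p)"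
  proof (rule bounded_imp_summable)
    show "0 \<le> norm (x i) powr p" for i by simp
    show "(\<Sum>i\<le>n. norm (x i) powr p) \<le> (\<Sum>j. K powr p * (1/2) ^ j)" for n
    proof -
      have "(\<Sum>i\<le>n. norm (x i) powr p) = (\<Sum>q\<in>prod_decode ` {..n}. norm (Y q) powr p)"
        by (subst sum.reindex) (auto simp: x_def inj_prod_decode)
      also have "\<dots> \<le> (\<Sum>j. K powr p * (1/2) ^ j)"
        by (intro sum_pairs_le_suminf Y_row half_sm) auto
      finally show ?thesis .
    qed
  qed
  have "polar_set p \<xi> \<subseteq> p_conv p x"
  proof
    fix k assume k: "k \<in> polar_set p \<xi>"
    \<comment> \<open>The successive remainders of k: stage j uses the coefficients belonging to
      \<open>r j\<close>, not to k.\<close>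
    define r where "r = rec_nat k (\<lambda>j k. k - (\<Sum>n<N j. A j k n *\<^sub>C y j n))"
    have r0: "r 0 = k" and rS: "r (Suc j) = r j - (\<Sum>n<N j. A j (r j) n *\<^sub>C y j n)" for j
      by (simp_all add: r_def)
    have rP: "r j \<in> polar_set p (\<Xi> j)" for j
      by (induction j) (use k A(2) in \<open>auto simp: r0 rS \<Xi>0\<close>)
    have "(\<lambda>j. r j) \<longlonglongrightarrow> 0"
    proof (rule Lim_null_comparison)
      have "norm (r j) \<le> K * (1/2) ^ j" for j
      proof -
        have "norm (r j) \<le> lp_norm p (d j)"
          using norm_le_lp_norm_of_polar_set[OF p good rP] .
        also have "\<dots> \<le> 2 ^ Suc j * (2 * lp_norm p (d j))"
        proof -
          have "(1::real) \<le> 2 ^ Suc (Suc j)" by (rule one_le_power) simp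
          from mult_right_mono[OF this lp_norm_nonneg[of p "d j"]] show ?thesis by simp
        qed
        also have "\<dots> \<le> K * (1/2) ^ j" by (rule dK)
        finally show ?thesis .
      qed
      then show "\<forall>\<^sub>F j in sequentially. norm (r j) \<le> K * (1/2) ^ j" by simp
      show "(\<lambda>j. K * (1/2) ^ j) \<longlonglongrightarrow> 0" using half_sm by (rule summable_LIMSEQ_zero)
    qed
    define b where "b j = (\<Sum>n<N j. A j (r j) n *\<^sub>C y j n)" for j
    have "(\<Sum>j<J. b j) = k - r J" for J
      by (induction J) (simp_all add: r0 rS b_def)
    with tendsto_diff[OF tendsto_const[of k] \<open>(\<lambda>j. r j) \<longlonglongrightarrow> 0\<close>] have b_sums: "b sums k"
      by (simp add: sums_def)
    define \<alpha> where "\<alpha> = (\<lambda>(j, n). if n < N j then of_real ((1/2) ^ Suc j) * A j (r j) n else 0)"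
    have \<alpha>: "\<alpha> \<in> dual_ball p" unfolding \<alpha>_def by (rule dual_ball_rows[OF p]) (rule A(1)[OF rP])
    \<comment> \<open>The factors 2^(j+1) on the vectors and 2^(-j-1) on the coefficients cancel, so
      the expansion of k is unchanged.\<close>
    have AY: "\<alpha> (j, n) *\<^sub>C Y (j, n) = (if n < N j then A j (r j) n *\<^sub>C y j n else 0)" for j n
    proof -
      have "of_real ((1/2) ^ Suc j) * A j (r j) n * of_real (2 ^ Suc j) = A j (r j) n * of_real (((1/2) * 2) ^ Suc j)"
        unfolding power_mult_distrib of_real_mult by (simp only: mult_ac)
      also have "\<dots> = A j (r j) n" by simp
      finally show ?thesis by (simp add: \<alpha>_def Y_def scaleC_scaleC del: power_Suc of_real_power)
    qed
    define g where "g q = \<alpha> q *\<^sub>C Y q" for q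
    \<comment> \<open>The rows telescope to k, but a single series is required. Absolute summability
      over all pairs permits both summation by rows and summation along
      \<open>prod_decode\<close>.\<close>
    have "g abs_summable_on UNIV"
      unfolding abs_summable_iff_bdd_above
    proof (rule bdd_aboveI2)
      fix F :: "(nat \<times> nat) set" assume "F \<in> {F. F \<subseteq> UNIV \<and> finite F}"
      then have F: "finite F" by simp
      have row: "(\<Sum>n<M. norm (g (j, n))) \<le> K * (1/2) ^ j" for j M
      proof -
        have "(\<Sum>n<M. norm (g (j, n))) \<le> (\<Sum>n<M. cmod (A j (r j) n) * norm (y j n))"
          unfolding g_def AY by (intro sum_mono) (auto simp: norm_scaleC)
        also have "\<dots> \<le> (\<Sum>n. cmod (A j (r j) n) * norm (y j n))"
          by (intro sum_le_suminf dual_ball_abs_sums(1)[OF A(1)[OF rP] p _ y_sm(1)]) auto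
        also have "\<dots> \<le> lp_norm p (\<lambda>n. norm (y j n))"
          by (intro dual_ball_abs_sums(2)[OF A(1)[OF rP] p _ y_sm(1)]) auto
        also have "\<dots> \<le> 1 * (2 * lp_norm p (d j))" using y_sm(2) by simp
        also have "\<dots> \<le> 2 ^ Suc j * (2 * lp_norm p (d j))"
          using lp_norm_nonneg[of p "d j"] by (intro mult_right_mono one_le_power) auto
        also have "\<dots> \<le> K * (1/2) ^ j" by (rule dK)
        finally show ?thesis .
      qed
      show "(\<Sum>q\<in>F. norm (g q)) \<le> (\<Sum>j. K * (1/2) ^ j)"
        by (intro sum_pairs_le_suminf row half_sm F) auto
    qed
    \<comment> \<open>Completeness of the space enters here.\<close>
    then have "g summable_on UNIV" by (rule abs_summable_summable)
    then obtain l where l: "(g has_sum l) UNIV" using has_sum_infsum by blast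
    then have "(g has_sum l) (Sigma UNIV (\<lambda>_. UNIV))" by simp
    moreover have "((\<lambda>n. g (j, n)) has_sum b j) UNIV" for j
      by (rule has_sum_finite_neutralI[of "{..<N j}"]) (auto simp: g_def AY b_def)
    ultimately have "(b has_sum l) UNIV" by (rule has_sum_SigmaD)
    then have "b sums l" by (rule has_sum_imp_sums)
    with b_sums have "l = k" by (metis sums_unique2)
    with l have "((\<lambda>i. g (prod_decode i)) has_sum k) UNIV"
      using has_sum_reindex_bij_betw[OF bij_prod_decode, of g] by blast
    then have "(\<lambda>i. \<alpha> (prod_decode i) *\<^sub>C x i) sums k"
      unfolding g_def x_def by (rule has_sum_imp_sums)
    moreover have "(\<lambda>i. \<alpha> (prod_decode i)) \<in> coeff_ball p"
    proof (rule dual_ball_imp_coeff_ball[OF p dual_ball_reindex[OF \<alpha> bij_prod_decode]])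
      show "(\<lambda>i. \<alpha> (prod_decode i)) \<longlonglongrightarrow> 0"
      proof (rule tendstoI)
        fix e :: real assume e: "0 < e"
        have "(\<lambda>j. (1/2::real) ^ Suc j) \<longlonglongrightarrow> 0" by (intro LIMSEQ_Suc LIMSEQ_power_zero) simp
        from order_tendstoD(2)[OF this e] obtain J where J: "\<And>j. j \<ge> J \<Longrightarrow> (1/2) ^ Suc j < e"
          unfolding eventually_sequentially by blast
        \<comment> \<open>Only the finitely many rows whose weight (1/2)^(j+1) is at least e can
          contain a large coefficient, and each row has finitely many nonzero entries.\<close>
        have "{q. \<not> cmod (\<alpha> q) < e} \<subseteq> (\<Union>j<J. Pair j ` {..<N j})"
        proof
          fix q assume q: "q \<in> {q. \<not> cmod (\<alpha> q) < e}"
          obtain j n where qjn: "q = (j, n)" by (cases q)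
          have n: "n < N j" using q e by (auto simp: qjn \<alpha>_def split: if_splits)
          have "cmod (\<alpha> q) = (1/2) ^ Suc j * cmod (A j (r j) n)"
            using n by (simp add: qjn \<alpha>_def norm_mult norm_power)
          also have "\<dots> \<le> (1/2) ^ Suc j * 1"
            by (intro mult_left_mono dual_ball_cmod_le_1[OF A(1)[OF rP]]) simp
          finally have "\<not> (1/2) ^ Suc j < e" using q by auto
          then have "j < J" using J by (meson not_le)
          with n show "q \<in> (\<Union>j<J. Pair j ` {..<N j})" by (auto simp: qjn)
        qed
        then have "finite {q. \<not> cmod (\<alpha> q) < e}" by (rule finite_subset) auto
        then have "finite (prod_decode -` {q. \<not> cmod (\<alpha> q) < e})"
          by (rule finite_vimageI) (rule inj_prod_decode)
        then show "\<forall>\<^sub>F i in sequentially. dist (\<alpha> (prod_decode i)) 0 < e"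
          unfolding cofinite_eq_sequentially[symmetric] eventually_cofinite by (simp add: vimage_def)
      qed
    qed
    ultimately show "k \<in> p_conv p x" unfolding p_conv_def
      by (intro CollectI bexI[of _ "\<lambda>i. \<alpha> (prod_decode i)"])
  qed
  moreover have "x \<in> carrier (ell p whole_space)" using x_sm by (simp add: ell_def whole_space_def)
  ultimately show ?thesis unfolding relatively_p_compact_def by blast
qed

section \<open>Limits of holomorphic functions\<close>

lemma bounded_linear_scaleC_left: "bounded_linear (\<lambda>s. s *\<^sub>C (h :: 'e::complex_normed_vector))"
proof (rule bounded_linear_intro[where K = "norm h"])
  fix r :: real and s :: complex
  have "(of_real r * s) *\<^sub>C h = of_real r *\<^sub>C s *\<^sub>C h" by (rule scaleC_scaleC[symmetric])
  then show "(r *\<^sub>R s) *\<^sub>C h = r *\<^sub>R s *\<^sub>C h" by (simp only: scaleR_conv_of_real[of r s] scaleC_of_real)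
  show "norm (s *\<^sub>C h) \<le> norm s * norm h" by (simp add: norm_scaleC)
qed (rule scaleC_add_left)

text \<open>Cauchy's estimate for u on the complex line through x in direction h. The radius is half
  of r divided by the norm of h, so that the closed disc stays inside the open ball; this is the
  origin of the factor 2.\<close>

lemma complex_derivative_bound:
  fixes u :: "'e::complex_normed_vector \<Rightarrow> complex"
  assumes r: "0 < r"
    and u: "\<And>y. y \<in> ball x r \<Longrightarrow> \<exists>D. (u has_derivative D) (at y) \<and> (\<forall>c h. D (c *\<^sub>C h) = c *\<^sub>C D h)"
    and B: "\<And>y. y \<in> ball x r \<Longrightarrow> cmod (u y) \<le> B"
    and D: "(u has_derivative D) (at x)" "\<And>c h. D (c *\<^sub>C h) = c *\<^sub>C D h"
  shows "cmod (D h) \<le> 2 * B / r * norm h"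
proof (cases "h = 0")
  case True
  then show ?thesis using D(2)[of 0 0] by (simp add: scaleC_complex_def)
next
  case False
  define \<rho> where "\<rho> = r / (2 * norm h)"
  have \<rho>: "0 < \<rho>" using r False by (simp add: \<rho>_def)
  define \<gamma> where "\<gamma> t = x + t *\<^sub>C h" for t
  have \<gamma>: "(\<gamma> has_derivative (\<lambda>s. s *\<^sub>C h)) (at t)" for t
  proof -
    have "((\<lambda>s. s *\<^sub>C h) has_derivative (\<lambda>s. s *\<^sub>C h)) (at t)"
      by (rule bounded_linear_imp_has_derivative[OF bounded_linear_scaleC_left])
    from has_derivative_add[OF has_derivative_const[of x] this] show ?thesis by (simp add: \<gamma>_def[abs_def])
  qed
  have inball: "\<gamma> t \<in> ball x r" if "cmod t \<le> \<rho>" for t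
  proof -
    have "norm (t *\<^sub>C h) \<le> \<rho> * norm h" using that by (simp add: norm_scaleC mult_right_mono)
    also have "\<dots> < r" using False r by (simp add: \<rho>_def)
    finally show ?thesis by (simp add: \<gamma>_def dist_norm)
  qed
  have der: "((\<lambda>t. u (\<gamma> t)) has_field_derivative D' h) (at t)"
    if "(u has_derivative D') (at (\<gamma> t))" "\<forall>c h. D' (c *\<^sub>C h) = c *\<^sub>C D' h" for t D'
  proof -
    have "((\<lambda>t. u (\<gamma> t)) has_derivative (\<lambda>s. D' (s *\<^sub>C h))) (at t)"
      using has_derivative_compose[OF \<gamma> that(1)] .
    then show ?thesis unfolding has_field_derivative_def
      by (rule has_derivative_eq_rhs) (simp add: that(2)[rule_format] scaleC_complex_def mult.commute fun_eq_iff)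
  qed
  have fd: "(\<lambda>t. u (\<gamma> t)) field_differentiable (at t)" if t: "cmod t \<le> \<rho>" for t
  proof -
    obtain D' where D': "(u has_derivative D') (at (\<gamma> t)) \<and> (\<forall>c h. D' (c *\<^sub>C h) = c *\<^sub>C D' h)"
      using u[OF inball[OF t]] ..
    have "((\<lambda>t. u (\<gamma> t)) has_field_derivative D' h) (at t)"
      by (rule der[OF conjunct1[OF D']]) (use D' in simp)
    then show ?thesis unfolding field_differentiable_def by (rule exI)
  qed
  have hol: "(\<lambda>t. u (\<gamma> t)) holomorphic_on ball 0 \<rho>"
    unfolding holomorphic_on_def by (rule ballI, rule field_differentiable_at_within, rule fd) simp
  have cont: "continuous_on (cball 0 \<rho>) (\<lambda>t. u (\<gamma> t))"
    by (rule continuous_at_imp_continuous_on, rule ballI, rule field_differentiable_imp_continuous_at, rule fd) simp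
  have bound: "cmod (u (\<gamma> t)) \<le> B" if "cmod (0 - t) = \<rho>" for t using that by (intro B inball) simp
  have "cmod ((deriv ^^ 1) (\<lambda>t. u (\<gamma> t)) 0) \<le> fact 1 * B / \<rho> ^ 1"
    using hol cont \<rho> bound by (rule Cauchy_inequality)
  moreover have "((\<lambda>t. u (\<gamma> t)) has_field_derivative D h) (at 0)"
    using D(2) by (intro der) (simp_all add: \<gamma>_def D(1))
  then have "deriv (\<lambda>t. u (\<gamma> t)) 0 = D h" by (rule DERIV_imp_deriv)
  ultimately have "cmod (D h) \<le> B / \<rho>" by simp
  also have "\<dots> = 2 * B / r * norm h" using r False by (simp add: \<rho>_def)
  finally show ?thesis .
qed

text \<open>Weierstrass' theorem on normed spaces. Cauchy's estimate on balls of radius r inside the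
  ball of radius 2 r makes the derivatives uniformly Cauchy on the smaller ball, so differentiation
  commutes with the limit, and complex homogeneity passes to it.\<close>

lemma complex_differentiable_uniform_limit:
  fixes u :: "nat \<Rightarrow> 'e::complex_normed_vector \<Rightarrow> complex"
  assumes r: "0 < r"
    and u: "\<And>n y. y \<in> ball x0 (2 * r) \<Longrightarrow>
      \<exists>D. (u n has_derivative D) (at y) \<and> (\<forall>c h. D (c *\<^sub>C h) = c *\<^sub>C D h)"
    and lim: "\<And>e. 0 < e \<Longrightarrow> \<exists>N. \<forall>n\<ge>N. \<forall>y\<in>ball x0 (2 * r). cmod (u n y - g y) \<le> e"
  shows "\<exists>D. (g has_derivative D) (at x0) \<and> (\<forall>c h. D (c *\<^sub>C h) = c *\<^sub>C D h)"
proof -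
  define Q where "Q n y D \<longleftrightarrow> (u n has_derivative D) (at y) \<and> (\<forall>c h. D (c *\<^sub>C h) = c *\<^sub>C D h)" for n y D
  define D where "D n y = (SOME D. Q n y D)" for n y
  have "Q n y (D n y)" if "y \<in> ball x0 (2 * r)" for n y
    unfolding D_def by (rule someI_ex[of "Q n y"]) (unfold Q_def, rule u[OF that])
  then have D: "(u n has_derivative D n y) (at y)" "D n y (c *\<^sub>C h) = c *\<^sub>C D n y h"
    if "y \<in> ball x0 (2 * r)" for n y c h
    using that unfolding Q_def by simp_all
  have sub: "ball y r \<subseteq> ball x0 (2 * r)" if "y \<in> ball x0 r" for y
  proof
    fix w assume "w \<in> ball y r"
    then show "w \<in> ball x0 (2 * r)" using that dist_triangle[of x0 w y] by simp
  qed
  have mem: "y \<in> ball x0 (2 * r)" if "y \<in> ball x0 r" for y using that r by simp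
  have cauchy: "\<exists>N. \<forall>n\<ge>N. \<forall>m\<ge>N. \<forall>y\<in>ball x0 r. \<forall>h. cmod (D n y h - D m y h) \<le> e * norm h" if e: "0 < e" for e
  proof -
    \<comment> \<open>Two members of the sequence then differ by at most e r / 2, and the factor 2 /
      r of Cauchy's estimate turns this into e.\<close>
    have "0 < e * r / 4" using e r by simp
    from lim[OF this] obtain N where N: "\<And>n y. n \<ge> N \<Longrightarrow> y \<in> ball x0 (2 * r) \<Longrightarrow> cmod (u n y - g y) \<le> e * r / 4"
      by blast
    have "cmod (D n y h - D m y h) \<le> e * norm h" if nm: "n \<ge> N" "m \<ge> N" and y: "y \<in> ball x0 r" for n m y h
    proof -
      have "cmod (D n y h - D m y h) \<le> 2 * (e * r / 2) / r * norm h"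
      proof (rule complex_derivative_bound[where u = "\<lambda>w. u n w - u m w", OF r])
        show "\<exists>D. ((\<lambda>w. u n w - u m w) has_derivative D) (at w) \<and> (\<forall>c h. D (c *\<^sub>C h) = c *\<^sub>C D h)"
          if "w \<in> ball y r" for w
        proof -
          have w: "w \<in> ball x0 (2 * r)" using sub[OF y] that by blast
          show ?thesis
            using has_derivative_diff[OF D(1)[OF w, of n] D(1)[OF w, of m]] D(2)[OF w]
            by (intro exI[of _ "\<lambda>h. D n w h - D m w h"]) (simp add: scaleC_complex_def right_diff_distrib)
        qed
        show "cmod (u n w - u m w) \<le> e * r / 2" if "w \<in> ball y r" for w
        proof -
          have w: "w \<in> ball x0 (2 * r)" using sub[OF y] that by blast
          have "cmod (u n w - u m w) \<le> cmod (u n w - g w) + cmod (u m w - g w)"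
            using norm_triangle_ineq4[of "u n w - g w" "u m w - g w"] by simp
          then show ?thesis using N[OF nm(1) w] N[OF nm(2) w] by linarith
        qed
        show "((\<lambda>w. u n w - u m w) has_derivative (\<lambda>h. D n y h - D m y h)) (at y)"
          by (intro has_derivative_diff D(1) mem y)
      qed (simp add: D(2)[OF mem[OF y]] scaleC_complex_def right_diff_distrib)
      then show ?thesis using r by simp
    qed
    then show ?thesis by blast
  qed
  have ulim: "(\<lambda>n. u n y) \<longlonglongrightarrow> g y" if "y \<in> ball x0 r" for y
  proof (rule metric_LIMSEQ_I)
    fix e :: real assume e: "0 < e"
    then have "0 < e / 2" by simp
    from lim[OF this] obtain N where N: "\<forall>n\<ge>N. \<forall>y\<in>ball x0 (2 * r). cmod (u n y - g y) \<le> e / 2" ..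
    have "dist (u n y) (g y) < e" if "n \<ge> N" for n
    proof -
      have "cmod (u n y - g y) \<le> e / 2" using N that mem[OF \<open>y \<in> ball x0 r\<close>] by blast
      then show ?thesis using e by (simp add: dist_norm)
    qed
    then show "\<exists>N. \<forall>n\<ge>N. dist (u n y) (g y) < e" by blast
  qed
  define G where "G y h = lim (\<lambda>n. D n y h)" for y h
  have conv: "(\<lambda>n. D n y h) \<longlonglongrightarrow> G y h" if y: "y \<in> ball x0 r" for y h
  proof -
    have "Cauchy (\<lambda>n. D n y h)"
    proof (rule metric_CauchyI)
      fix e :: real assume e: "0 < e"
      \<comment> \<open>The summand 1 covers h = 0 and makes the final inequality strict.\<close>
      have h1: "0 < norm h + 1" using norm_ge_zero[of h] by linarith
      have "0 < e / (norm h + 1)" using e h1 by simp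
      from cauchy[OF this] obtain N where N: "\<forall>n\<ge>N. \<forall>m\<ge>N. \<forall>y\<in>ball x0 r. \<forall>h'. cmod (D n y h' - D m y h') \<le> e / (norm h + 1) * norm h'"
        by (rule exE)
      have "e / (norm h + 1) * norm h < e / (norm h + 1) * (norm h + 1)"
        using e h1 by (intro mult_strict_left_mono) auto
      also have "\<dots> = e" using h1 by simp
      finally have lt: "e / (norm h + 1) * norm h < e" .
      have "dist (D m y h) (D n y h) < e" if "m \<ge> N" "n \<ge> N" for m n
      proof -
        have "cmod (D m y h - D n y h) \<le> e / (norm h + 1) * norm h" using N that y by blast
        with lt show ?thesis by (simp add: dist_norm)
      qed
      then show "\<exists>N. \<forall>m\<ge>N. \<forall>n\<ge>N. dist (D m y h) (D n y h) < e" by blast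
    qed
    then show ?thesis unfolding G_def by (simp add: Cauchy_convergent_iff convergent_LIMSEQ_iff)
  qed
  have "\<exists>g'. \<forall>y\<in>ball x0 r. (\<lambda>n. u n y) \<longlonglongrightarrow> g' y \<and> (g' has_derivative G y) (at y within ball x0 r)"
  proof (rule has_derivative_sequence)
    show "(u n has_derivative D n y) (at y within ball x0 r)" if "y \<in> ball x0 r" for n y
      using D(1)[OF mem[OF that]] by (rule has_derivative_at_withinI)
    show "\<forall>\<^sub>F n in sequentially. \<forall>y\<in>ball x0 r. \<forall>h. norm (D n y h - G y h) \<le> e * norm h" if e: "0 < e" for e
    proof -
      obtain N where N: "\<And>n m y h. n \<ge> N \<Longrightarrow> m \<ge> N \<Longrightarrow> y \<in> ball x0 r \<Longrightarrow> cmod (D n y h - D m y h) \<le> e * norm h"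
        using cauchy[OF e] by blast
      have "norm (D n y h - G y h) \<le> e * norm h" if "n \<ge> N" "y \<in> ball x0 r" for n y h
      proof (rule tendsto_upperbound)
        show "(\<lambda>m. cmod (D n y h - D m y h)) \<longlonglongrightarrow> cmod (D n y h - G y h)"
          by (intro tendsto_norm tendsto_diff tendsto_const conv that(2))
        show "\<forall>\<^sub>F m in sequentially. cmod (D n y h - D m y h) \<le> e * norm h"
          using N that eventually_sequentially by blast
      qed simp
      then show ?thesis unfolding eventually_sequentially by blast
    qed
    show "x0 \<in> ball x0 r" using r by simp
    show "(\<lambda>n. u n x0) \<longlonglongrightarrow> g x0" by (rule ulim) (use r in simp)
  qed simp
  then obtain g' where g': "\<And>y. y \<in> ball x0 r \<Longrightarrow> (\<lambda>n. u n y) \<longlonglongrightarrow> g' y"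
    "\<And>y. y \<in> ball x0 r \<Longrightarrow> (g' has_derivative G y) (at y within ball x0 r)" by blast
  have x0: "x0 \<in> ball x0 r" using r by simp
  have eq: "g' y = g y" if "y \<in> ball x0 r" for y
    using LIMSEQ_unique[OF g'(1)[OF that] ulim[OF that]] .
  have "(g' has_derivative G x0) (at x0)"
    using g'(2)[OF x0] at_within_open[OF x0 open_ball] by simp
  then have "(g has_derivative G x0) (at x0)"
    by (rule has_derivative_transform_within_open[OF _ open_ball x0]) (rule eq)
  moreover have "G x0 (c *\<^sub>C h) = c *\<^sub>C G x0 h" for c h
  proof (rule LIMSEQ_unique[OF conv[OF x0]])
    show "(\<lambda>n. D n x0 (c *\<^sub>C h)) \<longlonglongrightarrow> c *\<^sub>C G x0 h"
      unfolding D(2)[OF mem[OF x0]] scaleC_complex_def by (intro tendsto_mult_left conv x0)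
  qed
  ultimately show ?thesis by (intro exI[of _ "G x0"] conjI allI)
qed

text \<open>By continuity the weight exceeds half of its value at \<open>x0\<close> on a ball around
  \<open>x0\<close>, so weighted convergence is uniform on that ball.\<close>

lemma holomorphic_map_weighted_limit:
  fixes u :: "nat \<Rightarrow> 'e::complex_normed_vector \<Rightarrow> complex"
  assumes U: "open U" and v: "is_weight U v" and u: "\<And>n. holomorphic_map (u n) U"
    and lim: "\<And>e. 0 < e \<Longrightarrow> \<exists>N. \<forall>n\<ge>N. \<forall>y\<in>U. v y * cmod (u n y - g y) \<le> e"
  shows "holomorphic_map g U"
  unfolding holomorphic_map_def
proof
  fix x0 assume x0: "x0 \<in> U"
  define c where "c = v x0 / 2"
  have c: "0 < c" "c < v x0" using v x0 by (auto simp: c_def is_weight_def)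
  have "continuous_on U v" using v by (simp add: is_weight_def)
  then have "isCont v x0" using U x0 by (simp add: continuous_on_eq_continuous_at)
  then have "\<forall>\<^sub>F y in nhds x0. c < v y" using c(2) by (simp add: isCont_def tendsto_at_iff_tendsto_nhds order_tendstoD(1))
  moreover have "\<forall>\<^sub>F y in nhds x0. y \<in> U" using U x0 by (rule eventually_nhds_in_open)
  ultimately have "\<forall>\<^sub>F y in nhds x0. c < v y \<and> y \<in> U" by (rule eventually_conj)
  then obtain d where d: "0 < d" "\<And>y. dist y x0 < d \<Longrightarrow> c < v y \<and> y \<in> U"
    unfolding eventually_nhds_metric by blast
  show "\<exists>D. (g has_derivative D) (at x0) \<and> (\<forall>c h. D (c *\<^sub>C h) = c *\<^sub>C D h)"
  proof (rule complex_differentiable_uniform_limit[of "d / 2" x0 u])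
    show "\<exists>D. (u n has_derivative D) (at y) \<and> (\<forall>c h. D (c *\<^sub>C h) = c *\<^sub>C D h)" if "y \<in> ball x0 (2 * (d / 2))" for n y
    proof -
      have "y \<in> U" using d(2)[of y] that by (simp add: dist_commute)
      with u[of n] show ?thesis unfolding holomorphic_map_def by (rule bspec)
    qed
    show "\<exists>N. \<forall>n\<ge>N. \<forall>y\<in>ball x0 (2 * (d / 2)). cmod (u n y - g y) \<le> e" if e: "0 < e" for e
    proof -
      have "0 < c * e" using c(1) e by simp
      from lim[OF this] obtain N where N: "\<And>n y. n \<ge> N \<Longrightarrow> y \<in> U \<Longrightarrow> v y * cmod (u n y - g y) \<le> c * e"
        by blast
      have "cmod (u n y - g y) \<le> e" if "n \<ge> N" "y \<in> ball x0 (2 * (d / 2))" for n y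
      proof -
        have y: "c < v y" "y \<in> U" using d(2)[of y] that(2) by (auto simp: dist_commute)
        have "c * cmod (u n y - g y) \<le> v y * cmod (u n y - g y)" using y(1) by (intro mult_right_mono) auto
        also have "\<dots> \<le> c * e" by (rule N[OF that(1) y(2)])
        finally show ?thesis using c(1) by simp
      qed
      then show ?thesis by blast
    qed
  qed (use d in simp)
qed

section \<open>Closures in \<open>\<ell>\<^sub>p\<close> and norms of functionals\<close>

lemma carrier_ell_scalar: "carrier (ell_scalar p) = {u. summable (\<lambda>n. cmod (u n) powr p)}"
  by (simp add: ell_def whole_space_def)

lemma nrm_ell_scalar: "nrm (ell_scalar p) u = lp_norm p (\<lambda>n. cmod (u n))"
  by (simp add: ell_def whole_space_def lp_norm_def)

lemma Metric_space_ell_scalar: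
  assumes p: "1 \<le> p"
  shows "Metric_space (carrier (ell_scalar p)) (\<lambda>x y. nrm (ell_scalar p) (x - y))"
proof
  let ?V = "{u::nat \<Rightarrow> complex. summable (\<lambda>n. cmod (u n) powr p)}"
  have diff: "x - y \<in> ?V" if "x \<in> ?V" "y \<in> ?V" for x y
    using subspace_lp(1)[OF p] that by (rule complex_vector.subspace_diff)
  fix x y z :: "nat \<Rightarrow> complex"
  show "0 \<le> nrm (ell_scalar p) (x - y)" by (simp add: nrm_ell_scalar lp_norm_nonneg)
  show "nrm (ell_scalar p) (x - y) = nrm (ell_scalar p) (y - x)" by (simp add: nrm_ell_scalar norm_minus_commute)
  assume x: "x \<in> carrier (ell_scalar p)" and y: "y \<in> carrier (ell_scalar p)"
  show "nrm (ell_scalar p) (x - y) = 0 \<longleftrightarrow> x = y"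
  proof
    assume eq: "nrm (ell_scalar p) (x - y) = 0"
    have "cmod ((x - y) n) \<le> lp_norm p (\<lambda>n. cmod ((x - y) n))" for n
      using diff[of x y] x y by (intro le_lp_norm p) (simp_all add: carrier_ell_scalar)
    then have "(x - y) n = 0" for n using eq by (simp add: nrm_ell_scalar)
    then show "x = y" by (auto simp: fun_eq_iff)
  next
    assume "x = y"
    then show "nrm (ell_scalar p) (x - y) = 0" using p by (simp add: nrm_ell_scalar lp_norm_def)
  qed
  assume z: "z \<in> carrier (ell_scalar p)"
  have "lp_norm p (\<lambda>n. cmod (((x - y) + (y - z)) n)) \<le> lp_norm p (\<lambda>n. cmod ((x - y) n)) + lp_norm p (\<lambda>n. cmod ((y - z) n))"
    using diff[of x y] diff[of y z] x y z by (intro subspace_lp(2)[OF p]) (simp_all add: carrier_ell_scalar)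
  then show "nrm (ell_scalar p) (x - z) \<le> nrm (ell_scalar p) (x - y) + nrm (ell_scalar p) (y - z)"
    by (simp add: nrm_ell_scalar)
qed

definition ell_closure :: "real \<Rightarrow> (nat \<Rightarrow> complex) set \<Rightarrow> (nat \<Rightarrow> complex) set" where
  "ell_closure p W = {m \<in> carrier (ell_scalar p). \<forall>e>0. \<exists>w\<in>W. nrm (ell_scalar p) (m - w) < e}"

lemma closed_subspace_ell_closure:
  assumes p: "1 \<le> p" and W: "complex_vector.subspace W" and sub: "W \<subseteq> carrier (ell_scalar p)"
  shows "closed_subspace (ell_scalar p) (ell_closure p W)" and "W \<subseteq> ell_closure p W"
proof -
  interpret L: Metric_space "carrier (ell_scalar p)" "\<lambda>x y. nrm (ell_scalar p) (x - y)"
    by (rule Metric_space_ell_scalar[OF p])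
  have V: "complex_vector.subspace (carrier (ell_scalar p))"
    unfolding carrier_ell_scalar by (rule subspace_lp(1)[OF p])
  show WM: "W \<subseteq> ell_closure p W"
  proof
    fix w assume w: "w \<in> W"
    then have "nrm (ell_scalar p) (w - w) = 0" using L.mdist_zero sub by blast
    with w sub show "w \<in> ell_closure p W" by (auto simp: ell_closure_def intro!: bexI[of _ w])
  qed
  have "complex_vector.subspace (ell_closure p W)"
    unfolding complex_vector.subspace_def
  proof (intro conjI ballI allI)
    show "0 \<in> ell_closure p W" using WM complex_vector.subspace_0[OF W] by blast
  next
    fix m m' assume m: "m \<in> ell_closure p W" and m': "m' \<in> ell_closure p W"
    show "m + m' \<in> ell_closure p W"
      unfolding ell_closure_def
    proof (intro CollectI conjI allI impI)
      show "m + m' \<in> carrier (ell_scalar p)"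
        using m m' by (intro complex_vector.subspace_add[OF V]) (auto simp: ell_closure_def)
      fix e :: real assume "0 < e"
      then have "0 < e / 2" by simp
      obtain w where w: "w \<in> W" "nrm (ell_scalar p) (m - w) < e / 2"
        using m \<open>0 < e / 2\<close> unfolding ell_closure_def by blast
      obtain w' where w': "w' \<in> W" "nrm (ell_scalar p) (m' - w') < e / 2"
        using m' \<open>0 < e / 2\<close> unfolding ell_closure_def by blast
      have "m - w \<in> carrier (ell_scalar p)" "m' - w' \<in> carrier (ell_scalar p)"
        using m m' w w' sub by (auto simp: ell_closure_def intro!: complex_vector.subspace_diff[OF V])
      then have "nrm (ell_scalar p) ((m - w) + (m' - w')) \<le> nrm (ell_scalar p) (m - w) + nrm (ell_scalar p) (m' - w')"
        unfolding nrm_ell_scalar carrier_ell_scalar mem_Collect_eq by (rule subspace_lp(2)[OF p])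
      also have "\<dots> < e" using w(2) w'(2) by linarith
      also have "(m - w) + (m' - w') = (m + m') - (w + w')" by (rule add_diff_add[symmetric])
      finally show "\<exists>w\<in>W. nrm (ell_scalar p) (m + m' - w) < e"
        using complex_vector.subspace_add[OF W w(1) w'(1)] by blast
    qed
  next
    fix c m assume m: "m \<in> ell_closure p W"
    show "c *\<^sub>C m \<in> ell_closure p W"
      unfolding ell_closure_def
    proof (intro CollectI conjI allI impI)
      show "c *\<^sub>C m \<in> carrier (ell_scalar p)"
        using m by (intro complex_vector.subspace_scale[OF V]) (auto simp: ell_closure_def)
      fix e :: real assume e: "0 < e"
      \<comment> \<open>The summand 1 covers c = 0.\<close>
      have c: "0 < cmod c + 1" using norm_ge_zero[of c] by linarith
      then have "0 < e / (cmod c + 1)" using e by simp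
      then obtain w where w: "w \<in> W" "nrm (ell_scalar p) (m - w) < e / (cmod c + 1)"
        using m unfolding ell_closure_def by blast
      have "m - w \<in> carrier (ell_scalar p)"
        using m w sub by (auto simp: ell_closure_def intro!: complex_vector.subspace_diff[OF V])
      then have "nrm (ell_scalar p) (c *\<^sub>C (m - w)) = cmod c * nrm (ell_scalar p) (m - w)"
        unfolding nrm_ell_scalar carrier_ell_scalar mem_Collect_eq by (rule subspace_lp(3)[OF p])
      also have "\<dots> \<le> cmod c * (e / (cmod c + 1))" using w(2) by (intro mult_left_mono) auto
      also have "\<dots> < (cmod c + 1) * (e / (cmod c + 1))" using e c by (intro mult_strict_right_mono) auto
      also have "\<dots> = e" using c by simp
      also have "c *\<^sub>C (m - w) = c *\<^sub>C m - c *\<^sub>C w" by (rule complex_vector.scale_right_diff_distrib)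
      finally show "\<exists>w\<in>W. nrm (ell_scalar p) (c *\<^sub>C m - w) < e"
        using complex_vector.subspace_scale[OF W w(1)] by blast
    qed
  qed
  moreover have "closedin L.mtopology (ell_closure p W)"
    unfolding L.closedin_metric
  proof (intro conjI allI impI)
    show "ell_closure p W \<subseteq> carrier (ell_scalar p)" by (auto simp: ell_closure_def)
    fix x assume x: "x \<in> carrier (ell_scalar p) - ell_closure p W"
    then obtain e where e: "0 < e" "\<And>w. w \<in> W \<Longrightarrow> e \<le> nrm (ell_scalar p) (x - w)"
      unfolding ell_closure_def by (auto simp: not_less)
    have "disjnt (ell_closure p W) (L.mball x (e / 2))"
      unfolding disjnt_iff
    proof (intro allI notI)
      fix m assume m: "m \<in> ell_closure p W \<and> m \<in> L.mball x (e / 2)"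
      have "0 < e / 2" using e by simp
      then obtain w where w: "w \<in> W" "nrm (ell_scalar p) (m - w) < e / 2"
        using m unfolding ell_closure_def by blast
      have "nrm (ell_scalar p) (x - w) \<le> nrm (ell_scalar p) (x - m) + nrm (ell_scalar p) (m - w)"
        using x m w sub by (intro L.triangle) (auto simp: ell_closure_def)
      also have "\<dots> < e" using m w(2) by (simp add: L.in_mball)
      finally show False using e(2)[OF w(1)] by simp
    qed
    then show "\<exists>r>0. disjnt (ell_closure p W) (L.mball x r)" using e by (intro exI[of _ "e / 2"]) simp
  qed
  ultimately show "closed_subspace (ell_scalar p) (ell_closure p W)"
    by (simp add: closed_subspace_def)
qed

text \<open>The operator norm is a supremum of reals, so its values can be compared with it only
  once the set is known to be bounded above.\<close>

lemma bdd_above_op_norm_set: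
  assumes T: "T \<in> bounded_ops X whole_space" and nn: "\<And>x. x \<in> carrier X \<Longrightarrow> 0 \<le> nrm X x"
  shows "bdd_above ((\<lambda>x. nrm whole_space (T x)) ` {x \<in> carrier X. nrm X x \<le> 1})"
proof -
  obtain C where C: "\<And>x. x \<in> carrier X \<Longrightarrow> norm (T x) \<le> C * nrm X x"
  proof -
    have "\<exists>C. \<forall>x\<in>carrier X. nrm whole_space (T x) \<le> C * nrm X x" using T by (simp add: bounded_ops_def)
    then show thesis using that by (auto simp: whole_space_def)
  qed
  show ?thesis
  proof (rule bdd_aboveI2)
    fix x assume x: "x \<in> {x \<in> carrier X. nrm X x \<le> 1}"
    have "norm (T x) \<le> C * nrm X x" using C x by simp
    also have "\<dots> \<le> \<bar>C\<bar> * nrm X x" using nn x by (intro mult_right_mono) auto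
    also have "\<dots> \<le> \<bar>C\<bar> * 1" using x by (intro mult_left_mono) auto
    finally show "nrm whole_space (T x) \<le> \<bar>C\<bar>" by (simp add: whole_space_def)
  qed
qed

text \<open>The operator norm is the least L \<ge> 0 with |\<phi> x| \<le> L times the norm of x.
  This links the formal dual norm with the constants quantified in
  \<open>bidual_bound\<close>.\<close>

lemma dual_carrier_op_norm:
  fixes \<phi> :: "'f::complex_normed_vector \<Rightarrow> complex"
  assumes \<phi>: "\<phi> \<in> dual_carrier"
  shows "0 \<le> nrm (dual_space whole_space) \<phi>"
    and "cmod (\<phi> x) \<le> nrm (dual_space whole_space) \<phi> * norm x"
    and "\<And>L. 0 \<le> L \<Longrightarrow> (\<And>x. cmod (\<phi> x) \<le> L * norm x) \<Longrightarrow> nrm (dual_space whole_space) \<phi> \<le> L"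
proof -
  have nrm_eq: "nrm (dual_space whole_space) \<phi> = (SUP x\<in>{x. norm x \<le> 1}. cmod (\<phi> x))"
    by (simp add: dual_space_def op_norm_def whole_space_def)
  have "\<phi> \<in> bounded_ops whole_space whole_space" using \<phi> by (simp add: dual_space_def)
  from bdd_above_op_norm_set[OF this] have bdd: "bdd_above ((\<lambda>x. cmod (\<phi> x)) ` {x. norm x \<le> 1})"
    by (simp add: whole_space_def)
  have upper: "cmod (\<phi> x) \<le> nrm (dual_space whole_space) \<phi>" if "norm x \<le> 1" for x
    unfolding nrm_eq using that by (intro cSUP_upper bdd) simp
  show "0 \<le> nrm (dual_space whole_space) \<phi>" using upper[of 0] by (simp add: dual_carrier_0[OF \<phi>])
  show "cmod (\<phi> x) \<le> nrm (dual_space whole_space) \<phi> * norm x"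
  proof (cases "x = 0")
    case True
    then show ?thesis by (simp add: dual_carrier_0[OF \<phi>])
  next
    case False
    have "cmod (\<phi> (of_real (1 / norm x) *\<^sub>C x)) \<le> nrm (dual_space whole_space) \<phi>"
      using False by (intro upper) (simp add: norm_scaleC norm_divide)
    then show ?thesis using False by (simp add: dual_carrier_scaleC[OF \<phi>] norm_mult norm_divide field_simps)
  qed
  show "nrm (dual_space whole_space) \<phi> \<le> L" if L: "0 \<le> L" "\<And>x. cmod (\<phi> x) \<le> L * norm x" for L
    unfolding nrm_eq
  proof (rule cSUP_least)
    have "(0::'f) \<in> {x. norm x \<le> 1}" by simp
    then show "{x::'f. norm x \<le> 1} \<noteq> {}" by blast
    fix x :: 'f assume "x \<in> {x. norm x \<le> 1}"
    then show "cmod (\<phi> x) \<le> L" using L(2)[of x] mult_left_mono[of "norm x" 1 L] L(1) by simp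
  qed
qed

text \<open>Passage from the bidual as a normed space on a carrier to \<open>bidual_bound\<close>.
  For L > 0 the functional \<phi> is divided by L, and L = 0 forces \<phi> = 0.\<close>

lemma mem_bidual_carrier:
  fixes \<xi> :: "('f::complex_normed_vector \<Rightarrow> complex) \<Rightarrow> complex"
  assumes \<xi>: "\<xi> \<in> carrier (dual_space (dual_space whole_space))"
  shows "0 \<le> nrm (dual_space (dual_space whole_space)) \<xi>"
    and "bidual_bound (nrm (dual_space (dual_space whole_space)) \<xi>) \<xi>"
proof -
  let ?B = "{\<phi> \<in> dual_carrier. nrm (dual_space whole_space) \<phi> \<le> 1} :: ('f \<Rightarrow> complex) set"
  define c where "c = nrm (dual_space (dual_space whole_space)) \<xi>"
  have c_eq: "c = (SUP \<phi>\<in>?B. cmod (\<xi> \<phi>))"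
    unfolding c_def
    by (simp add: dual_space_def[of "dual_space whole_space"] op_norm_def whole_space_def[where 'a = complex])
  have B: "\<xi> \<in> bounded_ops (dual_space whole_space) whole_space" using \<xi> by (simp add: dual_space_def[of "dual_space whole_space"])
  from bdd_above_op_norm_set[OF B dual_carrier_op_norm(1)] have bdd: "bdd_above ((\<lambda>\<phi>. cmod (\<xi> \<phi>)) ` ?B)"
    by (simp add: whole_space_def[where 'a = complex])
  have add: "\<xi> (\<phi> + \<psi>) = \<xi> \<phi> + \<xi> \<psi>" if "\<phi> \<in> dual_carrier" "\<psi> \<in> dual_carrier" for \<phi> \<psi>
    using B that by (simp add: bounded_ops_def)
  have scale: "\<xi> (a *\<^sub>C \<phi>) = a * \<xi> \<phi>" if "\<phi> \<in> dual_carrier" for \<phi> a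
    using B that by (simp add: bounded_ops_def scaleC_complex_def)
  have zero: "0 \<in> (dual_carrier :: ('f \<Rightarrow> complex) set)" by (rule complex_vector.subspace_0[OF subspace_dual_carrier])
  have upper: "cmod (\<xi> \<phi>) \<le> c" if "\<phi> \<in> dual_carrier" "\<And>x. cmod (\<phi> x) \<le> norm x" for \<phi>
    unfolding c_eq using that dual_carrier_op_norm(3)[OF that(1), of 1] by (intro cSUP_upper bdd) simp
  have \<xi>0: "\<xi> 0 = 0" using scale[OF zero, of 0] by simp
  show c0: "0 \<le> nrm (dual_space (dual_space whole_space)) \<xi>" using upper[OF zero] by (simp add: \<xi>0 c_def)
  show "bidual_bound (nrm (dual_space (dual_space whole_space)) \<xi>) \<xi>"
    unfolding bidual_bound_def c_def[symmetric]
  proof (intro conjI ballI allI impI)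
    fix \<phi> :: "'f \<Rightarrow> complex" and L :: real
    assume \<phi>: "\<phi> \<in> dual_carrier" and L: "0 \<le> L" "\<forall>x. cmod (\<phi> x) \<le> L * norm x"
    show "cmod (\<xi> \<phi>) \<le> c * L"
    proof (cases "L = 0")
      case True
      then have "\<phi> = 0" using L by (auto simp: fun_eq_iff)
      then show ?thesis using \<xi>0 True by simp
    next
      case False
      with L have pos: "0 < L" by simp
      have "cmod (\<xi> (of_real (1 / L) *\<^sub>C \<phi>)) \<le> c"
      proof (rule upper)
        show "of_real (1 / L) *\<^sub>C \<phi> \<in> dual_carrier" by (rule complex_vector.subspace_scale[OF subspace_dual_carrier \<phi>])
        show "cmod ((of_real (1 / L) *\<^sub>C \<phi>) x) \<le> norm x" for x
          using L(2)[rule_format, of x] pos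
          by (simp add: scaleC_fun_def scaleC_complex_def norm_mult norm_divide field_simps)
      qed
      then show ?thesis using pos by (simp add: scale[OF \<phi>] norm_mult norm_divide field_simps)
    qed
  qed (simp_all add: add scale)
qed

text \<open>The canonical embedding into the bidual. The value 0 off the dual is imposed by the
  convention that operators vanish outside their carrier.\<close>

lemma bidual_carrier_eval:
  fixes y :: "'f::complex_normed_vector"
  defines "\<xi> \<equiv> \<lambda>\<phi>. if \<phi> \<in> dual_carrier then \<phi> y else 0"
  shows "\<xi> \<in> carrier (dual_space (dual_space whole_space))"
    and "nrm (dual_space (dual_space whole_space)) \<xi> \<le> norm y"
proof -
  have le: "cmod (\<xi> \<phi>) \<le> norm y * nrm (dual_space whole_space) \<phi>" if "\<phi> \<in> dual_carrier" for \<phi>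
    using dual_carrier_op_norm(2)[OF that, of y] that by (simp add: \<xi>_def mult.commute)
  note D = complex_vector.subspace_add[OF subspace_dual_carrier] complex_vector.subspace_scale[OF subspace_dual_carrier]
  show "\<xi> \<in> carrier (dual_space (dual_space whole_space))"
  proof -
    have "\<xi> (\<phi> + \<psi>) = \<xi> \<phi> + \<xi> \<psi>" if "\<phi> \<in> dual_carrier" "\<psi> \<in> dual_carrier" for \<phi> \<psi>
      using D(1)[OF that] that unfolding \<xi>_def by (simp only: if_True plus_fun_apply)
    moreover have "\<xi> (c *\<^sub>C \<phi>) = c *\<^sub>C \<xi> \<phi>" if "\<phi> \<in> dual_carrier" for c \<phi>
      using D(2)[OF that, of c] that unfolding \<xi>_def by (simp only: if_True) (simp add: scaleC_fun_def)
    moreover have "\<exists>C. \<forall>\<phi>\<in>dual_carrier. cmod (\<xi> \<phi>) \<le> C * nrm (dual_space whole_space) \<phi>"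
      using le by blast
    moreover have "\<xi> \<phi> = 0" if "\<phi> \<notin> dual_carrier" for \<phi> using that by (simp add: \<xi>_def)
    ultimately show ?thesis
      unfolding dual_space_def[of "dual_space whole_space"] bounded_ops_def
      by (simp add: whole_space_def[where 'a = complex])
  qed
  have eq: "nrm (dual_space (dual_space whole_space)) \<xi>
      = (SUP \<phi>\<in>{\<phi> \<in> dual_carrier. nrm (dual_space whole_space) \<phi> \<le> 1}. cmod (\<xi> \<phi>))"
    by (simp add: dual_space_def[of "dual_space whole_space"] op_norm_def whole_space_def[where 'a = complex])
  show "nrm (dual_space (dual_space whole_space)) \<xi> \<le> norm y"
    unfolding eq
  proof (rule cSUP_least)
    have zero: "0 \<in> (dual_carrier :: ('f \<Rightarrow> complex) set)" by (rule complex_vector.subspace_0[OF subspace_dual_carrier])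
    moreover have "nrm (dual_space whole_space) (0 :: 'f \<Rightarrow> complex) \<le> 1"
      by (rule dual_carrier_op_norm(3)[OF zero]) auto
    ultimately show "{\<phi> \<in> dual_carrier :: ('f \<Rightarrow> complex) set. nrm (dual_space whole_space) \<phi> \<le> 1} \<noteq> {}" by blast
    fix \<phi> :: "'f \<Rightarrow> complex" assume \<phi>: "\<phi> \<in> {\<phi> \<in> dual_carrier. nrm (dual_space whole_space) \<phi> \<le> 1}"
    then have "cmod (\<xi> \<phi>) \<le> norm y * nrm (dual_space whole_space) \<phi>" using le by blast
    also have "\<dots> \<le> norm y * 1" using \<phi> by (intro mult_left_mono) auto
    finally show "cmod (\<xi> \<phi>) \<le> norm y" by simp
  qed
qed

section \<open>Weighted norms and composition with functionals\<close>

lemma nrm_H_weighted_leI: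
  assumes "0 \<le> B" "\<And>x. x \<in> U \<Longrightarrow> v x * norm (g x) \<le> B"
  shows "nrm (H_weighted U v) g \<le> B"
  unfolding H_weighted_def using assms by (auto intro!: cSup_least)

lemma le_nrm_H_weighted:
  assumes "g \<in> carrier (H_weighted U v)" "x \<in> U"
  shows "v x * norm (g x) \<le> nrm (H_weighted U v) g"
  using assms unfolding H_weighted_def by (auto intro!: cSup_upper)

lemma bounded_linear_dual_carrier:
  assumes "\<phi> \<in> dual_carrier"
  shows "bounded_linear \<phi>"
proof -
  obtain L where L: "0 \<le> L" "\<And>x. cmod (\<phi> x) \<le> L * norm x" using dual_carrier_bound[OF assms] by blast
  show ?thesis
  proof (rule bounded_linear_intro)
    show "\<phi> (x + y) = \<phi> x + \<phi> y" for x y by (rule dual_carrier_add[OF assms])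
    show "\<phi> (r *\<^sub>R x) = r *\<^sub>R \<phi> x" for r x
      by (simp only: scaleC_of_real[symmetric] dual_carrier_scaleC[OF assms] scaleC_complex_def)
    show "norm (\<phi> x) \<le> norm x * L" for x using L(2)[of x] by (simp add: mult.commute)
  qed
qed

lemma holomorphic_map_dual_comp:
  assumes \<phi>: "\<phi> \<in> dual_carrier" and f: "holomorphic_map f U"
  shows "holomorphic_map (\<lambda>x. \<phi> (f x)) U"
  unfolding holomorphic_map_def
proof
  fix x assume x: "x \<in> U"
  obtain D where D: "(f has_derivative D) (at x) \<and> (\<forall>c h. D (c *\<^sub>C h) = c *\<^sub>C D h)"
    using bspec[OF f[unfolded holomorphic_map_def] x] ..
  have "((\<lambda>x. \<phi> (f x)) has_derivative (\<lambda>h. \<phi> (D h))) (at x)"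
    by (rule bounded_linear.has_derivative[OF bounded_linear_dual_carrier[OF \<phi>] conjunct1[OF D]])
  moreover have "\<phi> (D (c *\<^sub>C h)) = c *\<^sub>C \<phi> (D h)" for c h
    using D dual_carrier_scaleC[OF \<phi>] by (simp add: scaleC_complex_def)
  ultimately show "\<exists>D. ((\<lambda>x. \<phi> (f x)) has_derivative D) (at x) \<and> (\<forall>c h. D (c *\<^sub>C h) = c *\<^sub>C D h)"
    by (intro exI[of _ "\<lambda>h. \<phi> (D h)"] conjI allI)
qed

section \<open>The factorization theorem\<close>

lemma p_compact_imp_factorization:
  fixes U :: "'e::complex_normed_vector set" and f :: "'e \<Rightarrow> 'f::complex_normed_vector"
  assumes U: "open U" and v: "is_weight U v" and p: "1 \<le> p" and f: "f \<in> carrier (H_weighted U v)"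
    and x: "x \<in> carrier (ell p whole_space)" and conv: "(\<lambda>z. v z *\<^sub>R f z) ` U \<subseteq> p_conv p x"
  shows "\<exists>M R S. closed_subspace (ell_scalar p) M \<and>
       R \<in> quasi_nuclear p (dual_space (whole_space :: 'f nspace)) (subspace_of (ell_scalar p) M) \<and>
       S \<in> bounded_ops (subspace_of (ell_scalar p) M) (H_weighted U v :: ('e \<Rightarrow> complex) nspace) \<and>
       transpose_map f = S \<circ> R"
proof -
  let ?D = "dual_carrier :: ('f \<Rightarrow> complex) set"
  have vpos: "0 < v z" if "z \<in> U" for z using v that by (simp add: is_weight_def)
  have f_hol: "holomorphic_map f U" and f0: "\<And>z. z \<notin> U \<Longrightarrow> f z = 0"
    using f by (auto simp: H_weighted_def)
  have x_sm: "summable (\<lambda>n. norm (x n) powr p)" using x by (simp add: ell_def whole_space_def)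
  have "\<forall>z\<in>U. \<exists>a. a \<in> coeff_ball p \<and> (\<lambda>n. a n *\<^sub>C x n) sums (v z *\<^sub>R f z)"
    using conv by (auto simp: p_conv_def)
  \<comment> \<open>The coefficients are chosen separately for each z, without any regularity in z;
    holomorphy of the functions \<open>S m\<close> therefore has to come from approximation.\<close>
  then obtain a where a: "\<And>z. z \<in> U \<Longrightarrow> a z \<in> coeff_ball p"
    "\<And>z. z \<in> U \<Longrightarrow> (\<lambda>n. a z n *\<^sub>C x n) sums (v z *\<^sub>R f z)" by metis
  have aD: "a z \<in> dual_ball p" if "z \<in> U" for z using a(1)[OF that] coeff_ball_subset_dual_ball[OF p] by blast
  have \<phi>x: "summable (\<lambda>n. cmod (\<phi> (x n)) powr p)"
    "lp_norm p (\<lambda>n. cmod (\<phi> (x n))) \<le> nrm (dual_space whole_space) \<phi> * lp_norm p (\<lambda>n. norm (x n))"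
    if \<phi>: "\<phi> \<in> ?D" for \<phi>
  proof -
    note sc = lp_norm_scale[OF p dual_carrier_op_norm(1)[OF \<phi>] norm_ge_zero x_sm]
    note m = lp_norm_mono[OF p sc(1) norm_ge_zero dual_carrier_op_norm(2)[OF \<phi>]]
    show "summable (\<lambda>n. cmod (\<phi> (x n)) powr p)" by (rule m(1))
    show "lp_norm p (\<lambda>n. cmod (\<phi> (x n))) \<le> nrm (dual_space whole_space) \<phi> * lp_norm p (\<lambda>n. norm (x n))"
      using m(2) sc(2) by simp
  qed
  define ev where "ev \<phi> = (\<lambda>n. \<phi> (x n))" for \<phi> :: "'f \<Rightarrow> complex"
  have ev_add: "ev (\<phi> + \<psi>) = ev \<phi> + ev \<psi>" for \<phi> \<psi> by (auto simp: ev_def)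
  have ev_scale: "ev (c *\<^sub>C \<phi>) = c *\<^sub>C ev \<phi>" for c \<phi> by (simp add: ev_def scaleC_fun_def)
  note D = complex_vector.subspace_0[OF subspace_dual_carrier] complex_vector.subspace_add[OF subspace_dual_carrier]
    complex_vector.subspace_scale[OF subspace_dual_carrier]
  have W: "complex_vector.subspace (ev ` ?D)"
    unfolding complex_vector.subspace_def
  proof (intro conjI ballI allI)
    have "ev 0 = 0" by (auto simp: ev_def)
    then show "0 \<in> ev ` ?D" using D(1) by (metis imageI)
  next
    fix w w' assume "w \<in> ev ` ?D" "w' \<in> ev ` ?D"
    then obtain \<phi> \<psi> where "\<phi> \<in> ?D" "w = ev \<phi>" "\<psi> \<in> ?D" "w' = ev \<psi>" by blast
    then show "w + w' \<in> ev ` ?D" using D(2) by (metis ev_add imageI)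
  next
    fix c w assume "w \<in> ev ` ?D"
    then obtain \<phi> where "\<phi> \<in> ?D" "w = ev \<phi>" by blast
    then show "c *\<^sub>C w \<in> ev ` ?D" using D(3) by (metis ev_scale imageI)
  qed
  have W_sub: "ev ` ?D \<subseteq> carrier (ell_scalar p)"
    using \<phi>x(1) by (auto simp: carrier_ell_scalar ev_def)
  define M where "M = ell_closure p (ev ` ?D)"
  have M: "closed_subspace (ell_scalar p) M" and evM: "ev ` ?D \<subseteq> M"
    unfolding M_def using closed_subspace_ell_closure[OF p W W_sub] by blast+
  have M_sub: "complex_vector.subspace M" using M by (simp add: closed_subspace_def)
  have M_sm: "summable (\<lambda>n. cmod (m n) powr p)" if "m \<in> M" for m
    using that by (simp add: M_def ell_closure_def carrier_ell_scalar)
  define R where "R \<phi> = (if \<phi> \<in> ?D then ev \<phi> else 0)" for \<phi>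
  \<comment> \<open>This is v z times the future value of \<open>S m\<close> at z. On the range of
    \<open>ev\<close> it equals v z times \<phi> (f z) for every choice of coefficients.\<close>
  define s where "s z m = (\<Sum>n. a z n * m n)" for z and m :: "nat \<Rightarrow> complex"
  note s_sm = dual_ball_sums(1)[OF aD p M_sm]
  have s_le: "cmod (s z m) \<le> nrm (ell_scalar p) m" if "z \<in> U" "m \<in> M" for z m
    unfolding s_def nrm_ell_scalar by (rule dual_ball_sums(2)[OF aD[OF that(1)] p M_sm[OF that(2)]])
  have s_add: "s z (m + m') = s z m + s z m'" if "z \<in> U" "m \<in> M" "m' \<in> M" for z m m'
    using suminf_add[OF s_sm[OF that(1,2)] s_sm[OF that(1,3)]] by (simp add: s_def distrib_left)
  have s_diff: "s z (m - m') = s z m - s z m'" if "z \<in> U" "m \<in> M" "m' \<in> M" for z m m'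
    using suminf_diff[OF s_sm[OF that(1,2)] s_sm[OF that(1,3)]] by (simp add: s_def right_diff_distrib)
  have s_scale: "s z (c *\<^sub>C m) = c * s z m" if "z \<in> U" "m \<in> M" for z m c
    using suminf_mult[OF s_sm[OF that], of c]
    by (simp add: s_def scaleC_fun_def scaleC_complex_def mult.left_commute)
  have s_ev: "s z (ev \<phi>) = of_real (v z) * \<phi> (f z)" if "z \<in> U" "\<phi> \<in> ?D" for z \<phi>
  proof -
    have "(\<lambda>n. \<phi> (a z n *\<^sub>C x n)) sums \<phi> (v z *\<^sub>R f z)"
      by (rule bounded_linear.sums[OF bounded_linear_dual_carrier[OF that(2)] a(2)[OF that(1)]])
    then have "(\<lambda>n. a z n * \<phi> (x n)) sums (of_real (v z) * \<phi> (f z))"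
      by (simp only: dual_carrier_scaleC[OF that(2)] scaleC_of_real[symmetric])
    then show ?thesis by (simp add: s_def ev_def sums_iff)
  qed
  define S where "S m = (\<lambda>z. if m \<in> M \<and> z \<in> U then s z m / of_real (v z) else 0)" for m
  have S_ev: "S (ev \<phi>) = (\<lambda>z. \<phi> (f z))" if "\<phi> \<in> ?D" for \<phi>
  proof
    fix z
    show "S (ev \<phi>) z = \<phi> (f z)"
    proof (cases "z \<in> U")
      case True
      then show ?thesis using s_ev[OF True that] vpos[OF True] evM that by (auto simp: S_def)
    next
      case False
      then show ?thesis using f0 dual_carrier_0[OF that] by (simp add: S_def)
    qed
  qed
  \<comment> \<open>Division by the weight in \<open>S\<close> cancels the weight in the norm, so
    \<open>S\<close> has norm at most one.\<close>
  have vS: "v z * cmod (S m z) = cmod (s z m)" if "m \<in> M" "z \<in> U" for m z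
    using that vpos[OF that(2)] by (simp add: S_def norm_divide)
  have S_hol: "holomorphic_map (S m) U" if m: "m \<in> M" for m
  proof -
    \<comment> \<open>Elements of M are limits of sequences \<open>ev (\<phi> k)\<close>, whose
      images are the holomorphic functions \<open>\<phi> k\<close> composed with f; contractivity of
      \<open>S\<close> makes these converge in the weighted norm.\<close>
    have "\<exists>\<phi>. \<phi> \<in> ?D \<and> nrm (ell_scalar p) (m - ev \<phi>) < inverse (real (Suc k))" for k
    proof -
      have "0 < inverse (real (Suc k))" by simp
      then show ?thesis using m unfolding M_def ell_closure_def by blast
    qed
    then obtain \<phi> where \<phi>: "\<And>k. \<phi> k \<in> ?D" "\<And>k. nrm (ell_scalar p) (m - ev (\<phi> k)) < inverse (real (Suc k))"
      by metis
    have evk: "ev (\<phi> k) \<in> M" for k using evM \<phi>(1) by blast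
    show ?thesis
    proof (rule holomorphic_map_weighted_limit[OF U v])
      show "holomorphic_map (\<lambda>z. \<phi> k (f z)) U" for k by (rule holomorphic_map_dual_comp[OF \<phi>(1) f_hol])
      fix e :: real assume "0 < e"
      then obtain N where N: "inverse (real (Suc N)) < e" using reals_Archimedean by blast
      have "v z * cmod (\<phi> k (f z) - S m z) \<le> e" if "k \<ge> N" "z \<in> U" for k z
      proof -
        have "\<phi> k (f z) = s z (ev (\<phi> k)) / of_real (v z)" "S m z = s z m / of_real (v z)"
          using s_ev[OF that(2) \<phi>(1)[of k]] vpos[OF that(2)] m that(2) by (simp_all add: S_def)
        then have "\<phi> k (f z) - S m z = - (s z (m - ev (\<phi> k)) / of_real (v z))"
          unfolding s_diff[OF that(2) m evk[of k]] by (simp add: diff_divide_distrib)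
        then have "v z * cmod (\<phi> k (f z) - S m z) = cmod (s z (m - ev (\<phi> k)))"
          using vpos[OF that(2)] by (simp add: norm_divide)
        also have "\<dots> \<le> nrm (ell_scalar p) (m - ev (\<phi> k))"
          by (intro s_le that(2) complex_vector.subspace_diff[OF M_sub m evk])
        also have "\<dots> \<le> inverse (real (Suc k))" using \<phi>(2)[of k] by simp
        also have "\<dots> \<le> inverse (real (Suc N))" using that(1) by (intro le_imp_inverse_le) auto
        finally show ?thesis using N by simp
      qed
      then show "\<exists>N. \<forall>k\<ge>N. \<forall>z\<in>U. v z * cmod (\<phi> k (f z) - S m z) \<le> e" by blast
    qed
  qed
  have S_carrier: "S m \<in> carrier (H_weighted U v)" if m: "m \<in> M" for m
  proof -
    have "bdd_above ((\<lambda>z. v z * cmod (S m z)) ` U)"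
      by (rule bdd_aboveI2[of _ _ "nrm (ell_scalar p) m"]) (simp add: vS[OF m] s_le[OF _ m])
    then show ?thesis using S_hol[OF m] by (simp add: H_weighted_def S_def)
  qed
  have S_bounded: "nrm (H_weighted U v) (S m) \<le> 1 * nrm (ell_scalar p) m" if m: "m \<in> M" for m
    by (rule nrm_H_weighted_leI)
      (simp_all add: vS[OF m] s_le[OF _ m] nrm_ell_scalar lp_norm_nonneg s_le[OF _ m, unfolded nrm_ell_scalar])
  have "S \<in> bounded_ops (subspace_of (ell_scalar p) M) (H_weighted U v)"
    unfolding bounded_ops_def subspace_of_def nspace.select_convs
  proof (intro CollectI conjI ballI allI impI)
    show "S m \<in> carrier (H_weighted U v)" if "m \<in> M" for m by (rule S_carrier[OF that])
    show "S (m + m') = S m + S m'" if "m \<in> M" "m' \<in> M" for m m'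
      using complex_vector.subspace_add[OF M_sub that] that s_add[OF _ that]
      by (auto simp: S_def fun_eq_iff add_divide_distrib)
    show "S (c *\<^sub>C m) = c *\<^sub>C S m" if "m \<in> M" for c m
      using complex_vector.subspace_scale[OF M_sub that, of c] that s_scale[OF _ that]
      by (auto simp: S_def fun_eq_iff scaleC_fun_def scaleC_complex_def)
    show "\<exists>C. \<forall>m\<in>M. nrm (H_weighted U v) (S m) \<le> C * nrm (ell_scalar p) m"
      using S_bounded by blast
    show "S m = 0" if "m \<notin> M" for m using that by (auto simp: S_def)
  qed
  moreover have "R \<in> quasi_nuclear p (dual_space whole_space) (subspace_of (ell_scalar p) M)"
    unfolding quasi_nuclear_def
  proof (intro CollectI conjI)
    show "R \<in> bounded_ops (dual_space whole_space) (subspace_of (ell_scalar p) M)"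
      unfolding bounded_ops_def
    proof (intro CollectI conjI ballI allI impI)
      fix \<phi> assume \<phi>: "\<phi> \<in> ?D"
      show "R \<phi> \<in> carrier (subspace_of (ell_scalar p) M)" using \<phi> evM by (auto simp: R_def subspace_of_def)
      show "R (\<phi> + \<psi>) = R \<phi> + R \<psi>" if \<psi>: "\<psi> \<in> ?D" for \<psi>
        using \<phi> \<psi> D(2)[OF \<phi> \<psi>] unfolding R_def by (simp only: if_True ev_add)
      show "R (c *\<^sub>C \<phi>) = c *\<^sub>C R \<phi>" for c
        using \<phi> D(3)[OF \<phi>, of c] unfolding R_def by (simp only: if_True ev_scale)
    next
      show "\<exists>C. \<forall>\<phi>\<in>?D. nrm (subspace_of (ell_scalar p) M) (R \<phi>) \<le> C * nrm (dual_space whole_space) \<phi>"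
        using \<phi>x(2)
        by (intro exI[of _ "lp_norm p (\<lambda>n. norm (x n))"])
          (simp add: subspace_of_def nrm_ell_scalar R_def ev_def mult.commute)
    qed (simp add: R_def)
    \<comment> \<open>The evaluations at the points \<open>x n\<close>; with them the quasi
      p-nuclear estimate for \<open>R\<close> holds with equality.\<close>
    let ?\<xi> = "\<lambda>n \<phi>. if \<phi> \<in> ?D then \<phi> (x n) else 0"
    have "?\<xi> \<in> carrier (ell p (dual_space (dual_space whole_space)))"
      unfolding ell_def nspace.select_convs
    proof (intro CollectI conjI allI)
      show "?\<xi> n \<in> carrier (dual_space (dual_space whole_space))" for n by (rule bidual_carrier_eval(1))
      show "summable (\<lambda>n. nrm (dual_space (dual_space whole_space)) (?\<xi> n) powr p)"
        by (rule lp_norm_mono(1)[OF p x_sm mem_bidual_carrier(1)[OF bidual_carrier_eval(1)] bidual_carrier_eval(2)])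
    qed
    then show "\<exists>\<xi>\<in>carrier (ell p (dual_space (dual_space whole_space))).
        \<forall>\<phi>\<in>?D. nrm (subspace_of (ell_scalar p) M) (R \<phi>) \<le> (\<Sum>n. cmod (\<xi> n \<phi>) powr p) powr (1 / p)"
      by (rule bexI[rotated]) (simp add: R_def subspace_of_def nrm_ell_scalar lp_norm_def ev_def)
  qed
  moreover have "transpose_map f = S \<circ> R"
  proof
    fix \<phi> :: "'f \<Rightarrow> complex"
    \<comment> \<open>Off the dual, \<open>R\<close> takes the value 0 and
      \<open>transpose_map f\<close> is 0, so the factorization holds there as well.\<close>
    have "S 0 = 0"
      using s_scale[of _ 0 0] complex_vector.subspace_0[OF M_sub] by (auto simp: S_def fun_eq_iff)
    then show "transpose_map f \<phi> = (S \<circ> R) \<phi>"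
      using S_ev[of \<phi>] by (auto simp: transpose_map_def R_def)
  qed
  ultimately show ?thesis using M by blast
qed

text \<open>The value of \<open>S (R \<phi>)\<close> at z is \<phi> (f z). Multiplied by v z it is
  bounded by the weighted norm, hence by a bound for \<open>S\<close> times the p-norm of the values
  \<open>\<xi> n \<phi>\<close>; the bound is absorbed into the functionals.\<close>

lemma factorization_imp_p_compact:
  fixes U :: "'e::complex_normed_vector set" and f :: "'e \<Rightarrow> 'f::complex_banach"
  assumes v: "is_weight U v" and p: "1 \<le> p"
    and R: "R \<in> quasi_nuclear p (dual_space (whole_space :: 'f nspace)) (subspace_of (ell_scalar p) M)"
    and S: "S \<in> bounded_ops (subspace_of (ell_scalar p) M) (H_weighted U v :: ('e \<Rightarrow> complex) nspace)"
    and fac: "transpose_map f = S \<circ> R"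
  shows "relatively_p_compact p ((\<lambda>z. v z *\<^sub>R f z) ` U)"
proof -
  let ?D = "dual_carrier :: ('f \<Rightarrow> complex) set"
  let ?nn = "nrm (dual_space (dual_space (whole_space :: 'f nspace)))"
  have RM: "R \<phi> \<in> M" if "\<phi> \<in> ?D" for \<phi>
    using R that by (simp add: quasi_nuclear_def bounded_ops_def subspace_of_def)
  obtain \<xi> where \<xi>: "\<xi> \<in> carrier (ell p (dual_space (dual_space (whole_space :: 'f nspace))))"
    and R\<xi>: "\<forall>\<phi>\<in>?D. nrm (subspace_of (ell_scalar p) M) (R \<phi>) \<le> (\<Sum>n. cmod (\<xi> n \<phi>) powr p) powr (1 / p)"
    using R unfolding quasi_nuclear_def by blast
  have \<xi>c: "\<xi> n \<in> carrier (dual_space (dual_space whole_space))" and \<xi>_sm: "summable (\<lambda>n. ?nn (\<xi> n) powr p)" for n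
    using \<xi> by (simp_all add: ell_def)
  have "\<exists>C. \<forall>m\<in>M. nrm (H_weighted U v) (S m) \<le> C * nrm (ell_scalar p) m"
    using S by (simp add: bounded_ops_def subspace_of_def)
  then obtain C0 where C0: "\<forall>m\<in>M. nrm (H_weighted U v) (S m) \<le> C0 * nrm (ell_scalar p) m" ..
  \<comment> \<open>The constant of a bounded operator comes without a sign; its modulus can be used
    as a factor in estimates.\<close>
  define C where "C = \<bar>C0\<bar>"
  have C: "0 \<le> C" by (simp add: C_def)
  define \<zeta> where "\<zeta> n \<phi> = of_real C * \<xi> n \<phi>" for n \<phi>
  \<comment> \<open>The summand (1/2)^n is p-summable and keeps the bounds strictly positive when
    \<open>C\<close> or a norm vanishes.\<close>
  define c where "c n = C * ?nn (\<xi> n) + (1/2) ^ n" for n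
  have c: "0 < c n" for n
    unfolding c_def using C mem_bidual_carrier(1)[OF \<xi>c] by (intro add_nonneg_pos) auto
  have half: "summable (\<lambda>n. ((1/2::real) ^ n) powr p)"
  proof (rule summable_comparison_test')
    show "summable (\<lambda>n. (1/2::real) ^ n)" by (rule summable_geometric) simp
    show "norm (((1/2::real) ^ n) powr p) \<le> (1/2) ^ n" if "n \<ge> 0" for n
      using powr_mono'[of 1 p "(1/2::real) ^ n"] p by (simp add: power_le_one)
  qed
  have c_sm: "summable (\<lambda>n. c n powr p)"
    unfolding c_def
    using C mem_bidual_carrier(1)[OF \<xi>c]
    by (intro lp_norm_add(1)[OF p _ _ lp_norm_scale(1)[OF p C _ \<xi>_sm] half]) auto
  have \<zeta>: "bidual_bound (c n) (\<zeta> n)" for n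
    unfolding \<zeta>_def
    by (rule bidual_bound_mono[OF bidual_bound_scale[OF mem_bidual_carrier(2)[OF \<xi>c] C]]) (simp add: c_def)
  have "(\<lambda>z. v z *\<^sub>R f z) ` U \<subseteq> polar_set p \<zeta>"
  proof
    fix k assume "k \<in> (\<lambda>z. v z *\<^sub>R f z) ` U"
    then obtain z where z: "z \<in> U" "k = v z *\<^sub>R f z" by blast
    have vz: "0 < v z" using v z(1) by (simp add: is_weight_def)
    show "k \<in> polar_set p \<zeta>"
      unfolding polar_set_def
    proof (intro CollectI ballI)
      fix \<phi> assume \<phi>: "\<phi> \<in> ?D"
      have SR: "S (R \<phi>) = \<phi> \<circ> f" using fun_cong[OF fac, of \<phi>] \<phi> by (simp add: transpose_map_def)
      have "S (R \<phi>) \<in> carrier (H_weighted U v)"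
        using S RM[OF \<phi>] by (simp add: bounded_ops_def subspace_of_def)
      have "cmod (\<phi> k) = v z * cmod (S (R \<phi>) z)"
        using vz unfolding z(2) SR scaleC_of_real[symmetric] dual_carrier_scaleC[OF \<phi>] by (simp add: norm_mult)
      also have "\<dots> \<le> nrm (H_weighted U v) (S (R \<phi>))"
        by (rule le_nrm_H_weighted) fact+
      also have "\<dots> \<le> C0 * nrm (ell_scalar p) (R \<phi>)" using C0 RM[OF \<phi>] by blast
      also have "\<dots> \<le> C * nrm (ell_scalar p) (R \<phi>)"
        by (intro mult_right_mono) (auto simp: C_def nrm_ell_scalar lp_norm_nonneg)
      also have "\<dots> \<le> C * lp_norm p (\<lambda>n. cmod (\<xi> n \<phi>))"
        using R\<xi> \<phi> C by (intro mult_left_mono) (auto simp: lp_norm_def subspace_of_def)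
      also have "\<dots> = lp_norm p (\<lambda>n. cmod (\<zeta> n \<phi>))"
      proof -
        have b1: "bidual_bound (?nn (\<xi> n) + (1/2) ^ n) (\<xi> n)" for n
          by (rule bidual_bound_mono[OF mem_bidual_carrier(2)[OF \<xi>c]]) simp
        have b2: "0 < ?nn (\<xi> n) + (1/2) ^ n" for n
          using mem_bidual_carrier(1)[OF \<xi>c] by (intro add_nonneg_pos) auto
        have b3: "summable (\<lambda>n. (?nn (\<xi> n) + (1/2) ^ n) powr p)"
          by (intro lp_norm_add(1)[OF p _ _ \<xi>_sm half]) (auto simp: mem_bidual_carrier(1)[OF \<xi>c])
        have "summable (\<lambda>n. cmod (\<xi> n \<phi>) powr p)"
          by (rule bidual_bound_summable(1)[OF p b2 b3 b1 \<phi>])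
        from lp_norm_scale(2)[OF p C norm_ge_zero this] show ?thesis
          using C by (simp add: \<zeta>_def norm_mult)
      qed
      finally show "cmod (\<phi> k) \<le> lp_norm p (\<lambda>n. cmod (\<zeta> n \<phi>))" .
    qed
  qed
  then show ?thesis
    using polar_set_relatively_p_compact[OF p c c_sm \<zeta>] unfolding relatively_p_compact_def by blast
qed

theorem corollary2p19:
  fixes U :: "'e::complex_banach set"
    and v :: "'e \<Rightarrow> real"
    and p :: real
    and f :: "'e \<Rightarrow> 'f::complex_banach"
  assumes "open U"
    and "is_weight U v"
    and "1 \<le> p"
    and "f \<in> carrier (H_weighted U v)"
  shows "f \<in> H_weighted_p_compact p U v \<longleftrightarrow>
    (\<exists>M R S. closed_subspace (ell_scalar p) M \<and>
       R \<in> quasi_nuclear p (dual_space (whole_space :: 'f nspace)) (subspace_of (ell_scalar p) M) \<and>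
       S \<in> bounded_ops (subspace_of (ell_scalar p) M)
             (H_weighted U v :: ('e \<Rightarrow> complex) nspace) \<and>
       transpose_map f = S \<circ> R)"
proof
  assume "f \<in> H_weighted_p_compact p U v"
  then obtain x where "x \<in> carrier (ell p whole_space)" "(\<lambda>z. v z *\<^sub>R f z) ` U \<subseteq> p_conv p x"
    by (auto simp: H_weighted_p_compact_def relatively_p_compact_def)
  from p_compact_imp_factorization[OF assms this]
  show "\<exists>M R S. closed_subspace (ell_scalar p) M \<and>
       R \<in> quasi_nuclear p (dual_space (whole_space :: 'f nspace)) (subspace_of (ell_scalar p) M) \<and>
       S \<in> bounded_ops (subspace_of (ell_scalar p) M) (H_weighted U v :: ('e \<Rightarrow> complex) nspace) \<and>
       transpose_map f = S \<circ> R" .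
next
  assume "\<exists>M R S. closed_subspace (ell_scalar p) M \<and>
       R \<in> quasi_nuclear p (dual_space (whole_space :: 'f nspace)) (subspace_of (ell_scalar p) M) \<and>
       S \<in> bounded_ops (subspace_of (ell_scalar p) M) (H_weighted U v :: ('e \<Rightarrow> complex) nspace) \<and>
       transpose_map f = S \<circ> R"
  then obtain M R S
    where "R \<in> quasi_nuclear p (dual_space (whole_space :: 'f nspace)) (subspace_of (ell_scalar p) M)"
      "S \<in> bounded_ops (subspace_of (ell_scalar p) M) (H_weighted U v :: ('e \<Rightarrow> complex) nspace)"
      "transpose_map f = S \<circ> R"
    by blast
  from factorization_imp_p_compact[OF assms(2,3) this]
  show "f \<in> H_weighted_p_compact p U v" using assms(4) by (simp add: H_weighted_p_compact_def)
qed

end
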